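(* Let $\mathfrak{e}\subset\mathbb{C}$ be a compact, simply connected (not necessarily connected) set and let $N\subset\mathbb{C}$ be an open, connected, simply connected set such that $C(N\cap\mathfrak{e})>0$ and such that $N\cap\mathfrak{e}$ has two-dimensional Lebesgue measure zero. Let $\mu_n$ be the normalized zero counting measure of the Chebyshev polynomial $T_n^{(\mathfrak{e})}$ and let $\mu_{\mathfrak{e}}$ be the equilibrium measure of $\mathfrak{e}$. Then, as $n\to\infty$, the restriction of $\mu_n$ to $N$ converges weakly to the restriction of $\mu_{\mathfrak{e}}$ to $N$.
   Context: For a compact, not finite, set $\mathfrak{e}\subset\mathbb{C}$, $\|f\|_{\mathfrak{e}}=\sup_{z\in\mathfrak{e}}|f(z)|$, and the Chebyshev polynomial $T_n^{(\mathfrak{e})}$ is the unique monic polynomial of degree $n$ minimizing $\|P\|_{\mathfrak{e}}$ over all monic polynomials $P$ of degree $n$. If $w_1,\dots,w_n$ are the zeros of $T_n^{(\mathfrak{e})}$ counting multiplicity, then $\mu_n=\frac1n\sum_{j=1}^n\delta_{w_j}$. $C(\cdot)$ denotes logarithmic capacity and $\mu_{\mathfrak{e}}$ the (potential theoretic, logarithmic) equilibrium measure of $\mathfrak{e}$. A compact set $\mathfrak{e}$ is called simply connected if $\mathbb{C}\setminus\mathfrak{e}$ is connected. Weak convergence of measures on the open set $N$ means convergence of integrals of every continuous function with compact support in $N$. *)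

theory Defs
  imports "HOL-Probability.Probability" "HOL-Computational_Algebra.Polynomial"
begin

definition supnorm_on :: "complex set \<Rightarrow> (complex \<Rightarrow> complex) \<Rightarrow> real" where
  "supnorm_on E f = (SUP z\<in>E. cmod (f z))"

definition monic_of_degree :: "nat \<Rightarrow> complex poly \<Rightarrow> bool" where
  "monic_of_degree n p \<longleftrightarrow> degree p = n \<and> lead_coeff p = 1"

definition chebyshev_poly :: "complex set \<Rightarrow> nat \<Rightarrow> complex poly" where
  "chebyshev_poly E n = (THE p. monic_of_degree n p \<and>
     (\<forall>q. monic_of_degree n q \<longrightarrow> supnorm_on E (poly p) \<le> supnorm_on E (poly q)))"

text \<open>
  For a complex polynomial of degree \<open>n \<ge> 1\<close>, the multiset of zeros has size \<open>n\<close>, so that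
  \<open>pmf_of_multiset\<close> gives each zero \<open>w\<close> the mass \<open>order w p / n\<close>.  The \<open>distr\<close> only
  restricts the resulting discrete measure to the Borel sets.  For \<open>n = 0\<close> the value is
  unspecified.
\<close>

definition zero_counting_measure :: "complex poly \<Rightarrow> complex measure" where
  "zero_counting_measure p = distr (measure_pmf (pmf_of_multiset (proots p))) borel (\<lambda>z. z)"

definition log_kernel :: "complex \<Rightarrow> complex \<Rightarrow> ereal" where
  "log_kernel z w = (if z = w then \<infinity> else ereal (ln (1 / cmod (z - w))))"

text \<open>
  The energy \<open>\<integral>\<integral> log (1 / \<bar>z - w\<bar>) d\<mu> d\<mu>\<close> takes values in \<open>(-\<infinity>, \<infinity>]\<close> for compactly
  supported finite measures.  It is written as the integral of the positive part
  minus the integral of the negative part, since the Bochner integral is 0 on functions that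
  are not integrable.  Note that \<open>e2ennreal\<close> sends negative values to 0.
\<close>

definition log_energy :: "complex measure \<Rightarrow> ereal" where
  "log_energy \<mu> =
     enn2ereal (\<integral>\<^sup>+z. (\<integral>\<^sup>+w. e2ennreal (log_kernel z w) \<partial>\<mu>) \<partial>\<mu>) -
     enn2ereal (\<integral>\<^sup>+z. (\<integral>\<^sup>+w. e2ennreal (- log_kernel z w) \<partial>\<mu>) \<partial>\<mu>)"

text \<open>Borel probability measures whose support is a compact subset of \<open>E\<close>.\<close>

definition compact_prob_measures :: "complex set \<Rightarrow> complex measure set" where
  "compact_prob_measures E = {\<mu>. sets \<mu> = sets borel \<and> prob_space \<mu> \<and>
     (\<exists>K. compact K \<and> K \<subseteq> E \<and> emeasure \<mu> (- K) = 0)}"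

text \<open>
  Logarithmic capacity of an arbitrary set, \<open>sup exp (- I(\<mu>))\<close>, with \<open>exp (-\<infinity>) = 0\<close>.  The
  energies occurring here are never \<open>-\<infinity>\<close>, by compactness of the supports.
\<close>

definition log_capacity :: "complex set \<Rightarrow> ennreal" where
  "log_capacity E = (SUP \<mu>\<in>compact_prob_measures E.
     if log_energy \<mu> = \<infinity> then 0 else ennreal (exp (- real_of_ereal (log_energy \<mu>))))"

text \<open>Well defined for compact sets of positive capacity.\<close>

definition equilibrium_measure :: "complex set \<Rightarrow> complex measure" where
  "equilibrium_measure E = (THE \<mu>. \<mu> \<in> compact_prob_measures E \<and>
     (\<forall>\<nu>\<in>compact_prob_measures E. log_energy \<mu> \<le> log_energy \<nu>))"

text \<open>
  The test functions are continuous with compact support inside \<open>N\<close>, extended by 0 to the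
  whole plane.
\<close>

definition weakly_converges_on ::
  "complex set \<Rightarrow> (nat \<Rightarrow> complex measure) \<Rightarrow> complex measure \<Rightarrow> bool" where
  "weakly_converges_on N M \<mu> \<longleftrightarrow>
     (\<forall>f :: complex \<Rightarrow> real. continuous_on UNIV f \<longrightarrow> compact (closure {z. f z \<noteq> 0}) \<longrightarrow>
        closure {z. f z \<noteq> 0} \<subseteq> N \<longrightarrow>
        (\<lambda>n. \<integral>z. f z \<partial>M n) \<longlonglongrightarrow> (\<integral>z. f z \<partial>\<mu>))"

end

theory Submission
  imports Defs "HOL-Complex_Analysis.Complex_Analysis" "HOL-Computational_Algebra.Fundamental_Theorem_Algebra"
begin

text \<open>
  The proof compares logarithmic potentials.  For a probability measure \<open>\<nu>\<close> let
  \<open>log_pot \<nu> z = \<integral> ln \<bar>z - w\<bar> d\<nu>(w)\<close>; for the zero counting measure \<open>\<nu>\<^sub>n\<close> of the Chebyshev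
  polynomial \<open>T\<^sub>n\<close> this is \<open>ln \<bar>T\<^sub>n(z)\<bar> / n\<close>.  Let \<open>\<mu>\<close> be a measure of minimal energy \<open>I\<close> on \<open>E\<close>.  The
  energy is computed with the kernel \<open>ln (D / \<bar>z - w\<bar>)\<close>, where \<open>E\<close> lies in the disc of radius
  \<open>D / 4\<close>, so that the kernel is nonnegative on \<open>E\<close>.  With this kernel the minimal energy is
  \<open>a = I + ln D\<close>, and \<open>ln D - a = -I\<close> is the logarithm of the capacity of \<open>E\<close>.

  \<^item> Frostman's theorem: \<open>log_pot \<mu> \<ge> -I\<close> off the support of \<open>\<mu>\<close>, and \<open>log_pot \<mu> = -I\<close> at almost
    every point of \<open>E\<close> (\<open>log_pot_ge_off_support\<close>, \<open>log_pot_eq_AE_E\<close>).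

  \<^item> Fekete points are nearly energy minimal, and products over them compete with \<open>T\<^sub>n\<close>.  Hence
    \<open>excess n = ln \<parallel>T\<^sub>n\<parallel> / n + I\<close> has nonpositive upper limit (\<open>chebyshev_norm_upper\<close>).

  \<^item> By the maximum principle, \<open>gap n = log_pot \<mu> + excess n - log_pot \<nu>\<^sub>n\<close> is nonnegative off \<open>E\<close>
    (\<open>bernstein_walsh\<close>, \<open>gap_nonneg\<close>), and it is superharmonic there.  All measures involved live
    in the disc of radius \<open>D / 4\<close>, so that their potentials have the same mean over an annulus
    outside it; the mean of the gap over the annulus is therefore \<open>excess n\<close>, which tends to 0.
    A nonnegative superharmonic function with small mean over one disc has small means over
    the neighbouring discs, and so the gap tends to 0 in mean along the connected
    complement of \<open>E\<close> (\<open>gap_vanishes_everywhere\<close>).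

  \<^item> Thus \<open>log_pot \<nu>\<^sub>n\<close> tends to \<open>log_pot \<mu>\<close> in \<open>L\<^sup>1\<close> of each compact set off \<open>E\<close>.  Translates of the
    logarithm are uniformly integrable in the plane, which extends this to compact sets that
    meet \<open>E\<close> in a null set (\<open>potential_L1_null\<close>), in particular to the compact subsets of \<open>N\<close>.

  \<^item> Convergence of potentials gives convergence of measures: the mean of the logarithm over a
    disc about \<open>z\<close> minus its value at \<open>z\<close> is a nonnegative function of \<open>z\<close> with compact support.
    Convolution of a test function with this bump is nearly a multiple of the test function,
    and its integral against \<open>\<nu>\<close> is an integral of the potential of \<open>\<nu>\<close>
    (\<open>test_function_by_log_potential\<close>).

  A minimizer exists by weak compactness and lower semicontinuity of the energy.  It is unique,
  so that it is the equilibrium measure: by Frostman's theorem the potentials of two minimizers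
  agree almost everywhere on \<open>E\<close>, off \<open>E\<close> both are the limit of \<open>log_pot \<nu>\<^sub>n\<close>, and a measure is
  determined by its potential.
\<close>

section \<open>Circular means and integrability of the logarithm\<close>

text \<open>
  The plane is identified with \<open>real^2\<close> in order to use the invariance of Lebesgue measure under
  orthogonal transformations, which is a theorem about \<open>real^'n\<close>.
\<close>

lemma lborel_complex_eq_distr:
  "(lborel :: complex measure) = distr (lborel :: (real^2) measure) borel (\<lambda>v. Complex (v$1) (v$2))"
proof (rule lborel_eqI)
  let ?f = "\<lambda>v::real^2. Complex (v$1) (v$2)"
  have meas: "?f \<in> borel_measurable borel"
    by (intro borel_measurable_continuous_onI) (auto simp: Complex_eq intro!: continuous_intros)
  fix l u :: complex
  assume le: "\<And>b. b \<in> Basis \<Longrightarrow> l \<bullet> b \<le> u \<bullet> b"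
  have re: "Re l \<le> Re u" and im: "Im l \<le> Im u"
    using le[of 1] le[of \<i>] by (auto simp: Basis_complex_def)
  let ?L = "vector [Re l, Im l] :: real^2" and ?U = "vector [Re u, Im u] :: real^2"
  have pre: "?f -` box l u = box ?L ?U"
    by (auto simp: box_def Basis_complex_def Basis_vec_def inner_axis forall_2 exhaust_2)
  have "emeasure (distr lborel borel ?f) (box l u) = emeasure lborel (box ?L ?U)"
    using meas by (subst emeasure_distr) (auto simp: pre)
  also have "\<dots> = ennreal (\<Prod>b\<in>Basis. (?U - ?L) \<bullet> b)"
  proof (rule emeasure_lborel_box)
    fix b :: "real^2" assume "b \<in> Basis"
    then obtain i :: 2 where "b = axis i 1" by (auto simp: Basis_vec_def)
    then show "?L \<bullet> b \<le> ?U \<bullet> b" using re im exhaust_2[of i] by (auto simp: inner_axis)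
  qed
  also have "(\<Prod>b\<in>Basis. (?U - ?L) \<bullet> b) = (\<Prod>i\<in>UNIV. (?U - ?L) $ i)"
  proof -
    have B: "(Basis::(real^2) set) = (\<lambda>i. axis i 1) ` UNIV" by (auto simp: Basis_vec_def)
    have inj: "inj_on (\<lambda>i::2. axis i (1::real)) UNIV" by (auto simp: inj_on_def axis_eq_axis)
    show ?thesis unfolding B by (subst prod.reindex[OF inj]) (simp add: inner_axis)
  qed
  also have "\<dots> = (\<Prod>b\<in>Basis. (u - l) \<bullet> b)"
    by (simp add: UNIV_2 Basis_complex_def)
  finally show "emeasure (distr lborel borel ?f) (box l u) = ennreal (\<Prod>b\<in>Basis. (u - l) \<bullet> b)"  .
qed simp

lemma lborel_complex_rotation:
  assumes u: "cmod u = 1"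
  shows "distr lborel borel (\<lambda>z. u * z) = (lborel :: complex measure)"
proof -
  let ?f = "\<lambda>v::real^2. Complex (v$1) (v$2)"
  let ?g = "\<lambda>z. vector [Re z, Im z] :: real^2"
  have gf: "?g (?f v) = v" for v by (simp add: vec_eq_iff forall_2)
  have fg: "?f (?g z) = z" for z by simp
  have meas: "?f \<in> borel_measurable borel"
    by (intro borel_measurable_continuous_onI) (auto simp: Complex_eq intro!: continuous_intros)
  define T where "T = (\<lambda>v. ?g (inverse u * ?f v))"
  have lin: "linear T"
  proof (rule linearI)
    fix v w :: "real^2" and c :: real
    have f: "?f (v + w) = ?f v + ?f w" "?f (c *\<^sub>R v) = c *\<^sub>R ?f v" by (simp_all add: complex_eq_iff)
    have g: "?g (x + y) = ?g x + ?g y" "?g (c *\<^sub>R x) = c *\<^sub>R ?g x" for x y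
      by (simp_all add: vec_eq_iff forall_2)
    show "T (v + w) = T v + T w" "T (c *\<^sub>R v) = c *\<^sub>R T v"
      unfolding T_def by (simp_all only: f g distrib_left mult_scaleR_right)
  qed
  have nrm: "norm (?g z) = cmod z" for z
    by (simp add: norm_vec_def L2_set_def UNIV_2 cmod_def)
  have nrmf: "cmod (?f v) = norm v" for v using nrm[of "?f v"] gf by simp
  have orth: "orthogonal_transformation T"
  proof -
    have "norm (T v) = norm v" for v
      unfolding T_def nrm norm_mult norm_inverse u nrmf by simp
    then show ?thesis unfolding orthogonal_transformation using lin by simp
  qed
  have "lborel = distr lborel borel (\<lambda>z. u * z :: complex)"
  proof (rule lborel_eqI)
    fix l r :: complex
    assume le: "\<And>b. b \<in> Basis \<Longrightarrow> l \<bullet> b \<le> r \<bullet> b"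
    have eqb: "emeasure (lborel::(real^2) measure) (?f -` box l r) = emeasure lborel (box l r)"
    proof -
      have "emeasure lborel (box l r) = emeasure (distr lborel borel ?f) (box l r)"
        by (simp only: lborel_complex_eq_distr[symmetric])
      also have "\<dots> = emeasure (lborel::(real^2) measure) (?f -` box l r)"
        using meas by (subst emeasure_distr) auto
      finally show ?thesis by simp
    qed
    have fin: "?f -` box l r \<in> lmeasurable"
    proof (rule fmeasurableI)
      have "?f -` box l r \<inter> space borel \<in> sets borel" by (rule measurable_sets[OF meas]) auto
      then show "?f -` box l r \<in> sets lebesgue" by simp
      have "emeasure lebesgue (?f -` box l r) = emeasure lborel (?f -` box l r)"
        using measurable_sets[OF meas, of "box l r"] by (subst emeasure_completion) auto
      also have "\<dots> < \<infinity>" unfolding eqb using emeasure_lborel_box_finite by auto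
      finally show "emeasure lebesgue (?f -` box l r) < \<infinity>" .
    qed
    have pre: "?f -` ((\<lambda>z. u * z) -` box l r) = T ` (?f -` box l r)"
    proof (intro equalityI subsetI)
      fix v assume "v \<in> ?f -` ((\<lambda>z. u * z) -` box l r)"
      then have "u * ?f v \<in> box l r" by (simp only: vimage_eq)
      then have A: "?g (u * ?f v) \<in> ?f -` box l r" unfolding vimage_eq by (subst fg)
      have B: "T (?g (u * ?f v)) = v" unfolding T_def fg using u gf[of v]
        by (metis (no_types, lifting) left_inverse mult.assoc mult_1 norm_zero zero_neq_one)
      from imageI[OF A, of T] show "v \<in> T ` (?f -` box l r)" unfolding B .
    next
      fix v assume "v \<in> T ` (?f -` box l r)"
      then obtain x where x: "x \<in> ?f -` box l r" "v = T x" by auto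
      have "u * ?f v = ?f x" unfolding x T_def fg using u
        by (metis (no_types, lifting) right_inverse mult.assoc mult_1 norm_zero zero_neq_one)
      with x(1) show "v \<in> ?f -` ((\<lambda>z. u * z) -` box l r)" by (simp only: vimage_eq)
    qed
    have mu: "(\<lambda>z. u * z) \<in> borel_measurable borel" by measurable
    have ms: "?f -` ((\<lambda>z. u * z) -` box l r) \<in> sets borel"
      using measurable_sets[OF meas measurable_sets[OF mu, of "box l r"]] by auto
    have "emeasure (distr lborel borel (\<lambda>z. u * z)) (box l r) = emeasure lborel ((\<lambda>z. u * z) -` box l r)"
      using mu by (subst emeasure_distr) auto
    also have "\<dots> = emeasure (lborel::(real^2) measure) (?f -` ((\<lambda>z. u * z) -` box l r))"
      using measurable_sets[OF mu, of "box l r"]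
      by (subst lborel_complex_eq_distr, subst emeasure_distr) (use meas in auto)
    also have "\<dots> = emeasure lebesgue (T ` (?f -` box l r))"
      using ms by (subst emeasure_completion) (auto simp: pre)
    also have "\<dots> = measure lebesgue (T ` (?f -` box l r))"
      using measurable_orthogonal_image[OF orth fin] by (intro emeasure_eq_measure2) (auto simp: fmeasurable_def)
    also have "\<dots> = measure lebesgue (?f -` box l r)"
      using measure_orthogonal_image[OF orth fin] by simp
    also have "\<dots> = emeasure lebesgue (?f -` box l r)"
      using fin by (intro emeasure_eq_measure2[symmetric]) (auto simp: fmeasurable_def)
    also have "\<dots> = emeasure lborel (?f -` box l r)"
        using measurable_sets[OF meas, of "box l r"] by (subst emeasure_completion) auto
    also have "\<dots> = emeasure lborel (box l r)" by (rule eqb)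
    also have "\<dots> = ennreal (\<Prod>b\<in>Basis. (r - l) \<bullet> b)"
      by (rule emeasure_lborel_box) (use le in auto)
    finally show "emeasure (distr lborel borel (\<lambda>z. u * z)) (box l r) = ennreal (\<Prod>b\<in>Basis. (r - l) \<bullet> b)" .
  qed simp
  then show ?thesis by simp
qed


lemma integral_lborel_rotation:
  fixes f :: "complex \<Rightarrow> real"
  assumes u: "cmod u = 1" and f: "f \<in> borel_measurable borel"
  shows "(LINT z|lborel. f (u * z)) = (LINT z|lborel. f z)"
proof -
  have "(LINT z|lborel. f z) = (LINT z|distr lborel borel (\<lambda>z. u * z). f z)"
    using lborel_complex_rotation[OF u] by simp
  also have "\<dots> = (LINT z|lborel. f (u * z))"
    by (rule integral_distr) (use f in auto)
  finally show ?thesis by simp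
qed

lemma integrable_lborel_rotation:
  fixes f :: "complex \<Rightarrow> real"
  assumes u: "cmod u = 1" and f: "integrable lborel f"
  shows "integrable lborel (\<lambda>z. f (u * z))"
proof -
  have "integrable (distr lborel borel (\<lambda>z. u * z)) f"
    using lborel_complex_rotation[OF u] f by simp
  then show ?thesis
    by (rule integrable_distr[rotated]) auto
qed

lemma integral_lborel_translation:
  fixes f :: "complex \<Rightarrow> real"
  assumes f: "f \<in> borel_measurable borel"
  shows "(LINT z|lborel. f (c + z)) = (LINT z|lborel. f z)"
proof -
  have "(LINT z|lborel. f z) = (LINT z|distr lborel borel ((+) c). f z)"
    by (simp add: lborel_distr_plus)
  also have "\<dots> = (LINT z|lborel. f (c + z))"
    by (rule integral_distr) (use f in auto)
  finally show ?thesis by simp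
qed

lemma integrable_lborel_translation:
  fixes f :: "complex \<Rightarrow> real"
  assumes f: "integrable lborel f"
  shows "integrable lborel (\<lambda>z. f (c + z))"
proof -
  have "integrable (distr lborel borel ((+) c)) f"
    using f by (simp add: lborel_distr_plus)
  then show ?thesis
    by (rule integrable_distr[rotated]) auto
qed

text \<open>
  The integrand is the real part of the holomorphic function \<open>Ln (1 - \<zeta> a)\<close> on the unit circle,
  and this function vanishes at 0.
\<close>

lemma circle_mean_log_unit:
  assumes a: "cmod a < 1"
  shows "((\<lambda>t. ln (cmod (1 - exp (2 * of_real pi * \<i> * of_real t) * a))) has_integral 0) {0..1}"
proof -
  let ?f = "\<lambda>\<zeta>. Ln (1 - \<zeta> * a)"
  have pos: "0 < Re (1 - \<zeta> * a)" if "cmod \<zeta> \<le> 1" for \<zeta>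
  proof -
    have "Re (\<zeta> * a) \<le> cmod (\<zeta> * a)" by (rule complex_Re_le_cmod)
    also have "\<dots> \<le> 1 * cmod a" unfolding norm_mult by (intro mult_right_mono that) auto
    finally show ?thesis using a by simp
  qed
  have nn: "1 - \<zeta> * a \<notin> \<real>\<^sub>\<le>\<^sub>0" if "cmod \<zeta> \<le> 1" for \<zeta>
    using pos[OF that] by (auto simp: complex_nonpos_Reals_iff)
  have "?f holomorphic_on cball 0 1"
    by (intro holomorphic_intros) (use nn in auto)
  from Cauchy_integral_circlepath_simple[OF this, of 0]
  have "((\<lambda>u. ?f u / (u - 0)) has_contour_integral 0) (circlepath 0 1)" by simp
  then have "((\<lambda>t. ?f (circlepath 0 1 t) / circlepath 0 1 t * vector_derivative (circlepath 0 1) (at t within {0..1})) has_integral 0) {0..1}"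
    unfolding has_contour_integral_def by simp
  moreover have "?f (circlepath 0 1 t) / circlepath 0 1 t * vector_derivative (circlepath 0 1) (at t within {0..1})
     = (2 * pi * \<i>) * ?f (exp (2 * of_real pi * \<i> * of_real t))" if "t \<in> {0..1}" for t
    using that by (subst vector_derivative_circlepath01) (auto simp: circlepath)
  ultimately have "((\<lambda>t. (2 * pi * \<i>) * ?f (exp (2 * of_real pi * \<i> * of_real t))) has_integral 0) {0..1}"
    by (metis (no_types, lifting) has_integral_cong)
  then have "((\<lambda>t. inverse (2 * pi * \<i>) * ((2 * pi * \<i>) * ?f (exp (2 * of_real pi * \<i> * of_real t)))) has_integral inverse (2 * pi * \<i>) * 0) {0..1}"
    by (rule has_integral_mult_right)
  then have "((\<lambda>t. ?f (exp (2 * of_real pi * \<i> * of_real t))) has_integral 0) {0..1}"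
    by (simp add: field_simps)
  then have "((\<lambda>t. Re (?f (exp (2 * of_real pi * \<i> * of_real t)))) has_integral Re 0) {0..1}"
    using has_integral_linear[OF _ bounded_linear_Re] unfolding o_def by blast
  moreover have "Re (?f (exp (2 * of_real pi * \<i> * of_real t))) = ln (cmod (1 - exp (2 * of_real pi * \<i> * of_real t) * a))" for t
  proof (rule Re_Ln)
    have "cmod (exp (2 * of_real pi * \<i> * of_real t)) = 1" by (simp add: norm_exp_eq_Re)
    from pos[OF eq_refl[OF this]] show "1 - exp (2 * of_real pi * \<i> * of_real t) * a \<noteq> 0" by (metis less_irrefl zero_complex.sel(1))
  qed
  ultimately show ?thesis by simp
qed

text \<open>
  Jensen's formula for a linear polynomial; the factor of larger modulus is taken out of
  \<open>e z - w\<close>.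
\<close>

lemma circle_mean_log:
  assumes "z \<noteq> 0" "w \<noteq> 0" "cmod z \<noteq> cmod w"
  shows "((\<lambda>t. ln (cmod (exp (2 * of_real pi * \<i> * of_real t) * z - w))) has_integral ln (max (cmod z) (cmod w))) {0..1}"
proof (cases "cmod z < cmod w")
  case True
  let ?e = "\<lambda>t::real. exp (2 * of_real pi * \<i> * of_real t)"
  have a: "cmod (z / w) < 1" using True assms by (simp add: norm_divide)
  have "ln (cmod (?e t * z - w)) = ln (cmod (1 - ?e t * (z/w))) + ln (cmod w)" for t
  proof -
    have c: "cmod (?e t) = 1" by (simp add: norm_exp_eq_Re)
    have ne: "1 - ?e t * (z/w) \<noteq> 0"
    proof
      assume "1 - ?e t * (z/w) = 0"
      then have "cmod (?e t * (z/w)) = 1" by simp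
      moreover have "cmod (?e t * (z/w)) = cmod (z/w)" unfolding norm_mult c by simp
      ultimately show False using a by linarith
    qed
    have "?e t * z - w = - (w * (1 - ?e t * (z/w)))" using assms by (simp add: field_simps)
    then have "cmod (?e t * z - w) = cmod w * cmod (1 - ?e t * (z/w))" by (simp only: norm_minus_cancel norm_mult)
    then show ?thesis using ne assms by (simp add: ln_mult)
  qed
  moreover have "((\<lambda>t. ln (cmod (1 - ?e t * (z/w))) + ln (cmod w)) has_integral 0 + ln (cmod w)) {0..1}"
    by (intro has_integral_add circle_mean_log_unit a) (use has_integral_const_real[of "ln (cmod w)" 0 1] in simp)
  ultimately show ?thesis using True by (simp add: max_def)
next
  case False
  let ?e = "\<lambda>t::real. exp (2 * of_real pi * \<i> * of_real t)"
  define a where "a = cnj (w / z)"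
  have a: "cmod a < 1" using False assms by (simp add: a_def norm_divide)
  have "ln (cmod (?e t * z - w)) = ln (cmod (1 - ?e t * a)) + ln (cmod z)" for t
  proof -
    have c: "cmod (?e t) = 1" by (simp add: norm_exp_eq_Re)
    have ne: "1 - ?e t * a \<noteq> 0"
    proof
      assume "1 - ?e t * a = 0"
      then have "cmod (?e t * a) = 1" by simp
      with a c show False by (simp add: norm_mult)
    qed
    have cc: "?e t * cnj (?e t) = 1" using c by (simp add: complex_norm_square[symmetric])
    have "cmod (1 - ?e t * a) = cmod (cnj (1 - ?e t * a))" by (rule complex_mod_cnj[symmetric])
    also have "cnj (1 - ?e t * a) = 1 - cnj (?e t) * (w/z)" by (simp add: a_def)
    also have "cmod \<dots> = cmod (?e t * z) * cmod (1 - cnj (?e t) * (w/z)) / cmod z" using c assms by (simp add: norm_mult)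
    also have "cmod (?e t * z) * cmod (1 - cnj (?e t) * (w/z)) = cmod (?e t * z - (?e t * cnj (?e t)) * w)"
    proof -
      have "?e t * z * (1 - cnj (?e t) * (w/z)) = ?e t * z - (?e t * cnj (?e t)) * w"
        using assms(1) by (simp add: right_diff_distrib)
      from arg_cong[OF this, of cmod] show ?thesis by (simp only: norm_mult)
    qed
    finally have "cmod (?e t * z - w) = cmod z * cmod (1 - ?e t * a)" using assms cc by (simp add: field_simps)
    then show ?thesis using ne assms by (simp add: ln_mult)
  qed
  moreover have "((\<lambda>t. ln (cmod (1 - ?e t * a)) + ln (cmod z)) has_integral 0 + ln (cmod z)) {0..1}"
    by (intro has_integral_add circle_mean_log_unit a) (use has_integral_const_real[of "ln (cmod z)" 0 1] in simp)
  ultimately show ?thesis using False by (simp add: max_def)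
qed

text \<open>
  On the dyadic annulus of inner radius \<open>2\<^sup>-\<^sup>k\<^sup>-\<^sup>1\<close> the integrand is at most \<open>k + 1\<close>, and the areas of the
  discs of radius \<open>2\<^sup>-\<^sup>k\<close> decrease like \<open>4\<^sup>-\<^sup>k\<close>.
\<close>

lemma nn_integral_log_ball_finite:
  "(\<integral>\<^sup>+z. indicator (ball (0::complex) 1) z * ennreal (- ln (cmod z)) \<partial>lborel) < \<infinity>"
proof -
  have [measurable]: "ball (0::complex) r \<in> sets borel" for r by simp
  let ?g = "\<lambda>k z. ennreal (real k + 1) * indicator (ball (0::complex) ((1/2)^k)) z"
  have pw: "indicator (ball 0 1) z * ennreal (- ln (cmod z)) \<le> (\<Sum>k. ?g k z)" for z :: complex
  proof (cases "z \<in> ball 0 1 \<and> z \<noteq> 0")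
    case True
    define k where "k = (LEAST k. (1/2::real)^Suc k \<le> cmod z)"
    have "\<exists>k. (1/2::real)^k < cmod z" using True by (intro real_arch_pow_inv) auto
    then obtain k' where "(1/2::real)^k' < cmod z" by blast
    moreover have "(1/2::real)^Suc k' \<le> (1/2)^k'" by (rule power_decreasing) auto
    ultimately have "(1/2::real)^Suc k' \<le> cmod z" by linarith
    then have k1: "(1/2::real)^Suc k \<le> cmod z" unfolding k_def by (rule LeastI)
    have k2: "cmod z < (1/2)^k"
    proof (cases k)
      case 0 then show ?thesis using True by simp
    next
      case (Suc j)
      then have "j < k" by simp
      from not_less_Least[OF this[unfolded k_def]] have "\<not> (1/2::real)^Suc j \<le> cmod z" .
      with Suc show ?thesis by (simp only: not_le)
    qed
    have "- ln (cmod z) \<le> - ln ((1/2)^Suc k)" using k1 True by (subst neg_le_iff_le, subst ln_le_cancel_iff) auto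
    also have "\<dots> = (real k + 1) * ln 2" by (subst ln_realpow) (auto simp: ln_div algebra_simps)
    also have "\<dots> \<le> (real k + 1) * 1" using ln_2_less_1 by (intro mult_left_mono) auto
    finally have "ennreal (- ln (cmod z)) \<le> ennreal (real k + 1)" by (intro ennreal_leI) simp
    then have "ennreal (- ln (cmod z)) \<le> ?g k z" using k2 by (simp del: ennreal_plus)
    also have "?g k z \<le> (\<Sum>j. ?g j z)"
    proof -
      define G where "G = (\<lambda>j. ?g j z)"
      have "sum G {k} \<le> suminf G" by (rule sum_le_suminf) auto
      then have "G k \<le> suminf G" by simp
      then show ?thesis by (simp only: G_def)
    qed
    finally show ?thesis using True by simp
  qed (auto simp: indicator_def)
  have "(\<integral>\<^sup>+z. indicator (ball (0::complex) 1) z * ennreal (- ln (cmod z)) \<partial>lborel) \<le> (\<integral>\<^sup>+z. (\<Sum>k. ?g k z) \<partial>lborel)"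
    by (intro nn_integral_mono pw)
  also have "\<dots> = (\<Sum>k. \<integral>\<^sup>+z. ?g k z \<partial>lborel)"
    by (rule nn_integral_suminf) measurable
  also have "\<dots> = (\<Sum>k. ennreal ((real k + 1) * (pi * (1/4)^k)))"
  proof (rule suminf_cong)
    fix k
    have "(\<integral>\<^sup>+z. ?g k z \<partial>lborel) = ennreal (real k + 1) * emeasure lborel (ball (0::complex) ((1/2)^k))"
      by (subst nn_integral_cmult) auto
    also have "emeasure lborel (ball (0::complex) ((1/2)^k)) = ennreal (pi * ((1/2)^k)^2)"
      by (subst emeasure_ball) (auto simp: unit_ball_vol_2)
    also have "((1/2::real)^k)^2 = (1/4)^k" by (simp add: power2_eq_square power_mult_distrib[symmetric])
    finally show "(\<integral>\<^sup>+z. ?g k z \<partial>lborel) = ennreal ((real k + 1) * (pi * (1/4)^k))"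
      by (simp add: ennreal_mult')
  qed
  also have "\<dots> < \<infinity>"
  proof -
    have s1: "summable (\<lambda>k. real (Suc k) * (1/4::real)^k)"
    proof (rule summable_comparison_test')
      show "summable (\<lambda>k. (1/2::real)^k)" by (rule summable_geometric) auto
      fix k
      have "real (Suc k) \<le> 2 ^ k" by (induction k) auto
      then have "real (Suc k) * (1/4)^k \<le> 2^k * (1/4)^k" by (intro mult_right_mono) auto
      also have "\<dots> = (1/2)^k" by (simp flip: power_mult_distrib)
      finally show "norm (real (Suc k) * (1/4)^k) \<le> (1/2)^k" by simp
    qed
    have "summable (\<lambda>k. pi * (real (Suc k) * (1/4::real)^k))" by (rule summable_mult[OF s1])
    then have "summable (\<lambda>k. (real k + 1) * (pi * (1/4::real)^k))" by (simp add: mult_ac add_ac)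
    then show ?thesis by (subst suminf_ennreal2) auto
  qed
  finally show ?thesis .
qed


lemma integrable_log_ball:
  "integrable lborel (\<lambda>z. indicator (ball (0::complex) r) z * ln (cmod z))"
proof -
  have [measurable]: "ball (0::complex) r \<in> sets borel" for r by simp
  have 1: "integrable lborel (\<lambda>z. indicator (ball (0::complex) 1) z * ln (cmod z))"
  proof (rule integrableI_bounded)
    have "(\<integral>\<^sup>+z. ennreal (norm (indicator (ball (0::complex) 1) z * ln (cmod z))) \<partial>lborel)
        = (\<integral>\<^sup>+z. indicator (ball (0::complex) 1) z * ennreal (- ln (cmod z)) \<partial>lborel)"
    proof (rule nn_integral_cong)
      fix z :: complex
      show "ennreal (norm (indicator (ball 0 1) z * ln (cmod z))) = indicator (ball 0 1) z * ennreal (- ln (cmod z))"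
        by (cases "z = 0") (auto simp: indicator_def abs_if)
    qed
    with nn_integral_log_ball_finite
    show "(\<integral>\<^sup>+z. ennreal (norm (indicator (ball (0::complex) 1) z * ln (cmod z))) \<partial>lborel) < \<infinity>" by simp
  qed measurable
  have 2: "integrable lborel (\<lambda>z. indicator (ball (0::complex) r) z * ln (max 1 (cmod z)))"
  proof (rule Bochner_Integration.integrable_bound)
    show "integrable lborel (\<lambda>z. (max 1 r) * indicator (ball (0::complex) r) z :: real)"
      by (intro integrable_mult_right integrable_real_indicator) (use emeasure_lborel_ball_finite[of "0::complex" r] in auto)
    show "AE z in lborel. norm (indicator (ball (0::complex) r) z * ln (max 1 (cmod z))) \<le> norm (max 1 r * indicator (ball (0::complex) r) z)"
    proof (intro AE_I2)
      fix z :: complex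
      have "ln (max 1 (cmod z)) \<le> max 1 (cmod z)" by (meson less_imp_le ln_less_self max.strict_coboundedI1 zero_less_one)
      moreover have "0 \<le> ln (max 1 (cmod z))" by simp
      ultimately show "norm (indicator (ball (0::complex) r) z * ln (max 1 (cmod z))) \<le> norm (max 1 r * indicator (ball (0::complex) r) z)"
        by (auto simp: indicator_def)
    qed
  qed measurable
  have "integrable lborel (\<lambda>z. indicator (ball (0::complex) r) z * (indicator (ball (0::complex) 1) z * ln (cmod z)) + indicator (ball (0::complex) r) z * ln (max 1 (cmod z)))"
    using integrable_mult_indicator[OF _ 1, of "ball 0 r"] by (intro Bochner_Integration.integrable_add 2) simp
  moreover have "(\<lambda>z. indicator (ball (0::complex) r) z * (indicator (ball (0::complex) 1) z * ln (cmod z)) + indicator (ball (0::complex) r) z * ln (max 1 (cmod z)))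
     = (\<lambda>z. indicator (ball (0::complex) r) z * ln (cmod z))"
    by (auto simp: indicator_def fun_eq_iff max_def)
  ultimately show ?thesis by simp
qed

lemma integrable_log_bounded:
  fixes g :: "complex \<Rightarrow> real"
  assumes g: "g \<in> borel_measurable borel" and b: "\<And>z. \<bar>g z\<bar> \<le> B" and s: "\<And>z. cmod z \<ge> R \<Longrightarrow> g z = 0"
  shows "integrable lborel (\<lambda>z. g z * ln (cmod (z - w)))"
proof -
  have B: "0 \<le> B" using b[of 0] by linarith
  have "integrable lborel (\<lambda>z. indicator (ball 0 (R + cmod w)) (-w + z) * ln (cmod (-w + z)))"
    by (rule integrable_lborel_translation[OF integrable_log_ball])
  then have "integrable lborel (\<lambda>z. B * (indicator (ball 0 (R + cmod w)) (z - w) * ln (cmod (z - w))))"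
    by (intro integrable_mult_right) simp
  then show ?thesis
  proof (rule Bochner_Integration.integrable_bound)
    show "AE z in lborel. norm (g z * ln (cmod (z - w))) \<le> norm (B * (indicator (ball 0 (R + cmod w)) (z - w) * ln (cmod (z - w))))"
    proof (intro AE_I2)
      fix z
      show "norm (g z * ln (cmod (z - w))) \<le> norm (B * (indicator (ball 0 (R + cmod w)) (z - w) * ln (cmod (z - w))))"
      proof (cases "cmod z \<ge> R")
        case False
        then have "z - w \<in> ball 0 (R + cmod w)" using norm_triangle_ineq4[of z w] by (simp add: dist_norm norm_minus_commute)
        then show ?thesis using b[of z] B by (auto simp: abs_mult intro!: mult_right_mono)
      qed (simp add: s)
    qed
    show "(\<lambda>z. g z * ln (cmod (z - w))) \<in> borel_measurable lborel" using g by measurable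
  qed
qed

text \<open>
  The translates of the logarithm are uniformly integrable: moving \<open>w\<close> to the origin reduces the
  claim to the absolute continuity of the integral of the single function \<open>\<bar>ln \<bar>z\<bar>\<bar>\<close>.
\<close>

lemma integral_abs_log_small:
  assumes e: "e > 0"
  obtains d where "d > 0" "\<And>G w. G \<in> sets borel \<Longrightarrow> G \<subseteq> ball 0 R \<Longrightarrow> measure lborel G < d \<Longrightarrow> cmod w \<le> R \<Longrightarrow>
     (LINT z|lborel. indicator G z * \<bar>ln (cmod (z - w))\<bar>) \<le> e"
proof -
  have [measurable]: "ball (0::complex) r \<in> sets borel" for r by simp
  define g where "g = (\<lambda>z. indicator (ball (0::complex) (2*R)) z * \<bar>ln (cmod z)\<bar>)"
  have gi: "integrable lborel g"
    using integrable_abs[OF integrable_log_ball[of "2*R"]] by (simp add: g_def abs_mult)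
  have gm: "g \<in> borel_measurable borel" unfolding g_def by measurable
  have gp: "g z \<ge> 0" for z by (simp add: g_def)
  have mi: "integrable lborel (\<lambda>z. min (g z) (real k))" for k
    by (rule Bochner_Integration.integrable_bound[OF gi]) (use gm gp in \<open>auto simp: abs_if min_def\<close>)
  have "(\<lambda>k. LINT z|lborel. min (g z) (real k)) \<longlonglongrightarrow> (LINT z|lborel. g z)"
  proof (rule integral_dominated_convergence[where w=g])
    show "AE z in lborel. (\<lambda>k. min (g z) (real k)) \<longlonglongrightarrow> g z"
    proof (intro AE_I2)
      fix z
      obtain k0 where "g z \<le> real k0" using real_arch_simple by blast
      then have "\<forall>\<^sub>F k in sequentially. min (g z) (real k) = g z"
        unfolding eventually_sequentially by (intro exI[of _ k0]) (auto simp: min_def)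
      then show "(\<lambda>k. min (g z) (real k)) \<longlonglongrightarrow> g z" by (rule tendsto_eventually)
    qed
  qed (use gi gm gp in \<open>auto simp: abs_if min_def\<close>)
  then have "\<forall>\<^sub>F k in sequentially. dist (LINT z|lborel. min (g z) (real k)) (LINT z|lborel. g z) < e/2"
    using e by (intro tendstoD) auto
  then obtain k where k: "dist (LINT z|lborel. min (g z) (real k)) (LINT z|lborel. g z) < e/2"
    using eventually_happens by fastforce
  let ?d = "e / (2 * (real k + 1))"
  show ?thesis
  proof
    show "?d > 0" using e by simp
    fix G :: "complex set" and w
    assume G: "G \<in> sets borel" and GR: "G \<subseteq> ball 0 R" and Gd: "measure lborel G < ?d" and w: "cmod w \<le> R"
    have Gfin: "emeasure lborel G < \<infinity>"
    proof -
      have "emeasure lborel G \<le> emeasure lborel (ball (0::complex) R)" by (intro emeasure_mono GR) auto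
      then show ?thesis using emeasure_lborel_ball_finite by (metis le_less_trans)
    qed
    have iG: "integrable lborel (\<lambda>z. indicator G z :: real)" using G Gfin by (intro integrable_real_indicator) auto
    have gw: "integrable lborel (\<lambda>z. g (-w + z) - min (g (-w + z)) (real k))"
      by (rule integrable_lborel_translation[OF Bochner_Integration.integrable_diff[OF gi mi]])
    have gw1: "integrable lborel (\<lambda>z. g (-w + z))"
      by (rule integrable_lborel_translation[OF gi])
    have "(LINT z|lborel. indicator G z * \<bar>ln (cmod (z - w))\<bar>) \<le> (LINT z|lborel. (g (-w + z) - min (g (-w + z)) (real k)) + real k * indicator G z)"
    proof (rule integral_mono')
      show "integrable lborel (\<lambda>z. (g (-w + z) - min (g (-w + z)) (real k)) + real k * indicator G z)"
        by (intro Bochner_Integration.integrable_add gw integrable_mult_right iG)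
      fix z
      show "indicator G z * \<bar>ln (cmod (z - w))\<bar> \<le> (g (-w + z) - min (g (-w + z)) (real k)) + real k * indicator G z"
      proof (cases "z \<in> G")
        case True
        then have "cmod (z - w) < 2 * R" using GR w norm_triangle_ineq4[of z w] by (auto simp: dist_norm)
        then have "g (-w + z) = \<bar>ln (cmod (z - w))\<bar>" by (simp add: g_def)
        then show ?thesis using True by (auto simp: min_def)
      qed (auto simp: min_def)
      show "0 \<le> (g (-w + z) - min (g (-w + z)) (real k)) + real k * indicator G z"
        by (auto simp: min_def indicator_def)
    qed
    also have "\<dots> = (LINT z|lborel. g (-w + z) - min (g (-w + z)) (real k)) + real k * measure lborel G"
      using G by (subst Bochner_Integration.integral_add[OF gw]) (auto intro!: integrable_mult_right iG)
    also have "(LINT z|lborel. g (-w + z) - min (g (-w + z)) (real k)) = (LINT z|lborel. g z - min (g z) (real k))"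
      by (rule integral_lborel_translation[of "\<lambda>z. g z - min (g z) (real k)" "-w"])
        (use gm in simp)
    also have "\<dots> = (LINT z|lborel. g z) - (LINT z|lborel. min (g z) (real k))"
      by (rule Bochner_Integration.integral_diff[OF gi mi])
    also have "\<dots> + real k * measure lborel G \<le> e/2 + (real k + 1) * ?d"
    proof (intro add_mono mult_mono)
      show "(LINT z|lborel. g z) - (LINT z|lborel. min (g z) (real k)) \<le> e/2"
        using k unfolding dist_real_def by linarith
    qed (use Gd in auto)
    also have "\<dots> = e" using e by (simp add: field_simps)
    finally show "(LINT z|lborel. indicator G z * \<bar>ln (cmod (z - w))\<bar>) \<le> e" .
  qed
qed

lemma AE_lborel_cmod_neq: "AE z::complex in lborel. cmod (z - c) \<noteq> r"
proof -
  have "negligible (sphere c r)" by (rule negligible_sphere)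
  then have "sphere c r \<in> null_sets lborel"
    by (simp add: negligible_iff_null_sets null_sets_def)
  then show ?thesis
    by (rule AE_I') (auto simp: dist_norm norm_minus_commute)
qed

text \<open>
  The area integral does not change when \<open>z\<close> is rotated, so it equals its average over all
  rotations; after Fubini the inner integral is the circular mean of the logarithm.
\<close>

lemma integral_log_circular:
  fixes S :: "complex set"
  assumes S: "S \<in> sets borel" and b: "S \<subseteq> ball 0 R" and rot: "\<And>u z. cmod u = 1 \<Longrightarrow> u * z \<in> S \<longleftrightarrow> z \<in> S"
  shows "(LINT z|lborel. indicator S z * ln (cmod (z - w))) = (LINT z|lborel. indicator S z * ln (max (cmod z) (cmod w)))"
proof (cases "w = 0")
  case False
  let ?e = "\<lambda>t::real. exp (2 * of_real pi * \<i> * of_real t) :: complex"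
  have ce: "cmod (?e t) = 1" for t by (simp add: norm_exp_eq_Re)
  have ce_m [measurable]: "?e \<in> borel_measurable borel"
    by (intro borel_measurable_continuous_onI continuous_intros)
  define I where "I = (LINT z|lborel. indicator S z * ln (cmod (z - w)))"
  let ?G = "\<lambda>z. indicator S z * ln (cmod (z - w))"
  have Gi: "integrable lborel ?G"
    by (rule integrable_log_bounded[where B=1 and R=R]) (use S b in \<open>auto simp: indicator_def\<close>)
  have Gm: "?G \<in> borel_measurable borel" using S by measurable
  let ?F = "\<lambda>t z. indicator {0..1} t * (indicator S z * ln (cmod (?e t * z - w)))"
  have Fm: "(\<lambda>(t,z). ?F t z) \<in> borel_measurable (lborel \<Otimes>\<^sub>M lborel)"
    using S by measurable
  have eq: "?G (?e t * z) = indicator S z * ln (cmod (?e t * z - w))" for t z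
    using rot[OF ce] by (auto simp: indicator_def)

  have Fi: "integrable lborel (\<lambda>z. ?F t z)" for t
    using integrable_lborel_rotation[OF ce Gi, of t] unfolding eq by (intro integrable_mult_right)
  have FI: "integrable (lborel \<Otimes>\<^sub>M lborel) (\<lambda>(t,z). ?F t z)"
  proof (rule lborel_pair.Fubini_integrable[OF Fm])
    have "(LINT z|lborel. norm (case (t, z) of (t, z) \<Rightarrow> ?F t z)) = indicator {0..1} t * (LINT z|lborel. \<bar>?G z\<bar>)" for t
    proof -
      have "(LINT z|lborel. norm (case (t, z) of (t, z) \<Rightarrow> ?F t z)) = indicator {0..1} t * (LINT z|lborel. \<bar>?G (?e t * z)\<bar>)"
        unfolding eq by (simp add: abs_mult)
      also have "(LINT z|lborel. \<bar>?G (?e t * z)\<bar>) = (LINT z|lborel. \<bar>?G z\<bar>)"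
        by (rule integral_lborel_rotation[OF ce]) (use Gm in measurable)
      finally show ?thesis .
    qed
    then show "integrable lborel (\<lambda>t. LINT z|lborel. norm (case (t, z) of (t, z) \<Rightarrow> ?F t z))"
      by (simp add: integrable_mult_left_iff)
  qed (use Fi in auto)
  have "(LINT t|lborel. (LINT z|lborel. ?F t z)) = (LINT t|lborel. indicator {0..1::real} t * I)"
  proof -
    have "(LINT z|lborel. ?F t z) = indicator {0..1} t * I" for t
      unfolding I_def using integral_lborel_rotation[OF ce Gm, of t] unfolding eq by simp
    then show ?thesis by (simp only:)
  qed
  also have "\<dots> = I" by simp
  finally have "I = (LINT t|lborel. (LINT z|lborel. ?F t z))" ..
  also have "\<dots> = (LINT z|lborel. (LINT t|lborel. ?F t z))"
    using lborel_pair.Fubini_integral[OF FI] by simp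
  also have "\<dots> = (LINT z|lborel. indicator S z * ln (max (cmod z) (cmod w)))"
  proof (rule integral_cong_AE)
    show "AE z in lborel. (LINT t|lborel. ?F t z) = indicator S z * ln (max (cmod z) (cmod w))"
      using AE_lborel_cmod_neq[of 0 "cmod w"] AE_lborel_cmod_neq[of 0 0]
    proof eventually_elim
      case (elim z)
      then have nz: "z \<noteq> 0" "cmod z \<noteq> cmod w" by auto
      have ne: "?e t * z - w \<noteq> 0" for t
      proof
        assume "?e t * z - w = 0"
        then have "cmod (?e t * z) = cmod w" by simp
        with ce nz show False by (simp add: norm_mult)
      qed
      have cont: "continuous_on {0..1} (\<lambda>t. ln (cmod (?e t * z - w)))"
        by (intro continuous_intros) (use ne in auto)
      have "(LINT t|lborel. indicator {0..1} t * ln (cmod (?e t * z - w))) = integral {0..1} (\<lambda>t. ln (cmod (?e t * z - w)))"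
        using set_borel_integral_eq_integral(2)[OF borel_integrable_atLeastAtMost'[OF cont]]
        by (simp add: set_lebesgue_integral_def)
      also have "\<dots> = ln (max (cmod z) (cmod w))"
        by (rule integral_unique[OF circle_mean_log[OF nz(1) False nz(2)]])
      finally have "indicator S z * (LINT t|lborel. indicator {0..1} t * ln (cmod (?e t * z - w))) = indicator S z * ln (max (cmod z) (cmod w))" by simp
      also have "indicator S z * (LINT t|lborel. indicator {0..1} t * ln (cmod (?e t * z - w))) = (LINT t|lborel. ?F t z)"
        by (subst integral_mult_right_zero[symmetric]) (simp add: mult_ac)
      finally show ?case .
    qed
    show "(\<lambda>z. indicator S z * ln (max (cmod z) (cmod w))) \<in> borel_measurable lborel" using S by measurable
    show "(\<lambda>z. LINT t|lborel. ?F t z) \<in> borel_measurable lborel"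
      using S by measurable
  qed
  finally show ?thesis unfolding I_def .
qed simp


lemma integral_log_circular_about:
  fixes S :: "complex set"
  assumes S: "S \<in> sets borel" and b: "S \<subseteq> ball 0 R" and rot: "\<And>u z. cmod u = 1 \<Longrightarrow> u * z \<in> S \<longleftrightarrow> z \<in> S"
  shows "(LINT z|lborel. indicator S (z - c) * ln (cmod (z - w))) = (LINT z|lborel. indicator S z * ln (max (cmod z) (cmod (w - c))))"
proof -
  have "(LINT z|lborel. indicator S (z - c) * ln (cmod (z - w)))
      = (LINT z|lborel. indicator S (c + z - c) * ln (cmod (c + z - w)))"
    by (rule integral_lborel_translation[symmetric]) (use S in measurable)
  also have "\<dots> = (LINT z|lborel. indicator S z * ln (cmod (z - (w - c))))" by (simp add: algebra_simps)
  also have "\<dots> = (LINT z|lborel. indicator S z * ln (max (cmod z) (cmod (w - c))))"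
    by (rule integral_log_circular[OF S b rot])
  finally show ?thesis .
qed

lemma ball_mult_unit: "cmod u = 1 \<Longrightarrow> u * z \<in> ball 0 r \<longleftrightarrow> z \<in> ball (0::complex) r"
  by (simp add: norm_mult)

lemma integral_log_ball:
  assumes "w \<noteq> c"
  shows "(LINT z|lborel. indicator (ball c r) z * ln (cmod (z - w))) = (LINT z|lborel. indicator (ball 0 r) z * ln (max (cmod z) (cmod (w - c))))"
proof -
  have "indicator (ball c r) z = (indicator (ball 0 r) (z - c) :: real)" for z
    by (simp add: indicator_def dist_norm norm_minus_commute)
  then show ?thesis
    using integral_log_circular_about[of "ball 0 r" r c w] ball_mult_unit[of _ _ r] by simp
qed

lemma integrable_max_log_ball:
  assumes "s > 0"
  shows "integrable lborel (\<lambda>z. indicator (ball (0::complex) r) z * ln (max (cmod z) s))"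
proof (rule Bochner_Integration.integrable_bound)
  show "integrable lborel (\<lambda>z. indicator (ball (0::complex) r) z * (\<bar>ln s\<bar> + max r s))"
    using emeasure_lborel_ball_finite[of "0::complex" r]
    by (intro integrable_mult_left integrable_real_indicator) auto
  show "AE z in lborel. norm (indicator (ball (0::complex) r) z * ln (max (cmod z) s)) \<le> norm (indicator (ball (0::complex) r) z * (\<bar>ln s\<bar> + max r s))"
  proof (intro AE_I2)
    fix z :: complex
    show "norm (indicator (ball (0::complex) r) z * ln (max (cmod z) s)) \<le> norm (indicator (ball (0::complex) r) z * (\<bar>ln s\<bar> + max r s))"
    proof (cases "z \<in> ball 0 r")
      case True
      have "ln (max (cmod z) s) \<le> max (cmod z) s" using assms by (intro less_imp_le[OF ln_less_self]) auto
      moreover have "ln (max (cmod z) s) \<ge> ln s" using assms by auto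
      ultimately have "\<bar>ln (max (cmod z) s)\<bar> \<le> \<bar>ln s\<bar> + max r s" using True assms
      proof -
        assume 1: "ln (max (cmod z) s) \<le> max (cmod z) s" and 2: "ln s \<le> ln (max (cmod z) s)"
        have "max (cmod z) s \<le> max r s" "0 \<le> max r s" using True assms by auto
        then show ?thesis using 1 2 by linarith
      qed
      then show ?thesis using True by simp
    qed simp
  qed
  have [measurable]: "ball (0::complex) r \<in> sets borel" for r by simp
  show "(\<lambda>z. indicator (ball (0::complex) r) z * ln (max (cmod z) s)) \<in> borel_measurable lborel" by measurable
qed

text \<open>
  The logarithm is subharmonic.  At \<open>w = c\<close> the true value of the left side is \<open>-\<infinity>\<close>, but
  \<open>ln 0 = 0\<close> by convention, which is why this point is excluded.
\<close>

lemma ball_mean_log_ge: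
  assumes "w \<noteq> c"
  shows "measure lborel (ball c r) * ln (cmod (c - w)) \<le> (LINT z|lborel. indicator (ball c r) z * ln (cmod (z - w)))"
proof -
  have m: "measure lborel (ball c r) = measure lborel (ball (0::complex) r)"
    by (cases "r \<ge> 0") (simp_all add: content_ball ball_empty)
  have pos: "cmod (w - c) > 0" using assms by simp
  have "measure lborel (ball c r) * ln (cmod (c - w)) = (LINT z|lborel. indicator (ball (0::complex) r) z * ln (cmod (w - c)))"
    by (simp add: m norm_minus_commute)
  also have "\<dots> \<le> (LINT z|lborel. indicator (ball 0 r) z * ln (max (cmod z) (cmod (w - c))))"
  proof (rule integral_mono)
    show "integrable lborel (\<lambda>z. indicator (ball (0::complex) r) z * ln (cmod (w - c)))"
      using emeasure_lborel_ball_finite[of "0::complex" r] by (intro integrable_mult_left integrable_real_indicator) auto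
    show "integrable lborel (\<lambda>z. indicator (ball 0 r) z * ln (max (cmod z) (cmod (w - c))))"
      by (rule integrable_max_log_ball[OF pos])
    fix z :: complex
    show "indicator (ball 0 r) z * ln (cmod (w - c)) \<le> indicator (ball 0 r) z * ln (max (cmod z) (cmod (w - c)))"
    proof (rule mult_left_mono)
      show "ln (cmod (w - c)) \<le> ln (max (cmod z) (cmod (w - c)))"
        using pos by (subst ln_le_cancel_iff) (simp_all add: less_max_iff_disj)
    qed simp
  qed
  also have "\<dots> = (LINT z|lborel. indicator (ball c r) z * ln (cmod (z - w)))"
    by (rule integral_log_ball[OF assms, symmetric])
  finally show ?thesis .
qed

lemma ball_mean_log_eq:
  assumes "r \<le> cmod (c - w)" "w \<noteq> c"
  shows "(LINT z|lborel. indicator (ball c r) z * ln (cmod (z - w))) = measure lborel (ball c r) * ln (cmod (c - w))"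
proof -
  have m: "measure lborel (ball c r) = measure lborel (ball (0::complex) r)"
    by (cases "r \<ge> 0") (simp_all add: content_ball ball_empty)
  have "(LINT z|lborel. indicator (ball c r) z * ln (cmod (z - w))) = (LINT z|lborel. indicator (ball 0 r) z * ln (max (cmod z) (cmod (w - c))))"
    by (rule integral_log_ball[OF assms(2)])
  also have "\<dots> = (LINT z|lborel. indicator (ball (0::complex) r) z * ln (cmod (c - w)))"
    using assms by (intro Bochner_Integration.integral_cong) (auto simp: indicator_def max_def norm_minus_commute)
  finally show ?thesis by (simp add: m)
qed

text \<open>
  The mean over an annulus does not depend on the position of \<open>w\<close> in the inner disc.  Applied to
  measures on that disc, it says that all their potentials have the same mean.
\<close>

lemma annulus_mean_log:
  assumes "0 < s" "cmod w \<le> s"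
  shows "(LINT z|lborel. indicator (ball 0 r - cball 0 s) z * ln (cmod (z - w))) = (LINT z|lborel. indicator (ball 0 r - cball 0 s) z * ln (cmod z))"
proof -
  have "(LINT z|lborel. indicator (ball 0 r - cball 0 s) z * ln (cmod (z - w))) = (LINT z|lborel. indicator (ball 0 r - cball 0 s) z * ln (max (cmod z) (cmod w)))"
    by (rule integral_log_circular[where R=r]) (auto simp: norm_mult)
  also have "\<dots> = (LINT z|lborel. indicator (ball 0 r - cball 0 s) z * ln (cmod z))"
    using assms by (intro Bochner_Integration.integral_cong) (auto simp: indicator_def max_def)
  finally show ?thesis .
qed

section \<open>Logarithmic potentials\<close>

definition prob_on :: "complex set \<Rightarrow> complex measure \<Rightarrow> bool" where
  "prob_on K \<nu> \<longleftrightarrow> sets \<nu> = sets borel \<and> prob_space \<nu> \<and> emeasure \<nu> (- K) = 0"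

definition log_pot :: "complex measure \<Rightarrow> complex \<Rightarrow> real" where
  "log_pot \<nu> z = (LINT w|\<nu>. ln (cmod (z - w)))"

lemma prob_on_AE: assumes "prob_on K \<nu>" "K \<in> sets borel" shows "AE w in \<nu>. w \<in> K"
proof -
  have "- K \<in> null_sets \<nu>" using assms by (auto simp: prob_on_def null_sets_def)
  then show ?thesis by (rule AE_I') auto
qed

lemma prob_on_subset:
  assumes "prob_on K \<nu>" "K \<subseteq> K'" "K \<in> sets borel" "K' \<in> sets borel" shows "prob_on K' \<nu>"
proof -
  have "emeasure \<nu> (- K') \<le> emeasure \<nu> (- K)"
    using assms by (intro emeasure_mono) (auto simp: prob_on_def)
  then show ?thesis using assms by (auto simp: prob_on_def)
qed

text \<open>
  The integrals of \<open>\<bar>g z * ln \<bar>z - w\<bar>\<bar>\<close> over \<open>z\<close> are bounded uniformly for \<open>w\<close> in a disc.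
\<close>

lemma log_pot_Fubini:
  fixes g :: "complex \<Rightarrow> real"
  assumes \<nu>: "prob_on (cball 0 \<rho>) \<nu>"
    and g: "g \<in> borel_measurable borel" and b: "\<And>z. \<bar>g z\<bar> \<le> B" and s: "\<And>z. cmod z \<ge> R \<Longrightarrow> g z = 0"
  shows "integrable lborel (\<lambda>z. g z * log_pot \<nu> z)"
    and "(LINT z|lborel. g z * log_pot \<nu> z) = (LINT w|\<nu>. LINT z|lborel. g z * ln (cmod (z - w)))"
    and "AE z in lborel. g z \<noteq> 0 \<longrightarrow> integrable \<nu> (\<lambda>w. ln (cmod (z - w)))"
    and "integrable \<nu> (\<lambda>w. LINT z|lborel. g z * ln (cmod (z - w)))"
proof -
  have sets\<nu>: "sets \<nu> = sets borel" using \<nu> by (auto simp: prob_on_def)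
  have [measurable_cong]: "sets \<nu> = sets borel" by (rule sets\<nu>)
  interpret N: prob_space \<nu> using \<nu> by (auto simp: prob_on_def)
  interpret P: pair_sigma_finite \<nu> lborel ..
  note [measurable] = g
  let ?F = "\<lambda>(w,z). g z * ln (cmod (z - w))"
  have Fm: "?F \<in> borel_measurable (\<nu> \<Otimes>\<^sub>M lborel)" by measurable
  have Fi: "integrable lborel (\<lambda>z. g z * ln (cmod (z - w)))" for w
    by (rule integrable_log_bounded[OF g b s])
  define J where "J = (LINT z|lborel. indicator (ball (0::complex) (R + \<rho>)) z * \<bar>ln (cmod z)\<bar>)"
  have iJ: "integrable lborel (\<lambda>z. indicator (ball (0::complex) (R + \<rho>)) z * \<bar>ln (cmod z)\<bar>)"
    using integrable_abs[OF integrable_log_ball[of "R + \<rho>"]] by (simp add: abs_mult)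
  have B: "0 \<le> B" using b[of 0] by linarith
  have bd: "(LINT z|lborel. norm (g z * ln (cmod (z - w)))) \<le> B * J" if w: "cmod w \<le> \<rho>" for w
  proof -
    have "(LINT z|lborel. norm (g z * ln (cmod (z - w)))) \<le> (LINT z|lborel. B * (indicator (ball (0::complex) (R + \<rho>)) (-w + z) * \<bar>ln (cmod (-w + z))\<bar>))"
    proof (rule integral_mono)
      show "integrable lborel (\<lambda>z. norm (g z * ln (cmod (z - w))))" by (intro integrable_norm Fi)
      show "integrable lborel (\<lambda>z. B * (indicator (ball (0::complex) (R + \<rho>)) (-w + z) * \<bar>ln (cmod (-w + z))\<bar>))"
        by (intro integrable_mult_right integrable_lborel_translation[OF iJ])
      fix z
      show "norm (g z * ln (cmod (z - w))) \<le> B * (indicator (ball (0::complex) (R + \<rho>)) (-w + z) * \<bar>ln (cmod (-w + z))\<bar>)"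
      proof (cases "cmod z \<ge> R")
        case False
        then have "-w + z \<in> ball 0 (R + \<rho>)" using norm_triangle_ineq4[of z w] w by (simp add: dist_norm norm_minus_commute)
        then show ?thesis using b[of z] by (auto simp: abs_mult intro!: mult_right_mono)
      qed (simp add: s B)
    qed
    also have "\<dots> = B * J"
      unfolding J_def using integral_lborel_translation[of "\<lambda>z. indicator (ball (0::complex) (R + \<rho>)) z * \<bar>ln (cmod z)\<bar>" "-w"]
      using borel_measurable_integrable[OF iJ] by simp
    finally show ?thesis .
  qed
  have FI: "integrable (\<nu> \<Otimes>\<^sub>M lborel) ?F"
  proof (rule P.Fubini_integrable[OF Fm])
    have m: "(\<lambda>w. LINT z|lborel. norm (case (w, z) of (w, z) \<Rightarrow> g z * ln (cmod (z - w)))) \<in> borel_measurable \<nu>"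
      by measurable
    show "integrable \<nu> (\<lambda>w. LINT z|lborel. norm (case (w, z) of (w, z) \<Rightarrow> g z * ln (cmod (z - w))))"
    proof (rule N.integrable_const_bound[OF _ m])
      show "AE w in \<nu>. norm (LINT z|lborel. norm (case (w, z) of (w, z) \<Rightarrow> g z * ln (cmod (z - w)))) \<le> B * J"
        using prob_on_AE[OF \<nu> borel_closed[OF closed_cball]] by eventually_elim (use bd in auto)
    qed
    show "AE w in \<nu>. integrable lborel (\<lambda>z. case (w, z) of (w, z) \<Rightarrow> g z * ln (cmod (z - w)))" using Fi by simp
  qed
  show "integrable lborel (\<lambda>z. g z * log_pot \<nu> z)"
    using P.integrable_snd[OF FI] by (simp add: log_pot_def)
  show "(LINT z|lborel. g z * log_pot \<nu> z) = (LINT w|\<nu>. LINT z|lborel. g z * ln (cmod (z - w)))"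
    using P.Fubini_integral[OF FI] by (simp add: log_pot_def)
  show "AE z in lborel. g z \<noteq> 0 \<longrightarrow> integrable \<nu> (\<lambda>w. ln (cmod (z - w)))"
    using P.AE_integrable_snd[OF FI] by eventually_elim auto
  show "integrable \<nu> (\<lambda>w. LINT z|lborel. g z * ln (cmod (z - w)))"
    using P.integrable_fst[OF FI] by simp
qed


section \<open>Test functions in terms of potentials\<close>

definition disc_mean_log :: "real \<Rightarrow> complex \<Rightarrow> real" where
  "disc_mean_log r v = (LINT z|lborel. indicator (ball v r) z * ln (cmod z)) / measure lborel (ball (0::complex) r)"

text \<open>
  The difference between the disc mean of the logarithm and its value, a discrete Laplacian of
  the fundamental solution.  It is an approximate identity up to a constant factor.
\<close>

definition log_bump :: "real \<Rightarrow> complex \<Rightarrow> real" where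
  "log_bump r v = indicator (ball 0 r) v * (disc_mean_log r v - ln (cmod v))"

lemma measure_ball_complex: "r \<ge> 0 \<Longrightarrow> measure lborel (ball (c::complex) r) = pi * r^2"
  by (simp add: content_ball unit_ball_vol_2)

lemma indicator_ball_diff:
  fixes z y :: complex
  shows "indicator (ball 0 r) (z - y) = (indicator (ball z r) y :: real)"
    and "indicator (ball 0 r) (z - y) = (indicator (ball y r) z :: real)"
proof -
  have "z - y \<in> ball 0 r \<longleftrightarrow> y \<in> ball z r" unfolding mem_ball_0 unfolding mem_ball dist_norm ..
  moreover have "z - y \<in> ball 0 r \<longleftrightarrow> z \<in> ball y r" unfolding mem_ball_0 unfolding mem_ball dist_norm
    by (simp add: norm_minus_commute)
  ultimately show "indicator (ball 0 r) (z - y) = (indicator (ball z r) y :: real)"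
    "indicator (ball 0 r) (z - y) = (indicator (ball y r) z :: real)"
    unfolding indicator_def by simp_all
qed

lemma log_bump_eq:
  assumes "r > 0" "v \<noteq> 0"
  shows "log_bump r v = disc_mean_log r v - ln (cmod v)"
proof (cases "cmod v < r")
  case False
  then have "disc_mean_log r v = ln (cmod v)"
    using ball_mean_log_eq[of r v 0] assms by (simp add: disc_mean_log_def measure_ball_complex)
  then show ?thesis by (simp add: log_bump_def)
qed (simp add: log_bump_def)

lemma log_bump_nonneg:
  assumes "r > 0" "v \<noteq> 0"
  shows "log_bump r v \<ge> 0"
proof -
  have "measure lborel (ball v r) * ln (cmod v) \<le> (LINT z|lborel. indicator (ball v r) z * ln (cmod z))"
    using ball_mean_log_ge[of 0 v r] assms by simp
  then have "ln (cmod v) \<le> disc_mean_log r v"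
    using assms by (simp add: disc_mean_log_def measure_ball_complex field_simps)
  then show ?thesis using log_bump_eq[OF assms] by simp
qed

text \<open>
  The constant only serves to show that the integral of the bump is positive.  When \<open>v\<close> is at
  most a quarter of the radius, \<open>max \<bar>z\<bar> \<bar>v\<bar>\<close> is at least \<open>2 \<bar>v\<bar>\<close> on the outer part
  \<open>\<bar>z\<bar> \<ge> r / 2\<close> of the disc, which makes up three quarters of its area.
\<close>

lemma log_bump_ge:
  assumes "r > 0" "v \<noteq> 0" "cmod v < r / 4"
  shows "log_bump r v \<ge> 3/4 * ln 2"
proof -
  let ?B = "ball (0::complex) r" and ?B' = "ball (0::complex) (r/2)"
  have [measurable]: "ball (0::complex) r \<in> sets borel" for r by simp
  have fin: "emeasure lborel (ball (0::complex) s) < \<infinity>" for s using emeasure_lborel_ball_finite by auto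
  have i1: "integrable lborel (\<lambda>z. indicator ?B z * ln (cmod v))"
    using fin[of r] by (intro integrable_mult_left integrable_real_indicator) auto
  have i2: "integrable lborel (\<lambda>z. indicator ?B z * ln 2 :: real)"
    using fin[of r] by (intro integrable_mult_left integrable_real_indicator) auto
  have i3: "integrable lborel (\<lambda>z. indicator ?B' z * ln 2 :: real)"
    using fin[of "r/2"] by (intro integrable_mult_left integrable_real_indicator) auto
  have "(LINT z|lborel. indicator ?B z * ln (cmod v) + (indicator ?B z * ln 2 - indicator ?B' z * ln 2))
      \<le> (LINT z|lborel. indicator ?B z * ln (max (cmod z) (cmod (0 - v))))"
  proof (rule integral_mono)
    show "integrable lborel (\<lambda>z. indicator ?B z * ln (cmod v) + (indicator ?B z * ln 2 - indicator ?B' z * ln 2))"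
      by (intro Bochner_Integration.integrable_add Bochner_Integration.integrable_diff i1 i2 i3)
    show "integrable lborel (\<lambda>z. indicator ?B z * ln (max (cmod z) (cmod (0 - v))))"
      by (rule integrable_max_log_ball) (use assms in auto)
    fix z :: complex
    have v: "0 < cmod v" using assms by simp
    have mono: "ln (cmod v) \<le> ln (max (cmod z) (cmod v))" using v by (subst ln_le_cancel_iff) (auto simp: less_max_iff_disj)
    have "ln (cmod v) + ln 2 \<le> ln (max (cmod z) (cmod v))" if "r/2 \<le> cmod z"
    proof -
      have "ln (cmod v) + ln 2 = ln (cmod v * 2)" using v by (simp add: ln_mult)
      also have "\<dots> \<le> ln (max (cmod z) (cmod v))" using v that assms by (subst ln_le_cancel_iff) (auto simp: less_max_iff_disj)
      finally show ?thesis .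
    qed
    with mono show "indicator ?B z * ln (cmod v) + (indicator ?B z * ln 2 - indicator ?B' z * ln 2) \<le> indicator ?B z * ln (max (cmod z) (cmod (0 - v)))"
      using assms by (auto simp: indicator_def)
  qed
  also have "\<dots> = (LINT z|lborel. indicator (ball v r) z * ln (cmod (z - 0)))"
    by (rule integral_log_ball[symmetric]) (use assms in auto)
  also have "\<dots> = disc_mean_log r v * measure lborel ?B"
    using assms by (simp add: disc_mean_log_def measure_ball_complex)
  finally have le: "(LINT z|lborel. indicator ?B z * ln (cmod v) + (indicator ?B z * ln 2 - indicator ?B' z * ln 2)) \<le> disc_mean_log r v * measure lborel ?B" .
  have "(LINT z|lborel. indicator ?B z * ln (cmod v) + (indicator ?B z * ln 2 - indicator ?B' z * ln 2))
     = (LINT z|lborel. indicator ?B z * ln (cmod v)) + ((LINT z|lborel. indicator ?B z * ln 2) - (LINT z|lborel. indicator ?B' z * ln 2))"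
    using Bochner_Integration.integral_add[OF i1 Bochner_Integration.integrable_diff[OF i2 i3]] Bochner_Integration.integral_diff[OF i2 i3] by simp
  also have "\<dots> = (pi * r^2) * (ln (cmod v) + 3/4 * ln 2)"
    using assms by (simp add: measure_ball_complex field_simps power2_eq_square)
  finally have "(pi * r^2) * (ln (cmod v) + 3/4 * ln 2) \<le> (pi * r^2) * disc_mean_log r v"
    using le assms by (simp add: measure_ball_complex mult.commute)
  then have "ln (cmod v) + 3/4 * ln 2 \<le> disc_mean_log r v"
    using assms by (subst (asm) mult_le_cancel_left_pos) auto
  then show ?thesis using log_bump_eq[OF assms(1,2)] by simp
qed

lemma borel_measurable_disc_mean_log [measurable]: "disc_mean_log r \<in> borel_measurable borel"
proof -
  have "(\<lambda>v. (LINT z|lborel. indicator {p. dist (fst p) (snd p) < r} (v, z) * ln (cmod z)) / measure lborel (ball (0::complex) r)) \<in> borel_measurable borel"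
    by measurable
  then show ?thesis unfolding disc_mean_log_def by (simp add: indicator_def ball_def)
qed

lemma disc_mean_log_bound:
  assumes "cmod v \<le> s"
  shows "(LINT z|lborel. indicator (ball v r) z * \<bar>ln (cmod z)\<bar>) \<le> (LINT z|lborel. indicator (ball 0 (r + s)) z * \<bar>ln (cmod z)\<bar>)"
proof (rule integral_mono')
  show "integrable lborel (\<lambda>z. indicator (ball (0::complex) (r + s)) z * \<bar>ln (cmod z)\<bar>)"
    using integrable_abs[OF integrable_log_ball[of "r + s"]] by (simp add: abs_mult)
  fix z
  have "ball v r \<subseteq> ball 0 (r + s)"
  proof
    fix x assume "x \<in> ball v r"
    then have "cmod (x - v) < r" by (simp add: dist_norm norm_minus_commute)
    then show "x \<in> ball 0 (r + s)" using norm_triangle_sub[of x v] assms by simp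
  qed
  then show "indicator (ball v r) z * \<bar>ln (cmod z)\<bar> \<le> indicator (ball 0 (r + s)) z * \<bar>ln (cmod z)\<bar>"
    by (auto simp: indicator_def)
qed simp

lemma integrable_log_bump:
  assumes "r > 0"
  shows "integrable lborel (log_bump r)"
proof -
  have [measurable]: "ball (0::complex) r \<in> sets borel" for r by simp
  let ?J = "(LINT z|lborel. indicator (ball (0::complex) (r + r)) z * \<bar>ln (cmod z)\<bar>) / measure lborel (ball (0::complex) r)"
  have "integrable lborel (\<lambda>v. indicator (ball 0 r) v * disc_mean_log r v)"
  proof (rule Bochner_Integration.integrable_bound)
    show "integrable lborel (\<lambda>v. indicator (ball (0::complex) r) v * ?J)"
      using emeasure_lborel_ball_finite[of "0::complex" r] by (intro integrable_mult_left integrable_real_indicator) auto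
    show "AE v in lborel. norm (indicator (ball 0 r) v * disc_mean_log r v) \<le> norm (indicator (ball (0::complex) r) v * ?J)"
    proof (intro AE_I2)
      fix v :: complex
      show "norm (indicator (ball 0 r) v * disc_mean_log r v) \<le> norm (indicator (ball (0::complex) r) v * ?J)"
      proof (cases "cmod v < r")
        case True
        have "\<bar>LINT z|lborel. indicator (ball v r) z * ln (cmod z)\<bar> \<le> (LINT z|lborel. \<bar>indicator (ball v r) z * ln (cmod z)\<bar>)"
          by (rule integral_abs_bound)
        also have "\<dots> = (LINT z|lborel. indicator (ball v r) z * \<bar>ln (cmod z)\<bar>)" by (simp add: abs_mult)
        also have "\<dots> \<le> (LINT z|lborel. indicator (ball 0 (r + r)) z * \<bar>ln (cmod z)\<bar>)"
          by (rule disc_mean_log_bound) (use True in auto)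
        finally have "\<bar>disc_mean_log r v\<bar> \<le> ?J"
          unfolding disc_mean_log_def abs_divide by (simp add: divide_right_mono)
        then show ?thesis using True by simp
      qed simp
    qed
  qed measurable
  then have "integrable lborel (\<lambda>v. indicator (ball 0 r) v * disc_mean_log r v - indicator (ball 0 r) v * ln (cmod v))"
    by (intro Bochner_Integration.integrable_diff integrable_log_ball)
  then show ?thesis by (simp add: log_bump_def[abs_def] right_diff_distrib)
qed

lemma integral_log_bump_pos:
  assumes "r > 0"
  shows "(LINT v|lborel. log_bump r v) > 0"
proof -
  have [measurable]: "ball (0::complex) r \<in> sets borel" for r by simp
  have "0 < measure lborel (ball (0::complex) (r/4)) * (3/4 * ln 2)"
    using assms by (simp add: measure_ball_complex)
  also have "\<dots> = (LINT v|lborel. indicator (ball (0::complex) (r/4)) v * (3/4 * ln 2 :: real))" by simp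
  also have "\<dots> \<le> (LINT v|lborel. log_bump r v)"
  proof (rule integral_mono_AE)
    show "integrable lborel (\<lambda>v. indicator (ball (0::complex) (r/4)) v * (3/4 * ln 2 :: real))"
      using emeasure_lborel_ball_finite[of "0::complex" "r/4"] by (intro integrable_mult_left integrable_real_indicator) auto
    show "integrable lborel (log_bump r)" by (rule integrable_log_bump[OF assms])
    show "AE v in lborel. indicator (ball 0 (r/4)) v * (3/4 * ln 2) \<le> log_bump r v"
      using AE_lborel_cmod_neq[of 0 0]
    proof eventually_elim
      case (elim v)
      then show ?case using log_bump_ge[OF assms, of v] log_bump_nonneg[OF assms, of v]
        by (cases "v \<in> ball 0 (r/4)") auto
    qed
  qed
  finally show ?thesis .
qed

definition disc_mean :: "real \<Rightarrow> (complex \<Rightarrow> real) \<Rightarrow> complex \<Rightarrow> real" where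
  "disc_mean r F y = (LINT z|lborel. indicator (ball 0 r) (z - y) * F z) / measure lborel (ball (0::complex) r)"

lemma disc_mean_bound:
  assumes "r > 0" "F \<in> borel_measurable borel" "\<And>z. \<bar>F z\<bar> \<le> B"
  shows "\<bar>disc_mean r F y\<bar> \<le> B"
proof -
  have B: "0 \<le> B" using assms(3)[of 0] by linarith
  have "\<bar>LINT z|lborel. indicator (ball 0 r) (z - y) * F z\<bar> \<le> (LINT z|lborel. \<bar>indicator (ball 0 r) (z - y) * F z\<bar>)"
    by (rule integral_abs_bound)
  also have "\<dots> \<le> (LINT z|lborel. indicator (ball y r) z * B)"
  proof (rule integral_mono')
    show "integrable lborel (\<lambda>z. indicator (ball y r) z * B)"
      using emeasure_lborel_ball_finite[of y r] by (intro integrable_mult_left integrable_real_indicator) auto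
  qed (use assms(3) B in \<open>unfold indicator_ball_diff(2), auto simp: indicator_def\<close>)
  also have "\<dots> = (pi * r^2) * B" using assms by (simp add: measure_ball_complex)
  finally show ?thesis using assms by (simp add: disc_mean_def measure_ball_complex field_simps abs_divide)
qed

lemma borel_measurable_disc_mean:
  assumes [measurable]: "F \<in> borel_measurable borel"
  shows "disc_mean r F \<in> borel_measurable borel"
proof -
  have [measurable]: "ball (0::complex) r \<in> sets borel" for r by simp
  show ?thesis unfolding disc_mean_def[abs_def] by measurable
qed

lemma disc_mean_eq_0:
  assumes "\<And>z. dist z y < r \<Longrightarrow> F z = 0"
  shows "disc_mean r F y = 0"
proof -
  have "indicator (ball 0 r) (z - y) * F z = 0" for z
    using assms[of z] unfolding indicator_ball_diff(1) by (auto simp: indicator_def)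
  then have eq: "(\<lambda>z. indicator (ball 0 r) (z - y) * F z) = (\<lambda>_. 0)" by (rule ext)
  show ?thesis unfolding disc_mean_def eq by simp
qed

text \<open>
  Summation by parts: the averaging operator is symmetric, so it can be moved from the test
  function to the logarithm.
\<close>

lemma integral_disc_mean_log:
  assumes r: "r > 0" and F[measurable]: "F \<in> borel_measurable borel" and B: "\<And>z. \<bar>F z\<bar> \<le> B" and R: "\<And>z. cmod z \<ge> R \<Longrightarrow> F z = 0"
  shows "(LINT y|lborel. (disc_mean r F y - F y) * ln (cmod y)) = (LINT v|lborel. F v * log_bump r v)"
proof -
  have [measurable]: "ball (0::complex) r \<in> sets borel" for r by simp
  let ?V = "measure lborel (ball (0::complex) r)"
  let ?H = "\<lambda>z y. indicator (ball 0 r) (z - y) * F z * ln (cmod y)"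
  have B0: "0 \<le> B" using B[of 0] by linarith
  have Hm: "(\<lambda>(z,y). ?H z y) \<in> borel_measurable (lborel \<Otimes>\<^sub>M lborel)" by measurable
  have ind: "indicator (ball 0 r) (z - y) = (indicator (ball z r) y :: real)" for z y :: complex
    by (rule indicator_ball_diff(1))
  define J where "J = (LINT z|lborel. indicator (ball (0::complex) (r + R)) z * \<bar>ln (cmod z)\<bar>)"
  have Hi: "integrable lborel (?H z)" for z
  proof -
    have "integrable lborel (\<lambda>y. (F z * indicator (ball z r) y) * ln (cmod (y - 0)))"
    proof (rule integrable_log_bounded[where B="B" and R="r + cmod z"])
      fix y assume "r + cmod z \<le> cmod y"
      then show "F z * indicator (ball z r) y = 0" using norm_triangle_ineq2[of y z]
        by (auto simp: indicator_def dist_norm norm_minus_commute)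
    qed (use B B0 in \<open>auto simp: indicator_def\<close>)
    then show ?thesis by (simp add: ind mult_ac)
  qed
  have HI: "integrable (lborel \<Otimes>\<^sub>M lborel) (\<lambda>(z,y). ?H z y)"
  proof (rule lborel_pair.Fubini_integrable[OF Hm])
    show "integrable lborel (\<lambda>z. LINT y|lborel. norm (case (z, y) of (z, y) \<Rightarrow> ?H z y))"
    proof (rule Bochner_Integration.integrable_bound)
      show "integrable lborel (\<lambda>z. indicator (ball (0::complex) R) z * (B * J))"
        using emeasure_lborel_ball_finite[of "0::complex" R] by (intro integrable_mult_left integrable_real_indicator) auto
      show "AE z in lborel. norm (LINT y|lborel. norm (case (z, y) of (z, y) \<Rightarrow> ?H z y)) \<le> norm (indicator (ball (0::complex) R) z * (B * J))"
      proof (intro AE_I2)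
        fix z :: complex
        have "(LINT y|lborel. norm (case (z, y) of (z, y) \<Rightarrow> ?H z y)) = \<bar>F z\<bar> * (LINT y|lborel. indicator (ball z r) y * \<bar>ln (cmod y)\<bar>)"
          by (subst integral_mult_right_zero[symmetric]) (simp add: ind abs_mult mult_ac)
        moreover have "(LINT y|lborel. indicator (ball z r) y * \<bar>ln (cmod y)\<bar>) \<ge> 0" by (rule integral_nonneg_AE) auto
        moreover have "\<bar>F z\<bar> * (LINT y|lborel. indicator (ball z r) y * \<bar>ln (cmod y)\<bar>) \<le> indicator (ball 0 R) z * (B * J)"
        proof (cases "cmod z < R")
          case True
          then have "(LINT y|lborel. indicator (ball z r) y * \<bar>ln (cmod y)\<bar>) \<le> J"
            unfolding J_def by (intro disc_mean_log_bound) auto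
          then have "\<bar>F z\<bar> * (LINT y|lborel. indicator (ball z r) y * \<bar>ln (cmod y)\<bar>) \<le> B * J"
            using B B0 \<open>(LINT y|lborel. indicator (ball z r) y * \<bar>ln (cmod y)\<bar>) \<ge> 0\<close> by (intro mult_mono) auto
          then show ?thesis using True by simp
        qed (use R in auto)
        ultimately show "norm (LINT y|lborel. norm (case (z, y) of (z, y) \<Rightarrow> ?H z y)) \<le> norm (indicator (ball (0::complex) R) z * (B * J))"
          by simp
      qed
      show "(\<lambda>z. LINT y|lborel. norm (case (z, y) of (z, y) \<Rightarrow> ?H z y)) \<in> borel_measurable lborel" by measurable
    qed
  qed (use Hi in auto)
  have e1: "(LINT z|lborel. ?H z y) = ?V * (disc_mean r F y * ln (cmod y))" for y
    using r by (simp add: disc_mean_def measure_ball_complex)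
  have e2: "(LINT y|lborel. ?H z y) = ?V * (F z * disc_mean_log r z)" for z
  proof -
    have "(LINT y|lborel. ?H z y) = F z * (LINT y|lborel. indicator (ball z r) y * ln (cmod y))"
      by (subst integral_mult_right_zero[symmetric]) (simp add: ind mult_ac)
    then show ?thesis using r by (simp add: disc_mean_log_def measure_ball_complex)
  qed
  have V: "?V > 0" using r by (simp add: measure_ball_complex)
  have "(LINT y|lborel. ?V * (disc_mean r F y * ln (cmod y))) = (LINT z|lborel. ?V * (F z * disc_mean_log r z))"
    using lborel_pair.Fubini_integral[OF HI] unfolding e1 e2 .
  then have eq: "(LINT y|lborel. disc_mean r F y * ln (cmod y)) = (LINT z|lborel. F z * disc_mean_log r z)"
    using V by simp
  have j1: "integrable lborel (\<lambda>y. disc_mean r F y * ln (cmod y))"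
    using lborel_pair.integrable_snd[OF HI] V unfolding e1 by simp
  have j2: "integrable lborel (\<lambda>z. F z * disc_mean_log r z)"
    using lborel_pair.integrable_fst[OF HI] V unfolding e2 by simp
  have "integrable lborel (\<lambda>z. F z * ln (cmod (z - 0)))"
    by (rule integrable_log_bounded[OF F, where B=B and R=R]) (use B R in auto)
  then have j3: "integrable lborel (\<lambda>z. F z * ln (cmod z))" by simp
  have "(LINT y|lborel. (disc_mean r F y - F y) * ln (cmod y)) = (LINT y|lborel. disc_mean r F y * ln (cmod y)) - (LINT y|lborel. F y * ln (cmod y))"
    unfolding left_diff_distrib by (rule Bochner_Integration.integral_diff[OF j1 j3])
  also have "\<dots> = (LINT z|lborel. F z * disc_mean_log r z - F z * ln (cmod z))"
    unfolding eq by (rule Bochner_Integration.integral_diff[OF j2 j3, symmetric])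
  also have "\<dots> = (LINT z|lborel. F z * log_bump r z)"
  proof (rule integral_cong_AE)
    show "AE z in lborel. F z * disc_mean_log r z - F z * ln (cmod z) = F z * log_bump r z"
      using AE_lborel_cmod_neq[of 0 0] by eventually_elim (use r in \<open>auto simp: log_bump_eq right_diff_distrib\<close>)
    have [measurable]: "log_bump r \<in> borel_measurable borel" using borel_measurable_integrable[OF integrable_log_bump[OF r]] by simp
    show "(\<lambda>z. F z * disc_mean_log r z - F z * ln (cmod z)) \<in> borel_measurable lborel" by measurable
    show "(\<lambda>z. F z * log_bump r z) \<in> borel_measurable lborel" by measurable
  qed
  finally show ?thesis .
qed

text \<open>
  The function \<open>\<phi>\<close> is \<open>(disc_mean r f - f) / c\<close>, where \<open>c\<close> is the integral of the bump.  Its pairing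
  with the potential of \<open>\<nu>\<close> is the \<open>\<nu>\<close>-integral of the convolution of \<open>f\<close> with the normalized bump,
  and this differs from \<open>f\<close> by at most the oscillation of \<open>f\<close> on discs of radius \<open>r\<close>.  The same \<open>\<phi>\<close>
  works for all measures \<open>\<nu>\<close>.
\<close>

lemma test_function_by_log_potential:
  fixes f :: "complex \<Rightarrow> real"
  assumes f: "continuous_on UNIV f" and S: "compact (closure {z. f z \<noteq> 0})" "closure {z. f z \<noteq> 0} \<subseteq> N" and N: "open N" and e: "e > 0"
  obtains \<phi> K B where "\<phi> \<in> borel_measurable borel" "\<And>z. \<bar>\<phi> z\<bar> \<le> B" "compact K" "K \<subseteq> N" "\<And>z. z \<notin> K \<Longrightarrow> \<phi> z = 0"
    "\<And>\<rho> \<nu>. prob_on (cball 0 \<rho>) \<nu> \<Longrightarrow> \<bar>(LINT z|\<nu>. f z) - (LINT z|lborel. \<phi> z * log_pot \<nu> z)\<bar> \<le> e"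
proof -
  define S where "S = closure {z. f z \<noteq> 0}"
  have fS: "z \<notin> S \<Longrightarrow> f z = 0" for z using closure_subset[of "{z. f z \<noteq> 0}"] unfolding S_def by blast
  have cS: "compact S" "S \<subseteq> N" using assms unfolding S_def by auto
  have fm[measurable]: "f \<in> borel_measurable borel" by (rule borel_measurable_continuous_onI[OF f])
  obtain r0 where r0: "r0 > 0" "(\<Union>x\<in>S. cball x r0) \<subseteq> N"
    using compact_subset_open_imp_cball_epsilon_subset[OF cS(1) N cS(2)] by blast
  \<comment> \<open>A neighbourhood of the support of \<open>f\<close>: the values of \<open>f\<close> are compared across the boundary of the support.\<close>
  define K1 where "K1 = {x + y |x y. x \<in> S \<and> y \<in> cball 0 1}"
  have cK1: "compact K1" unfolding K1_def by (rule compact_sums[OF cS(1)]) simp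
  have "uniformly_continuous_on K1 f"
    by (rule compact_uniformly_continuous[OF continuous_on_subset[OF f] cK1]) auto
  then obtain r1 where r1: "r1 > 0" "\<And>x y. x \<in> K1 \<Longrightarrow> y \<in> K1 \<Longrightarrow> dist y x < r1 \<Longrightarrow> dist (f y) (f x) < e"
    using e by (rule uniformly_continuous_onE) blast
  define r where "r = min (min r0 r1) 1"
  have r: "r > 0" "r \<le> r0" "r \<le> r1" "r \<le> 1" using r0 r1 by (auto simp: r_def)
  have K1I: "z \<in> K1" if "x \<in> S" "dist z x \<le> 1" for x z
    unfolding K1_def using that by (intro CollectI exI[of _ x] exI[of _ "z - x"]) (auto simp: dist_norm norm_minus_commute)
  have osc: "\<bar>f (w + v) - f w\<bar> \<le> e" if v: "cmod v < r" for v w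
  proof (cases "w \<in> S \<or> w + v \<in> S")
    case True
    then have "w \<in> K1" "w + v \<in> K1" using K1I[of w w] K1I[of w "w+v"] K1I[of "w+v" w] K1I[of "w+v" "w+v"] v r
      by (auto simp: dist_norm)
    then show ?thesis using r1(2)[of w "w+v"] v r by (simp add: dist_norm)
  qed (use fS e in auto)
  obtain M where M: "\<And>z. \<bar>f z\<bar> \<le> M"
  proof -
    have "compact (f ` S)" by (rule compact_continuous_image[OF continuous_on_subset[OF f] cS(1)]) auto
    then obtain M where "\<forall>x\<in>f ` S. norm x \<le> M" using compact_imp_bounded bounded_iff by blast
    then have "\<bar>f z\<bar> \<le> max M 0" for z using fS[of z] by (cases "z \<in> S") (auto simp: le_max_iff_disj)
    then show ?thesis using that by blast
  qed
  obtain R where R: "\<And>z. z \<in> S \<Longrightarrow> cmod z < R"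
  proof -
    obtain R0 where "\<And>z. z \<in> S \<Longrightarrow> cmod z \<le> R0"
      using compact_imp_bounded[OF cS(1)] unfolding bounded_iff by blast
    then have "\<And>z. z \<in> S \<Longrightarrow> cmod z < R0 + 1" by fastforce
    then show ?thesis by (rule that)
  qed
  have fR: "cmod z \<ge> R \<Longrightarrow> f z = 0" for z using R[of z] fS[of z] by fastforce
  define c where "c = (LINT v|lborel. log_bump r v)"
  have c: "c > 0" unfolding c_def by (rule integral_log_bump_pos[OF r(1)])
  define \<phi>0 where "\<phi>0 = (\<lambda>y. disc_mean r f y - f y)"
  define K where "K = {x + y |x y. x \<in> S \<and> y \<in> cball 0 r}"
  have cK: "compact K" unfolding K_def by (rule compact_sums[OF cS(1)]) simp
  have KN: "K \<subseteq> N"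
  proof
    fix z assume "z \<in> K"
    then obtain x y where "z = x + y" "x \<in> S" "cmod y \<le> r" by (auto simp: K_def)
    then have "z \<in> cball x r0" using r by (auto simp: dist_norm)
    then show "z \<in> N" using r0 \<open>x \<in> S\<close> by blast
  qed
  have \<phi>K: "\<phi>0 z = 0" if "z \<notin> K" for z
  proof -
    have "x \<notin> S" if "dist x z < r" for x
    proof
      assume "x \<in> S"
      then have "x + (z - x) \<in> K" unfolding K_def using that by (intro CollectI exI[of _ x] exI[of _ "z - x"]) (auto simp: dist_norm norm_minus_commute)
      with \<open>z \<notin> K\<close> show False by simp
    qed
    then have "f x = 0" if "dist x z < r" for x using that fS by blast
    then show ?thesis using disc_mean_eq_0[of z r f] r(1) by (simp add: \<phi>0_def)
  qed
  have \<phi>B: "\<bar>\<phi>0 z\<bar> \<le> 2 * M" for z using disc_mean_bound[OF r(1) fm M, of z] M[of z] unfolding \<phi>0_def by linarith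
  have \<phi>m[measurable]: "\<phi>0 \<in> borel_measurable borel" unfolding \<phi>0_def using borel_measurable_disc_mean[OF fm] by measurable
  have bm[measurable]: "log_bump r \<in> borel_measurable borel" using borel_measurable_integrable[OF integrable_log_bump[OF r(1)]] by simp
  have main: "\<bar>(LINT y|lborel. \<phi>0 y * ln (cmod (y - w))) - c * f w\<bar> \<le> c * e" for w
  proof -
    let ?F = "\<lambda>v. f (w + v)"
    have F0: "cmod z \<ge> R + cmod w \<Longrightarrow> ?F z = 0" for z using norm_triangle_ineq4[of "w+z" w] by (intro fR) (auto)
    have [measurable]: "ball (0::complex) r \<in> sets borel" by simp
    have dm: "disc_mean r ?F y = disc_mean r f (w + y)" for y
    proof -
      have "(LINT z|lborel. indicator (ball 0 r) (z - (w + y)) * f z) = (LINT z|lborel. indicator (ball 0 r) (w + z - (w + y)) * f (w + z))"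
        by (rule integral_lborel_translation[of "\<lambda>z. indicator (ball 0 r) (z - (w + y)) * f z" w, symmetric]) measurable
      then show ?thesis by (simp add: disc_mean_def)
    qed
    have "(LINT y|lborel. \<phi>0 y * ln (cmod (y - w))) = (LINT y|lborel. \<phi>0 (w + y) * ln (cmod (w + y - w)))"
      by (rule integral_lborel_translation[of "\<lambda>y. \<phi>0 y * ln (cmod (y - w))" w, symmetric]) measurable
    also have "\<dots> = (LINT y|lborel. (disc_mean r ?F y - ?F y) * ln (cmod y))" by (simp add: \<phi>0_def dm)
    also have "\<dots> = (LINT v|lborel. ?F v * log_bump r v)"
      by (rule integral_disc_mean_log[OF r(1), where B=M and R="R + cmod w"]) (use M F0 in auto)
    finally have 1: "(LINT y|lborel. \<phi>0 y * ln (cmod (y - w))) = (LINT v|lborel. ?F v * log_bump r v)" .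
    have i1: "integrable lborel (\<lambda>v. f w * log_bump r v)" by (intro integrable_mult_right integrable_log_bump r)
    have i2: "integrable lborel (\<lambda>v. ?F v * log_bump r v)"
    proof (rule Bochner_Integration.integrable_bound)
      show "integrable lborel (\<lambda>v. M * log_bump r v)" by (intro integrable_mult_right integrable_log_bump r)
      have "M \<ge> 0" using M[of 0] by linarith
      then show "AE v in lborel. norm (?F v * log_bump r v) \<le> norm (M * log_bump r v)"
        using M by (auto simp: abs_mult intro!: mult_right_mono)
    qed measurable
    have "(LINT y|lborel. \<phi>0 y * ln (cmod (y - w))) - c * f w = (LINT v|lborel. ?F v * log_bump r v - f w * log_bump r v)"
      unfolding 1 c_def Bochner_Integration.integral_diff[OF i2 i1] by simp
    also have "\<bar>\<dots>\<bar> \<le> (LINT v|lborel. \<bar>?F v * log_bump r v - f w * log_bump r v\<bar>)"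
      by (rule integral_abs_bound)
    also have "\<dots> \<le> (LINT v|lborel. e * log_bump r v)"
    proof (rule integral_mono_AE)
      show "AE v in lborel. \<bar>?F v * log_bump r v - f w * log_bump r v\<bar> \<le> e * log_bump r v"
        using AE_lborel_cmod_neq[of 0 0]
      proof eventually_elim
        case (elim v)
        then have nn: "log_bump r v \<ge> 0" using log_bump_nonneg[OF r(1)] by auto
        have "\<bar>?F v * log_bump r v - f w * log_bump r v\<bar> = \<bar>?F v - f w\<bar> * log_bump r v"
          using nn by (simp add: abs_mult flip: left_diff_distrib)
        also have "\<dots> \<le> e * log_bump r v"
          using osc[of v w] nn by (cases "cmod v < r") (auto simp: log_bump_def intro!: mult_right_mono)
        finally show ?case .
      qed
    qed (intro integrable_abs Bochner_Integration.integrable_diff i1 i2 integrable_mult_right integrable_log_bump r)+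
    also have "\<dots> = c * e" by (simp add: c_def)
    finally show ?thesis .
  qed
  show thesis
  proof (rule that[of "\<lambda>z. \<phi>0 z / c" "2 * M / c" K])
    show "\<bar>\<phi>0 z / c\<bar> \<le> 2 * M / c" for z using \<phi>B[of z] c by (simp add: abs_divide divide_right_mono)
    fix \<rho> \<nu> assume \<nu>: "prob_on (cball 0 \<rho>) \<nu>"
    have [measurable_cong]: "sets \<nu> = sets borel" using \<nu> by (simp add: prob_on_def)
    interpret prob_space \<nu> using \<nu> by (simp add: prob_on_def)
    obtain R' where R': "\<And>z. z \<in> K \<Longrightarrow> cmod z < R'"
    proof -
      obtain R0 where "\<And>z. z \<in> K \<Longrightarrow> cmod z \<le> R0"
        using compact_imp_bounded[OF cK] unfolding bounded_iff by blast
      then have "\<And>z. z \<in> K \<Longrightarrow> cmod z < R0 + 1" by fastforce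
      then show ?thesis by (rule that)
    qed
    have \<phi>R: "R' \<le> cmod z \<Longrightarrow> \<phi>0 z = 0" for z using R'[of z] \<phi>K[of z] by fastforce
    note F = log_pot_Fubini[OF \<nu> \<phi>m, where B="2*M" and R=R']
    have fi: "integrable \<nu> f" by (rule integrable_const_bound[where B=M]) (use M in auto)
    let ?g = "\<lambda>w. LINT z|lborel. \<phi>0 z * ln (cmod (z - w))"
    have gi: "integrable \<nu> ?g" by (rule F(4)) (use \<phi>B \<phi>R in auto)
    have F2: "(LINT z|lborel. \<phi>0 z * log_pot \<nu> z) = (LINT w|\<nu>. ?g w)" by (rule F(2)) (use \<phi>B \<phi>R in auto)
    have "c * ((LINT z|\<nu>. f z) - (LINT z|lborel. \<phi>0 z / c * log_pot \<nu> z)) = (LINT w|\<nu>. c * f w) - (LINT w|\<nu>. ?g w)"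
      using c F2 by (simp add: right_diff_distrib)
    also have "\<dots> = (LINT w|\<nu>. c * f w - ?g w)"
      by (rule Bochner_Integration.integral_diff[symmetric]) (use fi gi in auto)
    finally have eq: "c * ((LINT z|\<nu>. f z) - (LINT z|lborel. \<phi>0 z / c * log_pot \<nu> z)) = (LINT w|\<nu>. c * f w - ?g w)" .
    have "c * \<bar>(LINT z|\<nu>. f z) - (LINT z|lborel. \<phi>0 z / c * log_pot \<nu> z)\<bar> = \<bar>LINT w|\<nu>. c * f w - ?g w\<bar>"
      unfolding eq[symmetric] abs_mult using c by simp
    also have "\<dots> \<le> (LINT w|\<nu>. \<bar>c * f w - ?g w\<bar>)" by (rule integral_abs_bound)
    also have "\<dots> \<le> (LINT w|\<nu>. c * e)"
      by (rule integral_mono) (use fi gi main in \<open>auto simp: abs_minus_commute\<close>)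
    also have "\<dots> = c * e" by (simp add: prob_space)
    finally show "\<bar>(LINT z|\<nu>. f z) - (LINT z|lborel. \<phi>0 z / c * log_pot \<nu> z)\<bar> \<le> e" using c by simp
  qed (use cK KN \<phi>K in auto)
qed

section \<open>Weak compactness of probability measures on compact sets\<close>

text \<open>
  Points are coded by the ternary number whose digits record membership in the sets \<open>U k\<close>.
  Digits 0 and 1 are used, so that close codes have equal leading digits.
\<close>

definition digit_code :: "(nat \<Rightarrow> 'a set) \<Rightarrow> 'a \<Rightarrow> real" where
  "digit_code U z = (\<Sum>k. indicator (U k) z * (1/3)^k)"

lemma summable_digit_code: "summable (\<lambda>k. indicator (U k) z * (1/3::real)^k)"
  by (rule summable_comparison_test'[of "\<lambda>k. (1/3::real)^k" 0])
    (auto simp: indicator_def intro: summable_geometric)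

text \<open>
  If the first difference occurs at digit \<open>j\<close>, the later digits change the code by at most half of
  \<open>3\<^sup>-\<^sup>j\<close>.
\<close>

lemma digit_code_separates:
  assumes "\<bar>digit_code U z - digit_code U w\<bar> < (1/3)^n / 2" "k \<le> n"
  shows "z \<in> U k \<longleftrightarrow> w \<in> U k"
proof (rule ccontr)
  assume A: "\<not> (z \<in> U k \<longleftrightarrow> w \<in> U k)"
  define P where "P = (\<lambda>j. \<not> (z \<in> U j \<longleftrightarrow> w \<in> U j))"
  define j where "j = (LEAST j. P j)"
  have Pj: "P j" and jk: "j \<le> k" unfolding j_def using A LeastI[of P k] Least_le[of P k] by (auto simp: P_def)
  have lt: "\<not> P i" if "i < j" for i using that unfolding j_def by (rule not_less_Least)
  define c where "c = (\<lambda>k. (indicator (U k) z - indicator (U k) w :: real))"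
  have cb: "\<bar>c k\<bar> \<le> 1" for k by (auto simp: c_def indicator_def)
  have cj: "\<bar>c j\<bar> = 1" using Pj by (auto simp: c_def P_def indicator_def)
  have ci: "c i = 0" if "i < j" for i using lt[OF that] by (auto simp: c_def P_def indicator_def)
  have sm: "summable (\<lambda>k. c k * (1/3)^k)"
    unfolding c_def left_diff_distrib by (intro summable_diff summable_digit_code)
  have eq: "digit_code U z - digit_code U w = (\<Sum>k. c k * (1/3)^k)"
    unfolding c_def left_diff_distrib digit_code_def by (intro suminf_diff summable_digit_code)
  also have "\<dots> = (\<Sum>k. c (k + Suc j) * (1/3)^(k + Suc j)) + (\<Sum>i<Suc j. c i * (1/3)^i)"
    by (rule suminf_split_initial_segment[OF sm])
  also have "(\<Sum>i<Suc j. c i * (1/3)^i) = c j * (1/3)^j" using ci by simp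
  finally have eq: "digit_code U z - digit_code U w = (\<Sum>k. c (k + Suc j) * (1/3)^(k + Suc j)) + c j * (1/3)^j" .
  have "\<bar>\<Sum>k. c (k + Suc j) * (1/3)^(k + Suc j)\<bar> \<le> (\<Sum>k. (1/3)^Suc j * (1/3)^k)"
  proof (rule norm_suminf_le[where 'a=real, unfolded real_norm_def])
    show "\<bar>c (n + Suc j) * (1/3)^(n + Suc j)\<bar> \<le> (1/3)^Suc j * (1/3)^n" for n
      using mult_right_mono[OF cb[of "n + Suc j"], of "(1/3)^(n + Suc j)"] by (simp add: abs_mult power_add mult_ac)
  qed (intro summable_mult summable_geometric, simp)
  also have "\<dots> = (1/3)^j / 2" by (subst suminf_mult) (auto simp: suminf_geometric intro: summable_geometric)
  finally have t: "\<bar>\<Sum>k. c (k + Suc j) * (1/3)^(k + Suc j)\<bar> \<le> (1/3)^j / 2" .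
  have "(1/3::real)^j = \<bar>c j * (1/3)^j\<bar>" by (simp add: abs_mult cj)
  also have "\<dots> \<le> \<bar>digit_code U z - digit_code U w\<bar> + (1/3)^j / 2" using t unfolding eq by linarith
  finally have "(1/3)^j / 2 \<le> \<bar>digit_code U z - digit_code U w\<bar>" by linarith
  moreover have "(1/3::real)^n \<le> (1/3)^j" using jk assms(2) by (intro power_decreasing) auto
  ultimately show False using assms(1) by linarith
qed

text \<open>
  Take for \<open>U\<close> an enumeration of a base of the topology.  By compactness, points of \<open>K\<close> that agree on
  finitely many of the sets are close, so that the inverse of the code is uniformly continuous
  on the image of \<open>K\<close> and extends to the closure; Tietze's theorem extends it to the line.
  The code itself is only Borel, but that is enough to push measures forward.
\<close>

lemma compact_code_exists:
  fixes K :: "complex set"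
  assumes K: "compact K" "K \<noteq> {}"
  obtains h :: "complex \<Rightarrow> real" and g where "h \<in> borel_measurable borel" "\<And>z. h z \<in> {0..2}" "continuous_on UNIV g" "\<And>z. z \<in> K \<Longrightarrow> g (h z) = z"
proof -
  obtain B :: "complex set set" where B: "countable B" "topological_basis B" using ex_countable_basis by blast
  have Bne: "B \<noteq> {}"
  proof
    assume "B = {}"
    then show False using topological_basisE[OF B(2) open_UNIV UNIV_I] by blast
  qed
  define U where "U = from_nat_into B"
  have Uo: "open (U k)" for k using topological_basis_open[OF B(2) from_nat_into[OF Bne]] by (simp add: U_def)
  have [measurable]: "U k \<in> sets borel" for k using Uo by simp
  define h where "h = digit_code U"
  have hm: "h \<in> borel_measurable borel" unfolding h_def digit_code_def by measurable
  have hb: "h z \<in> {0..2}" for z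
  proof -
    have "h z \<le> (\<Sum>k. (1/3)^k)" unfolding h_def digit_code_def
      by (intro suminf_le summable_digit_code summable_geometric) (auto simp: indicator_def)
    also have "\<dots> \<le> 2" by (subst suminf_geometric) auto
    finally have "h z \<le> 2" .
    moreover have "h z \<ge> 0" unfolding h_def digit_code_def by (intro suminf_nonneg summable_digit_code) auto
    ultimately show ?thesis by simp
  qed
  have key: "\<exists>d>0. \<forall>z\<in>K. \<forall>w\<in>K. \<bar>h z - h w\<bar> < d \<longrightarrow> dist z w < e" if e: "e > 0" for e
  proof -
    define I where "I = {k. \<exists>x. U k \<subseteq> ball x (e/2)}"
    have "K \<subseteq> (\<Union>k\<in>I. U k)"
    proof
      fix x assume "x \<in> K"
      obtain B' where B': "B' \<in> B" "x \<in> B'" "B' \<subseteq> ball x (e/2)"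
        using topological_basisE[OF B(2) open_ball, of x x "e/2"] e by auto
      obtain k where "U k = B'" using from_nat_into_surj[OF B(1) B'(1)] by (auto simp: U_def)
      with B' show "x \<in> (\<Union>k\<in>I. U k)" by (auto simp: I_def)
    qed
    then obtain J where J: "J \<subseteq> I" "finite J" "K \<subseteq> (\<Union>k\<in>J. U k)"
      using compactE_image[OF K(1), of I U] Uo by blast
    define n where "n = Max (insert 0 J)"
    have Jn: "k \<le> n" if "k \<in> J" for k using that J by (auto simp: n_def)
    have "dist z w < e" if zw: "z \<in> K" "w \<in> K" "\<bar>h z - h w\<bar> < (1/3)^n / 2" for z w
    proof -
      obtain k where k: "k \<in> J" "z \<in> U k" using J zw by blast
      then have "w \<in> U k" using digit_code_separates[of U z w n k] zw Jn[of k] by (auto simp: h_def)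
      moreover obtain x where x: "U k \<subseteq> ball x (e/2)" using k J by (auto simp: I_def)
      ultimately have "dist x z < e/2" "dist x w < e/2" using k by auto
      then show ?thesis using dist_triangle3[of z w x] by linarith
    qed
    then show ?thesis by (intro exI[of _ "(1/3)^n / 2"]) auto
  qed
  have inj: "inj_on h K"
  proof (rule inj_onI)
    fix z w assume zw: "z \<in> K" "w \<in> K" "h z = h w"
    show "z = w"
    proof (rule ccontr)
      assume "z \<noteq> w"
      then have "dist z w > 0" by simp
      from key[OF this] obtain d where d: "d > 0" "\<forall>x\<in>K. \<forall>y\<in>K. \<bar>h x - h y\<bar> < d \<longrightarrow> dist x y < dist z w" by blast
      have "dist z w < dist z w" by (rule d(2)[rule_format]) (use zw d(1) in auto)
      then show False by simp
    qed
  qed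
  define g0 where "g0 = inv_into K h"
  have g0: "g0 (h z) = z" if "z \<in> K" for z using inj that by (simp add: g0_def)
  have uc: "uniformly_continuous_on (h ` K) g0"
    unfolding uniformly_continuous_on_def
  proof (intro allI impI)
    fix e :: real assume "e > 0"
    from key[OF this] obtain d where d: "d > 0" "\<forall>z\<in>K. \<forall>w\<in>K. \<bar>h z - h w\<bar> < d \<longrightarrow> dist z w < e" by blast
    show "\<exists>d>0. \<forall>x\<in>h ` K. \<forall>x'\<in>h ` K. dist x' x < d \<longrightarrow> dist (g0 x') (g0 x) < e"
      using d g0 by (intro exI[of _ d]) (auto simp: dist_real_def)
  qed
  obtain g1 where g1: "uniformly_continuous_on (closure (h ` K)) g1" "\<And>x. x \<in> h ` K \<Longrightarrow> g0 x = g1 x"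
  proof (rule uniformly_continuous_on_extension_on_closure[OF uc])
    fix g assume "uniformly_continuous_on (closure (h ` K)) g" and "\<And>x. x \<in> h ` K \<Longrightarrow> g0 x = g x"
    then show thesis by (rule that)
  qed
  obtain g where g: "continuous_on UNIV g" "\<And>x. x \<in> closure (h ` K) \<Longrightarrow> g x = g1 x"
    by (rule Tietze_unbounded[OF uniformly_continuous_imp_continuous[OF g1(1)], of UNIV]) auto
  have "g (h z) = z" if "z \<in> K" for z
    using g(2)[of "h z"] g1(2)[of "h z"] g0[OF that] that closure_subset[of "h ` K"] by auto
  with hm hb g(1) show ?thesis by (rule that)
qed

lemma prob_on_nonempty: "prob_on K \<nu> \<Longrightarrow> K \<noteq> {}"
  unfolding prob_on_def using prob_space.emeasure_space_1[of \<nu>] sets_eq_imp_space_eq[of \<nu> borel] by auto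

lemma prob_on_integrable:
  fixes f :: "complex \<Rightarrow> real"
  assumes "prob_on K \<nu>" "compact K" "continuous_on UNIV f"
  shows "integrable \<nu> f"
proof -
  interpret prob_space \<nu> using assms by (simp add: prob_on_def)
  have [measurable_cong]: "sets \<nu> = sets borel" using assms by (simp add: prob_on_def)
  have [measurable]: "f \<in> borel_measurable borel" by (rule borel_measurable_continuous_onI[OF assms(3)])
  have "compact (f ` K)" by (rule compact_continuous_image[OF continuous_on_subset[OF assms(3)] assms(2)]) auto
  then obtain M where M: "\<forall>x\<in>f ` K. norm x \<le> M" using compact_imp_bounded bounded_iff by blast
  show ?thesis
  proof (rule integrable_const_bound[where B=M])
    show "AE x in \<nu>. norm (f x) \<le> M"
      using prob_on_AE[OF assms(1) borel_compact[OF assms(2)]] by eventually_elim (use M in auto)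
  qed measurable
qed

text \<open>
  The measures are transported to the line by the Borel code, Helly's selection theorem is
  applied there, and the limit is brought back by the continuous decoding map.
\<close>

lemma prob_on_weakly_compact:
  fixes K :: "complex set"
  assumes K: "compact K" and \<nu>: "\<And>n. prob_on K (\<nu> n)"
  obtains s \<nu>' where "strict_mono (s :: nat \<Rightarrow> nat)" "prob_on K \<nu>'"
    "\<And>f :: complex \<Rightarrow> real. continuous_on UNIV f \<Longrightarrow> (\<lambda>n. LINT z|\<nu> (s n). f z) \<longlonglongrightarrow> (LINT z|\<nu>'. f z)"
proof -
  have Kne: "K \<noteq> {}" by (rule prob_on_nonempty[OF \<nu>])
  have Kb: "K \<in> sets borel" by (rule borel_compact[OF K])
  obtain h :: "complex \<Rightarrow> real" and g where hm[measurable]: "h \<in> borel_measurable borel" and hb: "\<And>z. h z \<in> {0..2}" and g: "continuous_on UNIV g" and gh: "\<And>z. z \<in> K \<Longrightarrow> g (h z) = z"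
    by (rule compact_code_exists[OF K Kne]) blast
  have gm[measurable]: "g \<in> borel_measurable borel" by (rule borel_measurable_continuous_onI[OF g])
  have sets\<nu>[measurable_cong]: "sets (\<nu> n) = sets borel" for n using \<nu> by (simp add: prob_on_def)
  have ps: "prob_space (\<nu> n)" for n using \<nu> by (simp add: prob_on_def)
  define M where "M = (\<lambda>n. distr (\<nu> n) borel h)"
  have rd: "real_distribution (M n)" for n
    unfolding M_def by (rule prob_space.real_distribution_distr[OF ps]) measurable
  have "tight M"
    unfolding tight_def
  proof (intro conjI allI impI)
    fix e :: real assume "e > 0"
    have "measure (M n) {-1<..2} = 1" for n
    proof -
      interpret prob_space "\<nu> n" by (rule ps)
      have "measure (M n) {-1<..2} = measure (\<nu> n) (h -` {-1<..2} \<inter> space (\<nu> n))"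
        unfolding M_def by (rule measure_distr) auto
      also have "h -` {-1<..2} \<inter> space (\<nu> n) = space (\<nu> n)" using hb by (auto simp: Ball_def) (smt (verit) atLeastAtMost_iff hb)+
      finally show ?thesis by (simp add: prob_space)
    qed
    then show "\<exists>a b. a < b \<and> (\<forall>n. 1 - e < measure (M n) {a<..b})"
      using \<open>e > 0\<close> by (intro exI[of _ "-1"] exI[of _ 2]) auto
  qed (rule rd)
  from tight_imp_convergent_subsubsequence[OF this, of id] obtain r M' where
    r: "strict_mono r" and M': "real_distribution M'" and wc: "weak_conv_m (M \<circ> id \<circ> r) M'"
    by (auto simp: strict_mono_id)
  define \<nu>' where "\<nu>' = distr M' borel g"
  interpret M': real_distribution M' by (rule M')
  have p': "prob_space \<nu>'" unfolding \<nu>'_def by (rule M'.prob_space_distr) measurable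
  have bdd: "(\<lambda>n. LINT z|\<nu> (r n). f z) \<longlonglongrightarrow> (LINT z|\<nu>'. f z)"
    if f: "continuous_on UNIV f" and b: "\<And>z. \<bar>f z\<bar> \<le> B" for f :: "complex \<Rightarrow> real" and B
  proof -
    have [measurable]: "f \<in> borel_measurable borel" by (rule borel_measurable_continuous_onI[OF f])
    have "(\<lambda>n. integral\<^sup>L ((M \<circ> id \<circ> r) n) (f \<circ> g)) \<longlonglongrightarrow> integral\<^sup>L M' (f \<circ> g)"
    proof (rule weak_conv_imp_integral_bdd_continuous_conv[OF _ M' wc])
      show "real_distribution ((M \<circ> id \<circ> r) n)" for n using rd by simp
      have gc: "isCont g x" for x using g by (simp add: continuous_on_eq_continuous_at)
      have fc: "isCont f y" for y using f by (simp add: continuous_on_eq_continuous_at)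
      show "isCont (f \<circ> g) x" for x
        unfolding comp_def by (rule isCont_o2[OF gc fc])
      show "norm ((f \<circ> g) x) \<le> B" for x using b by simp
    qed
    moreover have "integral\<^sup>L ((M \<circ> id \<circ> r) n) (f \<circ> g) = (LINT z|\<nu> (r n). f z)" for n
    proof -
      have "integral\<^sup>L ((M \<circ> id \<circ> r) n) (f \<circ> g) = (LINT z|\<nu> (r n). (f \<circ> g) (h z))"
        unfolding M_def comp_def id_def by (rule integral_distr) measurable
      also have "\<dots> = (LINT z|\<nu> (r n). f z)"
      proof (rule integral_cong_AE)
        show "AE z in \<nu> (r n). (f \<circ> g) (h z) = f z"
          using prob_on_AE[OF \<nu> Kb] by eventually_elim (simp add: gh)
      qed (auto simp: comp_def)
      finally show ?thesis .
    qed
    moreover have "integral\<^sup>L M' (f \<circ> g) = (LINT z|\<nu>'. f z)"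
      unfolding \<nu>'_def comp_def by (rule integral_distr[symmetric]) measurable
    ultimately show ?thesis by simp
  qed
  have null: "emeasure \<nu>' (- K) = 0"
  proof -
    \<comment> \<open>The limit is still carried by \<open>K\<close>, since the bounded continuous function \<open>min 1 (infdist z K)\<close> has integral 0.\<close>
    let ?f = "\<lambda>z. min 1 (infdist z K)"
    have fc: "continuous_on UNIV ?f" by (intro continuous_intros)
    have fb: "\<bar>?f z\<bar> \<le> 1" for z using infdist_nonneg[of z K] by (simp add: abs_le_iff min_def)
    have [measurable]: "?f \<in> borel_measurable borel" by (rule borel_measurable_continuous_onI[OF fc])
    have "(LINT z|\<nu> (r n). ?f z) = 0" for n
    proof -
      have "(LINT z|\<nu> (r n). ?f z) = (LINT z|\<nu> (r n). 0)"
      proof (rule integral_cong_AE)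
        show "AE z in \<nu> (r n). ?f z = 0"
          using prob_on_AE[OF \<nu> Kb] by eventually_elim simp
      qed measurable
      then show ?thesis by simp
    qed
    then have z: "(LINT z|\<nu>'. ?f z) = 0" using bdd[OF fc fb] by (simp add: LIMSEQ_const_iff)
    interpret N: prob_space \<nu>' by (rule p')
    have [measurable_cong]: "sets \<nu>' = sets borel" by (simp add: \<nu>'_def)
    have "integrable \<nu>' ?f" by (rule N.integrable_const_bound[where B=1]) (use fb in auto)
    then have "AE z in \<nu>'. ?f z = 0"
      using z by (subst (asm) integral_nonneg_eq_0_iff_AE) (auto simp: infdist_nonneg)
    then have "AE z in \<nu>'. z \<in> K"
    proof eventually_elim
      case (elim z)
      then have "infdist z K = 0" by (simp add: min_def split: if_splits)
      then show ?case using in_closed_iff_infdist_zero[OF compact_imp_closed[OF K] Kne] by simp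
    qed
    then have "AE z in \<nu>'. z \<notin> - K" by simp
    then show ?thesis using Kb by (subst (asm) AE_iff_null_sets[symmetric]) (auto simp: null_sets_def \<nu>'_def)
  qed
  have pn: "prob_on K \<nu>'" unfolding prob_on_def using p' null by (simp add: \<nu>'_def)
  show thesis
  proof (rule that[OF r pn])
    fix f :: "complex \<Rightarrow> real" assume f: "continuous_on UNIV f"
    have "compact (f ` K)" by (rule compact_continuous_image[OF continuous_on_subset[OF f] K]) auto
    then obtain B0 where B0: "\<forall>x\<in>f ` K. norm x \<le> B0" using compact_imp_bounded bounded_iff by blast
    define B where "B = max B0 0"
    \<comment> \<open>Weak convergence concerns bounded functions, so \<open>f\<close> is truncated at its bound on \<open>K\<close>, which leaves the integrals unchanged.\<close>
    define f' where "f' = (\<lambda>z. max (- B) (min B (f z)))"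
    have f'c: "continuous_on UNIV f'" unfolding f'_def by (intro continuous_intros f)
    have f'b: "\<bar>f' z\<bar> \<le> B" for z by (auto simp: f'_def B_def)
    have f'K: "f' z = f z" if "z \<in> K" for z
    proof -
      have "\<bar>f z\<bar> \<le> B" using B0 that by (auto simp: B_def le_max_iff_disj)
      then show ?thesis by (auto simp: f'_def)
    qed
    have [measurable]: "f \<in> borel_measurable borel" "f' \<in> borel_measurable borel"
      by (auto intro: borel_measurable_continuous_onI f f'c)
    have eq: "(LINT z|\<mu>. f' z) = (LINT z|\<mu>. f z)" if "prob_on K \<mu>" for \<mu>
    proof (rule integral_cong_AE)
      have [measurable_cong]: "sets \<mu> = sets borel" using that by (simp add: prob_on_def)
      show "f' \<in> borel_measurable \<mu>" "f \<in> borel_measurable \<mu>" by measurable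
      show "AE z in \<mu>. f' z = f z" using prob_on_AE[OF that Kb] by eventually_elim (rule f'K)
    qed
    show "(\<lambda>n. LINT z|\<nu> (r n). f z) \<longlonglongrightarrow> (LINT z|\<nu>'. f z)"
      using bdd[OF f'c f'b] by (simp add: eq \<nu> pn)
  qed
qed


section \<open>Logarithmic energy\<close>

definition trunc_kernel :: "real \<Rightarrow> real \<Rightarrow> complex \<Rightarrow> complex \<Rightarrow> real" where
  "trunc_kernel D \<delta> z w = ln (D / max \<delta> (cmod (z - w)))"

definition shifted_kernel :: "real \<Rightarrow> complex \<Rightarrow> complex \<Rightarrow> ennreal" where
  "shifted_kernel D z w = (if z = w then \<infinity> else ennreal (ln (D / cmod (z - w))))"

definition mutual_energy :: "real \<Rightarrow> complex measure \<Rightarrow> complex measure \<Rightarrow> ennreal" where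
  "mutual_energy D \<mu> \<nu> = (\<integral>\<^sup>+z. \<integral>\<^sup>+w. shifted_kernel D z w \<partial>\<nu> \<partial>\<mu>)"

lemma shifted_kernel_commute: "shifted_kernel D z w = shifted_kernel D w z"
  by (simp add: shifted_kernel_def norm_minus_commute eq_commute)

lemma borel_measurable_shifted_kernel [measurable]:
  "(\<lambda>(z,w). shifted_kernel D z w) \<in> borel_measurable (borel \<Otimes>\<^sub>M borel)"
  unfolding shifted_kernel_def by measurable

lemma borel_measurable_shifted_kernel' [measurable (raw)]:
  assumes [measurable]: "f \<in> borel_measurable M" "g \<in> borel_measurable M"
  shows "(\<lambda>x. shifted_kernel D (f x) (g x)) \<in> borel_measurable M"
  using measurable_compose[OF measurable_Pair[OF assms] borel_measurable_shifted_kernel[of D]] by simp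

lemma trunc_kernel_lipschitz:
  assumes "D > 0" "\<delta> > 0"
  shows "\<bar>trunc_kernel D \<delta> z w - trunc_kernel D \<delta> z' w\<bar> \<le> dist z z' / \<delta>"
proof -
  have aux: "ln b - ln a \<le> (b - a) / \<delta> \<and> ln a \<le> ln b" if "\<delta> \<le> a" "a \<le> b" for a b :: real
  proof -
    have a: "a > 0" "b > 0" using that assms by auto
    have "ln b - ln a = ln (b / a)" using a by (simp add: ln_div)
    also have "\<dots> \<le> b / a - 1" using a by (intro ln_le_minus_one) auto
    also have "\<dots> = (b - a) / a" using a by (simp add: diff_divide_distrib)
    also have "\<dots> \<le> (b - a) / \<delta>" using that a assms by (intro divide_left_mono) auto
    finally show ?thesis using a that by simp
  qed
  define a where "a = max \<delta> (cmod (z - w))"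
  define b where "b = max \<delta> (cmod (z' - w))"
  have ab: "\<delta> \<le> a" "\<delta> \<le> b" by (auto simp: a_def b_def)
  have tri: "\<bar>cmod (z - w) - cmod (z' - w)\<bar> \<le> dist z z'"
    using norm_triangle_ineq3[of "z - w" "z' - w"] by (simp add: dist_norm)
  have "\<bar>a - b\<bar> \<le> dist z z'" using tri zero_le_dist[of z z'] unfolding a_def b_def by (auto simp: max_def abs_le_iff)
  then have d: "\<bar>a - b\<bar> / \<delta> \<le> dist z z' / \<delta>" using assms by (intro divide_right_mono) auto
  have "trunc_kernel D \<delta> z w - trunc_kernel D \<delta> z' w = ln b - ln a"
    using ab assms by (simp add: trunc_kernel_def a_def[symmetric] b_def[symmetric] ln_div)
  also have "\<bar>\<dots>\<bar> \<le> \<bar>a - b\<bar> / \<delta>"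
    using aux[of a b] aux[of b a] ab by (cases "a \<le> b") (auto simp: abs_if)
  finally show ?thesis using d by linarith
qed

lemma trunc_kernel_commute: "trunc_kernel D \<delta> z w = trunc_kernel D \<delta> w z"
  by (simp add: trunc_kernel_def norm_minus_commute)

lemma continuous_trunc_kernel:
  assumes "D > 0" "\<delta> > 0"
  shows "continuous_on UNIV (trunc_kernel D \<delta> z)"
  unfolding trunc_kernel_def[abs_def] using assms
  by (intro continuous_intros) (auto simp: max_def)

lemma trunc_pot_lipschitz:
  assumes \<mu>: "prob_on K \<mu>" "compact K" and D: "D > 0" "\<delta> > 0"
  shows "\<bar>(LINT w|\<mu>. trunc_kernel D \<delta> z w) - (LINT w|\<mu>. trunc_kernel D \<delta> z' w)\<bar> \<le> dist z z' / \<delta>"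
proof -
  interpret prob_space \<mu> using \<mu> by (simp add: prob_on_def)
  note ti = prob_on_integrable[OF \<mu> continuous_trunc_kernel[OF D]]
  have "(LINT w|\<mu>. trunc_kernel D \<delta> z w) - (LINT w|\<mu>. trunc_kernel D \<delta> z' w) = (LINT w|\<mu>. trunc_kernel D \<delta> z w - trunc_kernel D \<delta> z' w)"
    by (rule Bochner_Integration.integral_diff[OF ti ti, symmetric])
  also have "\<bar>\<dots>\<bar> \<le> (LINT w|\<mu>. \<bar>trunc_kernel D \<delta> z w - trunc_kernel D \<delta> z' w\<bar>)" by (rule integral_abs_bound)
  also have "\<dots> \<le> (LINT w|\<mu>. dist z z' / \<delta>)"
    by (rule integral_mono) (use ti trunc_kernel_lipschitz[OF D] in auto)
  also have "\<dots> = dist z z' / \<delta>" by (simp add: prob_space)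
  finally show ?thesis .
qed

text \<open>
  For a fixed \<open>z\<close> weak convergence gives convergence of the inner integrals.  They are Lipschitz in
  \<open>z\<close> with constant \<open>1 / \<delta>\<close>, whatever the measure, so that the convergence is uniform on \<open>K\<close>.
\<close>

lemma trunc_energy_limit:
  assumes K: "compact K" and D: "D > 0" "\<delta> > 0" and \<nu>: "\<And>n. prob_on K (\<nu> n)" and \<nu>': "prob_on K \<nu>'"
    and lim: "\<And>f :: complex \<Rightarrow> real. continuous_on UNIV f \<Longrightarrow> (\<lambda>n. LINT z|\<nu> n. f z) \<longlonglongrightarrow> (LINT z|\<nu>'. f z)"
  shows "(\<lambda>n. LINT z|\<nu> n. LINT w|\<nu> n. trunc_kernel D \<delta> z w) \<longlonglongrightarrow> (LINT z|\<nu>'. LINT w|\<nu>'. trunc_kernel D \<delta> z w)"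
proof -
  let ?t = "trunc_kernel D \<delta>"
  define G where "G = (\<lambda>\<mu> z. LINT w|\<mu>. ?t z w)"
  have Kb: "K \<in> sets borel" by (rule borel_compact[OF K])
  have Glip: "\<bar>G \<mu> z - G \<mu> z'\<bar> \<le> dist z z' / \<delta>" if \<mu>: "prob_on K \<mu>" for \<mu> z z'
    unfolding G_def by (rule trunc_pot_lipschitz[OF \<mu> K D])
  have Gc: "continuous_on UNIV (G \<mu>)" if \<mu>: "prob_on K \<mu>" for \<mu>
    unfolding continuous_on_iff
  proof (intro ballI allI impI)
    fix x :: complex and e :: real assume "e > 0"
    show "\<exists>d>0. \<forall>x'\<in>UNIV. dist x' x < d \<longrightarrow> dist (G \<mu> x') (G \<mu> x) < e"
    proof (intro exI[of _ "e * \<delta>"] conjI ballI impI)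
      fix x' assume "dist x' x < e * \<delta>"
      then have "dist x' x / \<delta> < e" using D by (simp add: field_simps)
      then show "dist (G \<mu> x') (G \<mu> x) < e" using Glip[OF \<mu>, of x' x] by (simp add: dist_real_def)
    qed (use D \<open>e > 0\<close> in auto)
  qed
  have pw: "(\<lambda>n. G (\<nu> n) z) \<longlonglongrightarrow> G \<nu>' z" for z
    unfolding G_def by (rule lim[OF continuous_trunc_kernel[OF D]])
  have unif: "\<forall>\<^sub>F n in sequentially. \<forall>z\<in>K. \<bar>G (\<nu> n) z - G \<nu>' z\<bar> < e" if e: "e > 0" for e
  proof -
    define d where "d = e * \<delta> / 3"
    have d: "d > 0" using e D by (simp add: d_def)
    have cov: "K \<subseteq> (\<Union>x\<in>K. ball x d)" using d by auto
    obtain X where X: "X \<subseteq> K" "finite X" "K \<subseteq> (\<Union>x\<in>X. ball x d)"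
      by (rule compactE_image[OF K open_ball cov])
    have "\<forall>\<^sub>F n in sequentially. \<forall>x\<in>X. dist (G (\<nu> n) x) (G \<nu>' x) < e/3"
      by (intro eventually_ball_finite X ballI tendstoD[OF pw]) (use e in simp)
    then show ?thesis
    proof eventually_elim
      case (elim n)
      show ?case
      proof
        fix z assume "z \<in> K"
        then obtain x where x: "x \<in> X" "dist x z < d" using X by auto
        have "dist z x / \<delta> < e/3" using x D by (simp add: d_def field_simps dist_commute)
        then have "\<bar>G (\<nu> n) z - G (\<nu> n) x\<bar> < e/3" "\<bar>G \<nu>' z - G \<nu>' x\<bar> < e/3"
          using Glip[OF \<nu>[of n], of z x] Glip[OF \<nu>', of z x] by linarith+
        moreover have "\<bar>G (\<nu> n) x - G \<nu>' x\<bar> < e/3" using elim x by (auto simp: dist_real_def)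
        ultimately show "\<bar>G (\<nu> n) z - G \<nu>' z\<bar> < e" by linarith
      qed
    qed
  qed
  have "(\<lambda>n. LINT z|\<nu> n. G (\<nu> n) z) \<longlonglongrightarrow> (LINT z|\<nu>'. G \<nu>' z)"
  proof (rule tendstoI)
    fix e :: real assume e: "e > 0"
    have "\<forall>\<^sub>F n in sequentially. dist (LINT z|\<nu> n. G \<nu>' z) (LINT z|\<nu>'. G \<nu>' z) < e/2"
      using e by (intro tendstoD[OF lim[OF Gc[OF \<nu>']]]) simp
    moreover have "\<forall>\<^sub>F n in sequentially. \<forall>z\<in>K. \<bar>G (\<nu> n) z - G \<nu>' z\<bar> < e/2" using e by (intro unif) simp
    ultimately show "\<forall>\<^sub>F n in sequentially. dist (LINT z|\<nu> n. G (\<nu> n) z) (LINT z|\<nu>'. G \<nu>' z) < e"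
    proof eventually_elim
      case (elim n)
      interpret prob_space "\<nu> n" using \<nu>[of n] by (simp add: prob_on_def)
      have i: "integrable (\<nu> n) (G (\<nu> n))" "integrable (\<nu> n) (G \<nu>')"
        by (intro prob_on_integrable[OF \<nu> K] Gc \<nu> \<nu>')+
      have "(LINT z|\<nu> n. G (\<nu> n) z) - (LINT z|\<nu> n. G \<nu>' z) = (LINT z|\<nu> n. G (\<nu> n) z - G \<nu>' z)"
        by (rule Bochner_Integration.integral_diff[OF i, symmetric])
      also have "\<bar>\<dots>\<bar> \<le> (LINT z|\<nu> n. \<bar>G (\<nu> n) z - G \<nu>' z\<bar>)" by (rule integral_abs_bound)
      also have "\<dots> \<le> (LINT z|\<nu> n. e/2)"
      proof (rule integral_mono_AE)
        show "AE z in \<nu> n. \<bar>G (\<nu> n) z - G \<nu>' z\<bar> \<le> e/2"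
          using prob_on_AE[OF \<nu> Kb] by eventually_elim (use elim in \<open>auto intro: less_imp_le\<close>)
      qed (use i in auto)
      also have "\<dots> = e/2" by (simp add: prob_space)
      finally have 1: "\<bar>(LINT z|\<nu> n. G (\<nu> n) z) - (LINT z|\<nu> n. G \<nu>' z)\<bar> \<le> e/2" .
      from elim(1) 1 show ?case unfolding dist_real_def by linarith
    qed
  qed
  then show ?thesis unfolding G_def .
qed

lemma trunc_kernel_nonneg:
  assumes "\<delta> > 0" "\<delta> \<le> D" "cmod (z - w) \<le> D"
  shows "0 \<le> trunc_kernel D \<delta> z w"
  using assms unfolding trunc_kernel_def by (intro ln_ge_zero) (auto simp: le_divide_eq max_def)

lemma trunc_kernel_le_shifted:
  assumes "\<delta> > 0" "D > 0"
  shows "ennreal (trunc_kernel D \<delta> z w) \<le> shifted_kernel D z w"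
proof (cases "z = w")
  case False
  then have "trunc_kernel D \<delta> z w \<le> ln (D / cmod (z - w))"
    using assms unfolding trunc_kernel_def by (subst ln_le_cancel_iff) (auto intro!: divide_left_mono simp: less_max_iff_disj)
  then show ?thesis using False by (auto simp: shifted_kernel_def intro: ennreal_leI)
qed (simp add: shifted_kernel_def)

lemma shifted_kernel_eq_SUP:
  assumes "D > 0"
  shows "shifted_kernel D z w = (SUP k. ennreal (trunc_kernel D (D / (real k + 1)) z w))"
proof (rule antisym)
  show "(SUP k. ennreal (trunc_kernel D (D / (real k + 1)) z w)) \<le> shifted_kernel D z w"
    using assms by (intro SUP_least trunc_kernel_le_shifted) auto
  show "shifted_kernel D z w \<le> (SUP k. ennreal (trunc_kernel D (D / (real k + 1)) z w))"
  proof (cases "z = w")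
    case True
    have e: "trunc_kernel D (D / (real k + 1)) z w = ln (real k + 1)" for k
      using assms True by (simp add: trunc_kernel_def)
    have "(SUP k. ennreal (ln (real k + 1))) = \<infinity>"
      unfolding infinity_ennreal_def
    proof (rule ennreal_SUP_eq_top)
      fix n
      obtain k where "exp (real n) < real k" using reals_Archimedean2 by blast
      then have "real n \<le> ln (real k + 1)" by (subst ln_ge_iff) auto
      then show "\<exists>i\<in>UNIV. of_nat n \<le> ennreal (ln (real i + 1))"
        by (intro bexI[of _ k]) (auto simp: ennreal_of_nat_eq_real_of_nat intro: ennreal_leI)
    qed
    then have "(SUP k. ennreal (trunc_kernel D (D / (real k + 1)) z w)) = \<infinity>" by (simp only: e)
    then show ?thesis by (simp only: infinity_ennreal_def top_greatest)
  next
    case False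
    obtain k where k: "D / cmod (z - w) < real k" using reals_Archimedean2 by blast
    have "D < real k * cmod (z - w)" using k False by (simp add: field_simps)
    then have "D \<le> (real k + 1) * cmod (z - w)" using norm_ge_zero[of "z - w"] unfolding distrib_right by linarith
    then have "D / (real k + 1) \<le> cmod (z - w)" by (simp add: divide_le_eq mult.commute)
    then have "trunc_kernel D (D / (real k + 1)) z w = ln (D / cmod (z - w))" by (simp add: trunc_kernel_def max_def)
    then show ?thesis using False by (simp add: shifted_kernel_def) (rule SUP_upper2[of k], simp_all)
  qed
qed

lemma incseq_trunc_kernel:
  assumes D: "D > 0"
  shows "incseq (\<lambda>k w. ennreal (trunc_kernel D (D / (real k + 1)) z w))"
proof (rule incseq_SucI, rule le_funI)
    fix k w
    have "D / (real (Suc k) + 1) \<le> D / (real k + 1)" using D by (intro divide_left_mono) auto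
    then have "max (D / (real (Suc k) + 1)) (cmod (z - w)) \<le> max (D / (real k + 1)) (cmod (z - w))" by (intro max.mono) auto
    moreover have "0 < max (D / (real (Suc k) + 1)) (cmod (z - w))" using D by (simp add: less_max_iff_disj)
    ultimately have "trunc_kernel D (D / (real k + 1)) z w \<le> trunc_kernel D (D / (real (Suc k) + 1)) z w"
      unfolding trunc_kernel_def using D by (subst ln_le_cancel_iff) (auto intro!: divide_left_mono simp: less_max_iff_disj simp del: of_nat_Suc)
    then show "ennreal (trunc_kernel D (D / (real k + 1)) z w) \<le> ennreal (trunc_kernel D (D / (real (Suc k) + 1)) z w)" by (rule ennreal_leI)
qed

lemma nn_integral_trunc_energy:
  assumes K: "compact K" and d: "\<delta> > 0" "\<delta> \<le> D" and KD: "\<And>z w. z \<in> K \<Longrightarrow> w \<in> K \<Longrightarrow> cmod (z - w) \<le> D" and \<nu>: "prob_on K \<nu>"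
  shows "(\<integral>\<^sup>+z. \<integral>\<^sup>+w. ennreal (trunc_kernel D \<delta> z w) \<partial>\<nu> \<partial>\<nu>) = ennreal (LINT z|\<nu>. LINT w|\<nu>. trunc_kernel D \<delta> z w)"
proof -
  have D: "D > 0" using d by linarith
  interpret prob_space \<nu> using \<nu> by (simp add: prob_on_def)
  have [measurable_cong]: "sets \<nu> = sets borel" using \<nu> by (simp add: prob_on_def)
  have Kb: "K \<in> sets borel" by (rule borel_compact[OF K])
  have tm[measurable]: "(\<lambda>(z,w). trunc_kernel D \<delta> z w) \<in> borel_measurable (borel \<Otimes>\<^sub>M borel)" for \<delta>
    unfolding trunc_kernel_def by measurable
  let ?t = "trunc_kernel D \<delta>"
  have ti: "integrable \<nu> (?t z)" for z by (rule prob_on_integrable[OF \<nu> K continuous_trunc_kernel[OF D d(1)]])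
  have nn: "AE w in \<nu>. 0 \<le> ?t z w" if "z \<in> K" for z
    using prob_on_AE[OF \<nu> Kb] by eventually_elim (use that KD d in \<open>auto intro: trunc_kernel_nonneg\<close>)
  have Gnn: "AE z in \<nu>. 0 \<le> (LINT w|\<nu>. ?t z w)"
    using prob_on_AE[OF \<nu> Kb]
  proof eventually_elim
    case (elim z)
    show ?case by (rule integral_nonneg_AE[OF nn[OF elim]])
  qed
  have Gi: "integrable \<nu> (\<lambda>z. LINT w|\<nu>. ?t z w)"
  proof (rule integrable_const_bound)
    show "AE z in \<nu>. norm (LINT w|\<nu>. ?t z w) \<le> ln (D / \<delta>)"
      using prob_on_AE[OF \<nu> Kb] Gnn
    proof eventually_elim
      case (elim z)
      have "(LINT w|\<nu>. ?t z w) \<le> (LINT w|\<nu>. ln (D / \<delta>))"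
      proof (rule integral_mono[OF ti])
        fix w show "?t z w \<le> ln (D / \<delta>)"
        proof -
          have p: "0 < max (\<delta>) (cmod (z - w))" using d(1) by (simp add: less_max_iff_disj)
          have "D / max (\<delta>) (cmod (z - w)) \<le> D / \<delta>"
            by (rule divide_left_mono) (use d D p in \<open>auto intro!: mult_pos_pos\<close>)
          moreover have "0 < D / max (\<delta>) (cmod (z - w))" using p D by (intro divide_pos_pos)
          ultimately show ?thesis unfolding trunc_kernel_def by (rule ln_mono)
        qed
      qed auto
      then show ?case using elim by (simp add: prob_space)
    qed
  qed measurable
  have "(\<integral>\<^sup>+z. \<integral>\<^sup>+w. ennreal (?t z w) \<partial>\<nu> \<partial>\<nu>) = (\<integral>\<^sup>+z. ennreal (LINT w|\<nu>. ?t z w) \<partial>\<nu>)"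
  proof (rule nn_integral_cong_AE)
    show "AE z in \<nu>. (\<integral>\<^sup>+w. ennreal (?t z w) \<partial>\<nu>) = ennreal (LINT w|\<nu>. ?t z w)"
      using prob_on_AE[OF \<nu> Kb]
    proof eventually_elim
      case (elim z)
      show ?case by (rule nn_integral_eq_integral[OF ti nn[OF elim]])
    qed
  qed
  also have "\<dots> = ennreal (LINT z|\<nu>. LINT w|\<nu>. ?t z w)" by (rule nn_integral_eq_integral[OF Gi Gnn])
  finally show ?thesis .
qed

lemma mutual_energy_le_if_trunc_le:
  assumes K: "compact K" and D: "D > 0" and KD: "\<And>z w. z \<in> K \<Longrightarrow> w \<in> K \<Longrightarrow> cmod (z - w) \<le> D" and \<nu>: "prob_on K \<nu>"
    and le: "\<And>\<delta>. \<delta> > 0 \<Longrightarrow> \<delta> \<le> D \<Longrightarrow> (LINT z|\<nu>. LINT w|\<nu>. trunc_kernel D \<delta> z w) \<le> c"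
  shows "mutual_energy D \<nu> \<nu> \<le> ennreal c"
proof -
  interpret prob_space \<nu> using \<nu> by (simp add: prob_on_def)
  have [measurable_cong]: "sets \<nu> = sets borel" using \<nu> by (simp add: prob_on_def)
  let ?d = "\<lambda>k::nat. D / (real k + 1)"
  have tm[measurable]: "(\<lambda>(z,w). trunc_kernel D \<delta> z w) \<in> borel_measurable (borel \<Otimes>\<^sub>M borel)" for \<delta>
    unfolding trunc_kernel_def by measurable
  have inc: "incseq (\<lambda>k w. ennreal (trunc_kernel D (?d k) z w))" for z
    by (rule incseq_trunc_kernel[OF D])
  have "mutual_energy D \<nu> \<nu> = (\<integral>\<^sup>+z. \<integral>\<^sup>+w. (SUP k. ennreal (trunc_kernel D (?d k) z w)) \<partial>\<nu> \<partial>\<nu>)"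
    unfolding mutual_energy_def shifted_kernel_eq_SUP[OF D] ..
  also have "\<dots> = (\<integral>\<^sup>+z. (SUP k. \<integral>\<^sup>+w. ennreal (trunc_kernel D (?d k) z w) \<partial>\<nu>) \<partial>\<nu>)"
    by (intro nn_integral_cong nn_integral_monotone_convergence_SUP inc) measurable
  also have "\<dots> = (SUP k. \<integral>\<^sup>+z. \<integral>\<^sup>+w. ennreal (trunc_kernel D (?d k) z w) \<partial>\<nu> \<partial>\<nu>)"
  proof (rule nn_integral_monotone_convergence_SUP)
    show "incseq (\<lambda>k z. \<integral>\<^sup>+w. ennreal (trunc_kernel D (?d k) z w) \<partial>\<nu>)"
      using inc by (auto simp: incseq_def le_fun_def intro!: nn_integral_mono)
    show "(\<lambda>z. \<integral>\<^sup>+w. ennreal (trunc_kernel D (?d k) z w) \<partial>\<nu>) \<in> borel_measurable \<nu>" for k by measurable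
  qed
  also have "\<dots> \<le> ennreal c"
  proof (rule SUP_least)
    fix k
    have d: "?d k > 0" "?d k \<le> D" using D by (auto simp: field_simps)
    have "(\<integral>\<^sup>+z. \<integral>\<^sup>+w. ennreal (trunc_kernel D (?d k) z w) \<partial>\<nu> \<partial>\<nu>) = ennreal (LINT z|\<nu>. LINT w|\<nu>. trunc_kernel D (?d k) z w)"
      by (rule nn_integral_trunc_energy[OF K d KD \<nu>])
    also have "\<dots> \<le> ennreal c" by (intro ennreal_leI le d)
    finally show "(\<integral>\<^sup>+z. \<integral>\<^sup>+w. ennreal (trunc_kernel D (?d k) z w) \<partial>\<nu> \<partial>\<nu>) \<le> ennreal c" .
  qed
  finally show ?thesis .
qed

text \<open>
  The truncated energies pass to a weak limit, and by monotone convergence the energy of the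
  limit is the supremum of its truncated energies.
\<close>

lemma energy_lower_semicontinuous:
  assumes K: "compact K" and D: "D > 0" and KD: "\<And>z w. z \<in> K \<Longrightarrow> w \<in> K \<Longrightarrow> cmod (z - w) \<le> D" and \<nu>: "\<And>n. prob_on K (\<nu> n)"
    and le: "\<And>\<delta> e. \<delta> > 0 \<Longrightarrow> \<delta> \<le> D \<Longrightarrow> e > 0 \<Longrightarrow> \<forall>\<^sub>F n in sequentially. (LINT z|\<nu> n. LINT w|\<nu> n. trunc_kernel D \<delta> z w) \<le> c + e"
  obtains \<nu>' where "prob_on K \<nu>'" "mutual_energy D \<nu>' \<nu>' \<le> ennreal c"
proof -
  obtain s \<nu>' where s: "strict_mono (s :: nat \<Rightarrow> nat)" and \<nu>': "prob_on K \<nu>'" and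
    lim: "\<And>f :: complex \<Rightarrow> real. continuous_on UNIV f \<Longrightarrow> (\<lambda>n. LINT z|\<nu> (s n). f z) \<longlonglongrightarrow> (LINT z|\<nu>'. f z)"
  proof (rule prob_on_weakly_compact[OF K \<nu>])
    fix s \<nu>' assume "strict_mono (s :: nat \<Rightarrow> nat)" "prob_on K \<nu>'"
      "\<And>f :: complex \<Rightarrow> real. continuous_on UNIV f \<Longrightarrow> (\<lambda>n. LINT z|\<nu> (s n). f z) \<longlonglongrightarrow> (LINT z|\<nu>'. f z)"
    then show thesis by (rule that)
  qed
  have "mutual_energy D \<nu>' \<nu>' \<le> ennreal c"
  proof (rule mutual_energy_le_if_trunc_le[OF K D KD \<nu>'])
    fix \<delta> :: real assume \<delta>: "\<delta> > 0" "\<delta> \<le> D"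
    show "(LINT z|\<nu>'. LINT w|\<nu>'. trunc_kernel D \<delta> z w) \<le> c"
    proof (rule field_le_epsilon)
      fix e :: real assume e: "e > 0"
      show "(LINT z|\<nu>'. LINT w|\<nu>'. trunc_kernel D \<delta> z w) \<le> c + e"
      proof (rule tendsto_upperbound)
        show "(\<lambda>n. LINT z|\<nu> (s n). LINT w|\<nu> (s n). trunc_kernel D \<delta> z w) \<longlonglongrightarrow> (LINT z|\<nu>'. LINT w|\<nu>'. trunc_kernel D \<delta> z w)"
          by (rule trunc_energy_limit[OF K D \<delta>(1) \<nu> \<nu>' lim])
        show "\<forall>\<^sub>F n in sequentially. (LINT z|\<nu> (s n). LINT w|\<nu> (s n). trunc_kernel D \<delta> z w) \<le> c + e"
          by (rule eventually_subseq[OF s le[OF \<delta> e]])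
      qed simp
    qed
  qed
  with \<nu>' show ?thesis by (rule that)
qed

section \<open>Supports and a maximum principle for weighted polynomials\<close>

definition support :: "complex measure \<Rightarrow> complex set" where
  "support \<mu> = {z. \<forall>r>0. emeasure \<mu> (ball z r) > 0}"

lemma closed_support: "sets \<mu> = sets borel \<Longrightarrow> closed (support \<mu>)"
  unfolding closed_def open_contains_ball
proof (intro ballI)
  fix z assume s: "sets \<mu> = sets borel" and "z \<in> - support \<mu>"
  then obtain r where r: "r > 0" "emeasure \<mu> (ball z r) = 0" by (auto simp: support_def not_less)
  have "ball z r \<subseteq> - support \<mu>"
  proof
    fix x assume x: "x \<in> ball z r"
    define r' where "r' = r - dist z x"
    have "ball x r' \<subseteq> ball z r"
    proof
      fix y assume "y \<in> ball x r'"
      then show "y \<in> ball z r" using dist_triangle[of z y x] by (simp add: r'_def)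
    qed
    then have "emeasure \<mu> (ball x r') \<le> emeasure \<mu> (ball z r)" using s by (intro emeasure_mono) auto
    with r x show "x \<in> - support \<mu>" unfolding support_def by (auto intro!: exI[of _ r'] simp: r'_def)
  qed
  with r show "\<exists>e>0. ball z e \<subseteq> - support \<mu>" by blast
qed

lemma emeasure_outside_support:
  assumes s: "sets \<mu> = sets borel"
  shows "emeasure \<mu> (- support \<mu>) = 0"
proof -
  define F where "F = {ball z r |z r. emeasure \<mu> (ball z r) = 0}"
  obtain F' where F': "F' \<subseteq> F" "countable F'" "\<Union>F' = \<Union>F"
    by (rule Lindelof[of F]) (auto simp: F_def)
  have "(\<Union>B\<in>F'. B) \<in> null_sets \<mu>"
  proof (rule null_sets_UN')
    show "countable F'" by (rule F'(2))
    fix B assume "B \<in> F'"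
    then obtain z r where "B = ball z r" "emeasure \<mu> (ball z r) = 0" using F'(1) by (auto simp: F_def)
    then show "B \<in> null_sets \<mu>" using s by (auto simp: null_sets_def)
  qed
  then have N: "\<Union>F \<in> null_sets \<mu>" unfolding F'(3)[symmetric] by simp
  have M: "- support \<mu> \<in> sets \<mu>" using closed_support[OF s] s by (simp add: borel_closed borel_comp)
  have sub: "- support \<mu> \<subseteq> \<Union>F"
  proof
    fix z assume "z \<in> - support \<mu>"
    then obtain r where r: "r > 0" "emeasure \<mu> (ball z r) = 0" by (auto simp: support_def)
    then have "ball z r \<in> F" by (auto simp: F_def)
    moreover have "z \<in> ball z r" using r by simp
    ultimately show "z \<in> \<Union>F" by (rule UnionI)
  qed
  from null_sets_subset[OF N M sub] show ?thesis by (rule null_setsD1)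
qed

lemma support_subset:
  assumes "prob_on K \<mu>" "closed K"
  shows "support \<mu> \<subseteq> K"
proof (rule ccontr)
  assume "\<not> ?thesis"
  then obtain z where z: "z \<in> support \<mu>" "z \<in> - K" by blast
  have "open (- K)" by (rule open_Compl[OF assms(2)])
  then obtain r where r: "r > 0" "ball z r \<subseteq> - K" using z(2) by (meson open_contains_ball)
  have "emeasure \<mu> (ball z r) \<le> emeasure \<mu> (- K)" using r assms by (intro emeasure_mono) (auto simp: prob_on_def)
  then show False using z r assms by (auto simp: support_def prob_on_def)
qed

lemma prob_on_support: "prob_on K \<mu> \<Longrightarrow> prob_on (support \<mu>) \<mu>"
  using emeasure_outside_support[of \<mu>] by (simp add: prob_on_def)

lemma log_pot_eq_trunc:
  assumes "prob_on S \<mu>" "closed S" "\<delta> > 0" "\<And>w. w \<in> S \<Longrightarrow> \<delta> \<le> cmod (z - w)"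
  shows "log_pot \<mu> z = - (LINT w|\<mu>. trunc_kernel 1 \<delta> z w)"
proof -
  have [measurable_cong]: "sets \<mu> = sets borel" using assms by (simp add: prob_on_def)
  have "log_pot \<mu> z = (LINT w|\<mu>. - trunc_kernel 1 \<delta> z w)"
    unfolding log_pot_def
  proof (rule integral_cong_AE)
    show "AE w in \<mu>. ln (cmod (z - w)) = - trunc_kernel 1 \<delta> z w"
      using prob_on_AE[OF assms(1) borel_closed[OF assms(2)]]
    proof eventually_elim
      case (elim w)
      then have "max \<delta> (cmod (z - w)) = cmod (z - w)" "cmod (z - w) > 0" using assms(3) assms(4)[of w] by auto
      then show ?case by (simp add: trunc_kernel_def ln_div)
    qed
  qed (auto simp: trunc_kernel_def)
  then show ?thesis by simp
qed

lemma integrable_log_off_support: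
  assumes "prob_on S \<mu>" "compact S" "z \<notin> S"
  shows "integrable \<mu> (\<lambda>w. ln (cmod (z - w)))"
proof -
  have [measurable_cong]: "sets \<mu> = sets borel" using assms by (simp add: prob_on_def)
  have "open (- S)" using assms compact_imp_closed by auto
  then obtain \<delta> where d: "\<delta> > 0" "ball z \<delta> \<subseteq> - S" using assms(3) by (meson ComplI open_contains_ball)
  have "integrable \<mu> (\<lambda>w. - trunc_kernel 1 \<delta> z w)"
    using prob_on_integrable[OF assms(1,2) continuous_trunc_kernel[of 1 \<delta> z]] d by auto
  then show ?thesis
  proof (rule Bochner_Integration.integrable_cong_AE_imp)
    show "AE w in \<mu>. - trunc_kernel 1 \<delta> z w = ln (cmod (z - w))"
      using prob_on_AE[OF assms(1) borel_compact[OF assms(2)]]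
    proof eventually_elim
      case (elim w)
      then have "\<not> dist z w < \<delta>" using d by auto
      then have "max \<delta> (cmod (z - w)) = cmod (z - w)" "cmod (z - w) > 0" using d by (auto simp: dist_norm)
      then show ?case by (simp add: trunc_kernel_def ln_div)
    qed
  qed measurable
qed

lemma continuous_log_pot:
  assumes \<mu>: "prob_on S \<mu>" "compact S"
  shows "continuous_on (- S) (log_pot \<mu>)"
proof (rule continuous_at_imp_continuous_on, rule ballI)
  fix z assume "z \<in> - S"
  have "open (- S)" using assms compact_imp_closed by auto
  then obtain d where d: "d > 0" "ball z d \<subseteq> - S" using \<open>z \<in> - S\<close> by (meson open_contains_ball)
  define \<delta> where "\<delta> = d / 2"
  have \<delta>: "\<delta> > 0" using d by (simp add: \<delta>_def)
  have far: "\<delta> \<le> cmod (x - w)" if "dist x z < \<delta>" "w \<in> S" for x w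
  proof -
    have "\<not> dist z w < d" using d that by auto
    then show ?thesis using dist_triangle[of z w x] that by (simp add: \<delta>_def dist_commute dist_norm[symmetric])
  qed
  show "isCont (log_pot \<mu>) z"
    unfolding continuous_at_eps_delta
  proof (intro allI impI)
    fix e :: real assume e: "e > 0"
    show "\<exists>d>0. \<forall>x'. dist x' z < d \<longrightarrow> dist (log_pot \<mu> x') (log_pot \<mu> z) < e"
    proof (intro exI[of _ "min \<delta> (e * \<delta>)"] conjI allI impI)
      fix x assume x: "dist x z < min \<delta> (e * \<delta>)"
      have "dist x z / \<delta> < e" using x \<delta> by (simp add: field_simps)
      moreover have "log_pot \<mu> x = - (LINT w|\<mu>. trunc_kernel 1 \<delta> x w)" "log_pot \<mu> z = - (LINT w|\<mu>. trunc_kernel 1 \<delta> z w)"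
        using \<delta> by (intro log_pot_eq_trunc[OF \<mu>(1) compact_imp_closed[OF \<mu>(2)]] far; use x in auto)+
      moreover have "\<bar>(LINT w|\<mu>. trunc_kernel 1 \<delta> x w) - (LINT w|\<mu>. trunc_kernel 1 \<delta> z w)\<bar> \<le> dist x z / \<delta>"
        by (rule trunc_pot_lipschitz[OF \<mu>]) (use \<delta> in auto)
      ultimately show "dist (log_pot \<mu> x) (log_pot \<mu> z) < e" by (simp add: dist_real_def)
    qed (use \<delta> e in auto)
  qed
qed

lemma log_pot_ge:
  assumes "prob_on S \<mu>" "compact S" "S \<subseteq> cball 0 \<rho>" "cmod z > \<rho>"
  shows "ln (cmod z - \<rho>) \<le> log_pot \<mu> z"
proof -
  interpret prob_space \<mu> using assms by (simp add: prob_on_def)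
  have "z \<notin> S" using assms by auto
  have "ln (cmod z - \<rho>) = (LINT w|\<mu>. ln (cmod z - \<rho>))" by (simp add: prob_space)
  also have "\<dots> \<le> log_pot \<mu> z" unfolding log_pot_def
  proof (rule integral_mono_AE)
    show "integrable \<mu> (\<lambda>w. ln (cmod (z - w)))" by (rule integrable_log_off_support[OF assms(1,2) \<open>z \<notin> S\<close>])
    show "AE w in \<mu>. ln (cmod z - \<rho>) \<le> ln (cmod (z - w))"
      using prob_on_AE[OF assms(1) borel_compact[OF assms(2)]]
    proof eventually_elim
      case (elim w)
      then have "cmod w \<le> \<rho>" using assms(3) by auto
      then have "cmod z - \<rho> \<le> cmod (z - w)" using norm_triangle_ineq2[of z w] by linarith
      then show ?case using assms(4) by (intro ln_mono) auto
    qed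
  qed auto
  finally show ?thesis .
qed

lemma log_pot_ball_mean:
  assumes "prob_on S \<mu>" "compact S" "r > 0" "ball c r \<inter> S = {}"
  shows "integrable lborel (\<lambda>z. indicator (ball c r) z * log_pot \<mu> z)"
    and "(LINT z|lborel. indicator (ball c r) z * log_pot \<mu> z) = measure lborel (ball c r) * log_pot \<mu> c"
proof -
  obtain \<rho> where \<rho>: "S \<subseteq> cball 0 \<rho>" using compact_imp_bounded[OF assms(2)] by (auto simp: bounded_iff subset_eq)
  have p: "prob_on (cball 0 \<rho>) \<mu>" by (rule prob_on_subset[OF assms(1) \<rho>]) (auto intro: borel_compact assms)
  have b: "indicator (ball c r) z = (0::real)" if "cmod z \<ge> cmod c + r" for z
    using that norm_triangle_ineq2[of z c] by (auto simp: indicator_def dist_norm norm_minus_commute)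
  have bm: "(indicator (ball c r) :: complex \<Rightarrow> real) \<in> borel_measurable borel" by (intro borel_measurable_indicator) simp
  note F = log_pot_Fubini[OF p bm, of 1 "cmod c + r"]
  show "integrable lborel (\<lambda>z. indicator (ball c r) z * log_pot \<mu> z)"
    by (rule F(1)) (use b in \<open>auto simp: indicator_def\<close>)
  have "(LINT z|lborel. indicator (ball c r) z * log_pot \<mu> z) = (LINT w|\<mu>. LINT z|lborel. indicator (ball c r) z * ln (cmod (z - w)))"
    by (rule F(2)) (use b in \<open>auto simp: indicator_def\<close>)
  also have "\<dots> = (LINT w|\<mu>. measure lborel (ball c r) * ln (cmod (c - w)))"
  proof (rule integral_cong_AE)
    have s: "sets \<mu> = sets borel" using assms by (simp add: prob_on_def)
    note [measurable_cong] = s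
    show "(\<lambda>w. measure lborel (ball c r) * ln (cmod (c - w))) \<in> borel_measurable \<mu>" by measurable
    show "(\<lambda>w. LINT z|lborel. indicator (ball c r) z * ln (cmod (z - w))) \<in> borel_measurable \<mu>"
      by (rule borel_measurable_integrable, rule F(4)) (use b in \<open>auto simp: indicator_def\<close>)
    show "AE w in \<mu>. (LINT z|lborel. indicator (ball c r) z * ln (cmod (z - w))) = measure lborel (ball c r) * ln (cmod (c - w))"
      using prob_on_AE[OF assms(1) borel_compact[OF assms(2)]]
    proof eventually_elim
      case (elim w)
      then have "\<not> dist c w < r" using assms(4) by auto
      then show ?case using assms(3) by (intro ball_mean_log_eq) (auto simp: dist_norm)
    qed
  qed
  also have "\<dots> = measure lborel (ball c r) * log_pot \<mu> c" by (simp add: log_pot_def)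
  finally show "(LINT z|lborel. indicator (ball c r) z * log_pot \<mu> z) = measure lborel (ball c r) * log_pot \<mu> c" .
qed

definition log_sum :: "complex multiset \<Rightarrow> complex \<Rightarrow> real" where
  "log_sum A z = (\<Sum>w\<in>#A. ln (cmod (z - w)))"

lemma monic_poly_eq_prod:
  assumes "lead_coeff (p :: complex poly) = 1"
  shows "poly p z = (\<Prod>w\<in>#proots p. z - w)"
proof -
  have "p = (\<Prod>x\<in>#proots p. [:-x, 1:])" using complex_poly_decompose_multiset[of p] assms by simp
  then have "poly p z = poly (\<Prod>x\<in>#proots p. [:-x, 1:]) z" by simp
  also have "\<dots> = (\<Prod>w\<in>#proots p. z - w)" by (induction "proots p" arbitrary: p) (auto simp: poly_prod_mset)
  finally show ?thesis .
qed

lemma ln_prod_mset: "z \<notin># A \<Longrightarrow> ln (cmod (\<Prod>w\<in>#A. z - w)) = log_sum A z" for z :: complex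
proof (induction A)
  case (add x A)
  have "(\<Prod>w\<in>#A. z - w) \<noteq> 0" using add.prems by auto
  then show ?case using add by (auto simp: log_sum_def norm_mult ln_mult)
qed (simp add: log_sum_def)

lemma ln_cmod_poly:
  assumes "lead_coeff (p :: complex poly) = 1" "poly p z \<noteq> 0"
  shows "ln (cmod (poly p z)) = log_sum (proots p) z"
proof -
  have "p \<noteq> 0" using assms by auto
  then have "z \<notin># proots p" using assms(2) by simp
  then show ?thesis using ln_prod_mset[of z "proots p"] monic_poly_eq_prod[OF assms(1), of z] by simp
qed

lemma log_sum_ball_mean:
  "integrable lborel (\<lambda>z. indicator (ball c r) z * log_sum A z)"
  "c \<notin># A \<Longrightarrow> measure lborel (ball c r) * log_sum A c \<le> (LINT z|lborel. indicator (ball c r) z * log_sum A z)"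
proof (induction A)
  case empty
  { case 1 show ?case by (simp add: log_sum_def) next case 2 show ?case by (simp add: log_sum_def) }
next
  case (add x A)
  have i: "integrable lborel (\<lambda>z. indicator (ball c r) z * ln (cmod (z - x)))"
  proof (rule integrable_log_bounded[where B=1 and R="cmod c + r"])
    fix z assume "cmod z \<ge> cmod c + r"
    then show "indicator (ball c r) z = (0::real)" using norm_triangle_ineq2[of z c] by (auto simp: indicator_def dist_norm norm_minus_commute)
  qed (auto simp: indicator_def)
  have e: "indicator (ball c r) z * log_sum (add_mset x A) z = indicator (ball c r) z * ln (cmod (z - x)) + indicator (ball c r) z * log_sum A z" for z
    by (simp add: log_sum_def distrib_left)
  { case 1 show ?case unfolding e by (intro Bochner_Integration.integrable_add i add.IH) }
  { case 2
    then have "x \<noteq> c" "c \<notin># A" by auto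
    have "measure lborel (ball c r) * log_sum (add_mset x A) c = measure lborel (ball c r) * ln (cmod (c - x)) + measure lborel (ball c r) * log_sum A c"
      by (simp add: log_sum_def distrib_left)
    also have "\<dots> \<le> (LINT z|lborel. indicator (ball c r) z * ln (cmod (z - x))) + (LINT z|lborel. indicator (ball c r) z * log_sum A z)"
      by (intro add_mono ball_mean_log_ge add.IH(2)) (use \<open>x \<noteq> c\<close> \<open>c \<notin># A\<close> in auto)
    also have "\<dots> = (LINT z|lborel. indicator (ball c r) z * log_sum (add_mset x A) z)"
      unfolding e by (rule Bochner_Integration.integral_add[OF i add.IH(1), symmetric])
    finally show ?case . }
qed

lemma AE_lborel_notin_mset: "AE z in lborel. z \<notin># (A :: complex multiset)"
proof -
  have "set_mset A \<in> null_sets lborel" by (rule finite_imp_null_set_lborel) auto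
  then show ?thesis by (rule AE_I') auto
qed

text \<open>
  A nonempty open set has positive measure.
\<close>

lemma AE_lborel_open_imp_all:
  fixes f :: "complex \<Rightarrow> real"
  assumes "AE z in lborel. z \<in> A \<longrightarrow> f z = m" "open A" "continuous_on A f" "z \<in> A"
  shows "f z = m"
proof (rule ccontr)
  assume ne: "f z \<noteq> m"
  have "open (A \<inter> f -` (- {m}))" using assms(2,3) by (intro continuous_open_preimage) auto
  moreover have "z \<in> A \<inter> f -` (- {m})" using ne assms(4) by auto
  ultimately obtain r where r: "r > 0" "ball z r \<subseteq> A \<inter> f -` (- {m})" unfolding open_contains_ball by blast
  have "AE x in lborel. x \<notin> ball z r" using assms(1) by eventually_elim (use r in auto)
  then have "ball z r \<in> null_sets lborel" by (subst AE_iff_null_sets) auto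
  then have "measure lborel (ball z r) = 0" by (simp add: measure_def null_sets_def)
  then show False using r(1) by (simp add: measure_ball_complex)
qed

lemma poly_growth:
  fixes p :: "complex poly"
  obtains C where "C > 0" "\<And>z. cmod z \<ge> 1 \<Longrightarrow> cmod (poly p z) \<le> C * cmod z ^ degree p"
proof
  let ?C = "(\<Sum>i\<le>degree p. cmod (coeff p i)) + 1"
  show "?C > 0" using sum_nonneg[of "{..degree p}" "\<lambda>i. cmod (coeff p i)"] by auto
  fix z :: complex assume z: "cmod z \<ge> 1"
  have "cmod (poly p z) \<le> (\<Sum>i\<le>degree p. cmod (coeff p i * z ^ i))" unfolding poly_altdef by (rule norm_sum)
  also have "\<dots> \<le> (\<Sum>i\<le>degree p. cmod (coeff p i) * cmod z ^ degree p)"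
    by (intro sum_mono) (auto simp: norm_mult norm_power intro!: mult_left_mono power_increasing z)
  also have "\<dots> \<le> ?C * cmod z ^ degree p" by (simp add: sum_distrib_right[symmetric] distrib_right)
  finally show "cmod (poly p z) \<le> ?C * cmod z ^ degree p" .
qed

text \<open>
  Up to constants, the weighted polynomial grows like the power \<open>degree p - s\<close> of \<open>\<bar>z\<bar>\<close>.
\<close>

lemma weighted_poly_tendsto_0:
  fixes p :: "complex poly"
  assumes \<mu>: "prob_on S \<mu>" "compact S" and s: "s > real (degree p)" and B: "B > 0"
  obtains R where "\<And>z. cmod z \<ge> R \<Longrightarrow> cmod (poly p z) * exp (- s * log_pot \<mu> z) < B"
proof -
  obtain C where C: "C > 0" "\<And>z. cmod z \<ge> 1 \<Longrightarrow> cmod (poly p z) \<le> C * cmod z ^ degree p"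
  proof (rule poly_growth[of p])
    fix C assume "C > 0" "\<And>z. cmod z \<ge> 1 \<Longrightarrow> cmod (poly p z) \<le> C * cmod z ^ degree p"
    then show thesis by (rule that)
  qed
  obtain \<rho>0 where \<rho>0: "S \<subseteq> cball 0 \<rho>0" using compact_imp_bounded[OF \<mu>(2)] by (auto simp: bounded_iff subset_eq)
  define \<rho> where "\<rho> = max \<rho>0 1"
  have \<rho>: "S \<subseteq> cball 0 \<rho>" "\<rho> \<ge> 1" using \<rho>0 by (auto simp: \<rho>_def)
  have "((\<lambda>x. C * 2 powr s * x powr (real (degree p) - s)) \<longlongrightarrow> C * 2 powr s * 0) at_top"
    by (intro tendsto_mult tendsto_const tendsto_neg_powr filterlim_ident) (use s in auto)
  then have "\<forall>\<^sub>F x in at_top. C * 2 powr s * x powr (real (degree p) - s) < B"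
    using B by (intro order_tendstoD(2)) auto
  then obtain R0 where R0: "\<And>x. x \<ge> R0 \<Longrightarrow> C * 2 powr s * x powr (real (degree p) - s) < B"
    by (auto simp: eventually_at_top_linorder)
  show thesis
  proof
    fix z assume z: "cmod z \<ge> max R0 (2 * \<rho> + 1)"
    define x where "x = cmod z"
    have x: "x \<ge> R0" "x \<ge> 2 * \<rho> + 1" "x \<ge> 1" using z \<rho> by (auto simp: x_def)
    have "ln (x / 2) \<le> ln (x - \<rho>)" using x \<rho> by (intro ln_mono) auto
    also have "\<dots> \<le> log_pot \<mu> z" unfolding x_def by (rule log_pot_ge[OF \<mu> \<rho>(1)]) (use x \<rho> in \<open>simp add: x_def\<close>)
    finally have "exp (- s * log_pot \<mu> z) \<le> exp (- s * ln (x / 2))" using s by (simp add: mult_left_mono)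
    also have "\<dots> = (x / 2) powr (- s)" using x by (simp add: powr_def)
    also have "\<dots> = 2 powr s * x powr (- s)" using x by (simp add: powr_divide powr_minus field_simps)
    finally have 1: "exp (- s * log_pot \<mu> z) \<le> 2 powr s * x powr (- s)" .
    have "cmod (poly p z) * exp (- s * log_pot \<mu> z) \<le> (C * x ^ degree p) * (2 powr s * x powr (- s))"
      using C x 1 by (intro mult_mono) (auto simp: x_def)
    also have "x ^ degree p = x powr real (degree p)" using x by (simp add: powr_realpow)
    also have "C * x powr real (degree p) * (2 powr s * x powr - s) = C * 2 powr s * x powr (real (degree p) - s)"
      by (simp add: powr_diff powr_minus divide_inverse mult_ac)
    also have "\<dots> < B" by (rule R0[OF x(1)])
    finally show "cmod (poly p z) * exp (- s * log_pot \<mu> z) < B" .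
  qed
qed

text \<open>
  The logarithm of the weighted polynomial is subharmonic on \<open>W\<close>, because the potential is harmonic
  off the support.  The weight \<open>s > degree p\<close> makes the function vanish at infinity, so that a
  value above the boundary bound would give a maximum inside \<open>W\<close>.  The set where the maximum is
  attained is then compact, and open by the mean value inequality, which is impossible in the
  plane.
\<close>

lemma weighted_poly_maximum_principle:
  fixes p :: "complex poly"
  assumes \<mu>: "prob_on S \<mu>" "compact S" and s: "s > real (degree p)" and p: "lead_coeff p = 1"
    and W: "open W" "W \<inter> S = {}"
    and bd: "\<And>z0 B'. z0 \<in> frontier W \<Longrightarrow> B' > B \<Longrightarrow> \<exists>r>0. \<forall>z\<in>W. dist z z0 < r \<longrightarrow> cmod (poly p z) * exp (- s * log_pot \<mu> z) < B'"
    and B: "B \<ge> 0" and z: "z \<in> W"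
  shows "cmod (poly p z) * exp (- s * log_pot \<mu> z) \<le> B"
proof (rule ccontr)
  define F where "F = (\<lambda>z. cmod (poly p z) * exp (- s * log_pot \<mu> z))"
  assume "\<not> ?thesis"
  then have Fz: "F z > B" by (simp add: F_def)
  have WS: "W \<subseteq> - S" using W by auto
  have Fc: "continuous_on W F" unfolding F_def
    by (intro continuous_intros continuous_on_subset[OF continuous_log_pot[OF \<mu>] WS])
  \<comment> \<open>\<open>F\<close> is smaller than \<open>F z\<close> far out and near the frontier of \<open>W\<close>, so that this superlevel set is compact.\<close>
  define C where "C = {x \<in> W. F x \<ge> F z}"
  obtain R where R: "\<And>x. cmod x \<ge> R \<Longrightarrow> F x < F z"
  proof (rule weighted_poly_tendsto_0[OF \<mu> s, of "F z"])
    show "F z > 0" using Fz B by linarith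
  qed (use that in \<open>auto simp: F_def\<close>)
  have "C \<subseteq> ball 0 R"
  proof
    fix x assume "x \<in> C"
    then have "\<not> F x < F z" by (auto simp: C_def)
    then have "\<not> cmod x \<ge> R" using R[of x] by blast
    then show "x \<in> ball 0 R" by simp
  qed
  then have "bounded C" using bounded_subset bounded_ball by blast
  moreover have "closed C"
    unfolding closed_limpt
  proof (intro allI impI)
    fix x assume x: "x islimpt C"
    show "x \<in> C"
    proof (cases "x \<in> W")
      case True
      have "(F \<longlongrightarrow> F x) (at x within W)" using Fc True by (auto simp: continuous_on_def)
      then have t: "(F \<longlongrightarrow> F x) (at x within C)" by (rule tendsto_within_subset) (auto simp: C_def)
      have "F z \<le> F x"
      proof (rule tendsto_lowerbound[OF t])
        show "\<forall>\<^sub>F x in at x within C. F z \<le> F x" by (auto simp: eventually_at_filter C_def)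
        show "at x within C \<noteq> bot" using x by (simp add: trivial_limit_within)
      qed
      then show ?thesis using True by (simp add: C_def)
    next
      case False
      have "x islimpt W" using x islimpt_subset[of x C W] by (auto simp: C_def)
      then have "x \<in> frontier W" using False W(1) by (simp add: frontier_def closure_def interior_open)
      from bd[OF this Fz] obtain r where r: "r > 0" "\<forall>y\<in>W. dist y x < r \<longrightarrow> F y < F z" unfolding F_def by blast
      obtain y where "y \<in> C" "dist y x < r" using x r(1) unfolding islimpt_approachable by blast
      then show ?thesis using r(2) by (auto simp: C_def)
    qed
  qed
  ultimately have cC: "compact C" using compact_eq_bounded_closed by blast
  have "z \<in> C" using z by (simp add: C_def)
  then obtain x0 where x0: "x0 \<in> C" "\<And>x. x \<in> C \<Longrightarrow> F x \<le> F x0"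
    using continuous_attains_sup[OF cC, of F] continuous_on_subset[OF Fc, of C] by (auto simp: C_def)
  define m where "m = F x0"
  have Fm: "F x \<le> m" if "x \<in> W" for x
    using x0(2)[of x] x0(2)[OF \<open>z \<in> C\<close>] that by (cases "F x \<ge> F z") (auto simp: C_def m_def)
  have mz: "F z \<le> m" using Fm z by auto
  have m0: "m > 0" using mz Fz B by linarith
  define Z where "Z = {x \<in> C. F x = m}"
  have ZW: "Z \<subseteq> W" by (auto simp: Z_def C_def)
  have ZF: "Z = {x \<in> W. F x = m}" using mz by (auto simp: Z_def C_def)
  have "closed Z" unfolding Z_def
  proof (rule continuous_closed_preimage_constant[OF continuous_on_subset[OF Fc] compact_imp_closed[OF cC]])
    show "C \<subseteq> W" by (auto simp: C_def)
  qed
  moreover have "open Z"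
    unfolding open_contains_ball
  proof
    fix c assume c: "c \<in> Z"
    then have cW: "c \<in> W" and Fc': "F c = m" using ZF by auto
    obtain r where r: "r > 0" "ball c r \<subseteq> W" using W(1) cW by (meson open_contains_ball)
    have disj: "ball c r \<inter> S = {}" using r W by auto
    have pc: "poly p c \<noteq> 0" using Fc' m0 by (auto simp: F_def)
    have "p \<noteq> 0" using p by auto
    have pnz: "poly p x \<noteq> 0" if "x \<notin># proots p" for x using that \<open>p \<noteq> 0\<close> by simp
    have cn: "c \<notin># proots p" using pc \<open>p \<noteq> 0\<close> by simp
    have lnF: "ln (F x) = log_sum (proots p) x - s * log_pot \<mu> x" if "x \<notin># proots p" for x
      using pnz[OF that] by (simp add: F_def ln_mult ln_cmod_poly[OF p])
    let ?b = "indicator (ball c r) :: complex \<Rightarrow> real"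
    let ?V = "measure lborel (ball c r)"
    \<comment> \<open>On the disc \<open>g\<close> is \<open>ln m - ln F\<close>, apart from the zeros of \<open>p\<close>: nonnegative, with integral at most 0.\<close>
    define g where "g = (\<lambda>x. ?b x * ln m - ?b x * log_sum (proots p) x + s * (?b x * log_pot \<mu> x))"
    have i0: "integrable lborel (\<lambda>x. ?b x * ln m)"
      using emeasure_lborel_ball_finite[of c r] by (intro integrable_mult_left integrable_real_indicator) auto
    note i1 = log_sum_ball_mean(1)[of c r "proots p"]
    note i2 = log_pot_ball_mean(1)[OF \<mu> r(1) disj]
    have gi: "integrable lborel g" unfolding g_def
      by (intro Bochner_Integration.integrable_add Bochner_Integration.integrable_diff integrable_mult_right i0 i1 i2)
    have "(LINT x|lborel. g x) = (LINT x|lborel. ?b x * ln m) - (LINT x|lborel. ?b x * log_sum (proots p) x) + s * (LINT x|lborel. ?b x * log_pot \<mu> x)"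
      unfolding g_def using i0 i1 i2 by simp
    also have "\<dots> \<le> ?V * ln m - ?V * log_sum (proots p) c + s * (?V * log_pot \<mu> c)"
      using log_sum_ball_mean(2)[OF cn, of r] log_pot_ball_mean(2)[OF \<mu> r(1) disj] by simp
    also have "\<dots> = ?V * (ln m - ln (F c))" unfolding lnF[OF cn] by (simp add: algebra_simps)
    also have "\<dots> = 0" using Fc' by simp
    finally have gle: "(LINT x|lborel. g x) \<le> 0" .
    have geq: "g x = ?b x * (ln m - ln (F x))" if "x \<notin># proots p" for x
      unfolding lnF[OF that] by (simp add: g_def algebra_simps)
    have Fpos: "F x > 0" if "x \<notin># proots p" for x using pnz[OF that] by (simp add: F_def)
    have gnn: "AE x in lborel. 0 \<le> g x"
      using AE_lborel_notin_mset[of "proots p"]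
    proof eventually_elim
      case (elim x)
      show ?case
      proof (cases "x \<in> ball c r")
        case True
        then have "ln (F x) \<le> ln m" using Fm[of x] r(2) Fpos[OF elim] by (intro ln_mono) auto
        then show ?thesis using geq[OF elim] by simp
      qed (simp add: geq[OF elim])
    qed
    have "(LINT x|lborel. g x) = 0" using gle integral_nonneg_AE[OF gnn] by linarith
    then have g0: "AE x in lborel. g x = 0" using integral_nonneg_eq_0_iff_AE[OF gi gnn] by simp
    have "AE x in lborel. x \<in> ball c r \<longrightarrow> F x = m"
      using g0 AE_lborel_notin_mset[of "proots p"]
    proof eventually_elim
      case (elim x)
      show ?case
      proof
        assume x: "x \<in> ball c r"
        then have "ln (F x) = ln m" using elim geq[OF elim(2)] by simp
        then show "F x = m" using ln_inj_iff[OF Fpos[OF elim(2)] m0] by simp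
      qed
    qed
    then have "F x = m" if "x \<in> ball c r" for x
      using AE_lborel_open_imp_all[of "ball c r" F m x] that continuous_on_subset[OF Fc r(2)] by auto
    then have "ball c r \<subseteq> Z" using r(2) ZF by auto
    then show "\<exists>e>0. ball c e \<subseteq> Z" using r(1) by blast
  qed
  moreover have "x0 \<in> Z" using x0 by (simp add: Z_def m_def)
  ultimately have "Z = UNIV" using connected_clopen[of "UNIV :: complex set"] by (auto simp: connected_UNIV)
  moreover have "Z \<subseteq> C" by (auto simp: Z_def)
  ultimately have "bounded (UNIV :: complex set)" using bounded_subset[OF compact_imp_bounded[OF cC], of Z] by (simp only:)
  then show False using not_bounded_UNIV by blast
qed

section \<open>Energy minimizers and Frostman's theorem\<close>

definition mix_measure :: "real \<Rightarrow> complex measure \<Rightarrow> complex measure \<Rightarrow> complex measure" where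
  "mix_measure t \<mu> \<sigma> = measure_pmf (bernoulli_pmf t) \<bind> (\<lambda>b. if b then \<sigma> else \<mu>)"

lemma mix_kernel_measurable:
  assumes "prob_on K \<mu>" "prob_on K \<sigma>"
  shows "(\<lambda>b. if b then \<sigma> else \<mu>) \<in> measurable (measure_pmf p) (subprob_algebra borel)"
proof -
  have "\<mu> \<in> space (subprob_algebra borel)" "\<sigma> \<in> space (subprob_algebra borel)"
    using assms by (simp_all add: space_subprob_algebra prob_on_def prob_space_imp_subprob_space)
  then have "(\<lambda>b. if b then \<sigma> else \<mu>) \<in> UNIV \<rightarrow> space (subprob_algebra borel)" by simp
  then show ?thesis by (simp only: measurable_pmf_measure1)
qed

lemma nn_integral_mix:
  assumes "prob_on K \<mu>" "prob_on K \<sigma>" "0 \<le> t" "t \<le> 1" "f \<in> borel_measurable borel"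
  shows "(\<integral>\<^sup>+z. f z \<partial>mix_measure t \<mu> \<sigma>) = ennreal (1 - t) * (\<integral>\<^sup>+z. f z \<partial>\<mu>) + ennreal t * (\<integral>\<^sup>+z. f z \<partial>\<sigma>)"
  unfolding mix_measure_def
  by (subst nn_integral_bind[OF assms(5) mix_kernel_measurable[OF assms(1,2)]])
    (use assms in \<open>simp add: mult.commute add.commute\<close>)

lemma prob_on_mix:
  assumes "prob_on K \<mu>" "prob_on K \<sigma>" "0 \<le> t" "t \<le> 1" "K \<in> sets borel"
  shows "prob_on K (mix_measure t \<mu> \<sigma>)"
proof -
  have s: "sets (mix_measure t \<mu> \<sigma>) = sets borel" unfolding mix_measure_def
    by (rule sets_bind[of _ _ borel]) (use assms in \<open>auto simp: prob_on_def\<close>)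
  have em: "emeasure (mix_measure t \<mu> \<sigma>) A = ennreal (1 - t) * emeasure \<mu> A + ennreal t * emeasure \<sigma> A" if "A \<in> sets borel" for A
  proof -
    have "emeasure (mix_measure t \<mu> \<sigma>) A = (\<integral>\<^sup>+z. indicator A z \<partial>mix_measure t \<mu> \<sigma>)" using that s by simp
    also have "\<dots> = ennreal (1 - t) * (\<integral>\<^sup>+z. indicator A z \<partial>\<mu>) + ennreal t * (\<integral>\<^sup>+z. indicator A z \<partial>\<sigma>)"
      by (rule nn_integral_mix[OF assms(1-4)]) (use that in simp)
    also have "\<dots> = ennreal (1 - t) * emeasure \<mu> A + ennreal t * emeasure \<sigma> A"
      using that assms by (simp add: prob_on_def)
    finally show ?thesis .
  qed
  have sp: "space \<nu> = UNIV" if "sets \<nu> = sets borel" for \<nu> :: "complex measure" using sets_eq_imp_space_eq[OF that] by simp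
  have "emeasure \<mu> UNIV = 1" "emeasure \<sigma> UNIV = 1"
    using assms prob_space.emeasure_space_1[of \<mu>] prob_space.emeasure_space_1[of \<sigma>] sp[of \<mu>] sp[of \<sigma>] by (auto simp: prob_on_def)
  then have "emeasure (mix_measure t \<mu> \<sigma>) (space (mix_measure t \<mu> \<sigma>)) = 1"
    using em[of UNIV] sp[OF s] assms by (simp add: ennreal_plus[symmetric] del: ennreal_plus)
  then have "prob_space (mix_measure t \<mu> \<sigma>)" by (rule prob_spaceI)
  moreover have "emeasure (mix_measure t \<mu> \<sigma>) (- K) = 0" using em[of "- K"] assms by (simp add: prob_on_def)
  ultimately show ?thesis using s by (simp add: prob_on_def)
qed

lemma mutual_energy_commute:
  assumes "prob_on K \<mu>" "prob_on K \<sigma>"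
  shows "mutual_energy D \<mu> \<sigma> = mutual_energy D \<sigma> \<mu>"
proof -
  interpret M: prob_space \<mu> using assms by (simp add: prob_on_def)
  interpret S: prob_space \<sigma> using assms by (simp add: prob_on_def)
  interpret P: pair_sigma_finite \<mu> \<sigma> ..
  have [measurable_cong]: "sets \<mu> = sets borel" "sets \<sigma> = sets borel" using assms by (auto simp: prob_on_def)
  have "(\<integral>\<^sup>+z. \<integral>\<^sup>+w. shifted_kernel D z w \<partial>\<sigma> \<partial>\<mu>) = (\<integral>\<^sup>+w. \<integral>\<^sup>+z. shifted_kernel D z w \<partial>\<mu> \<partial>\<sigma>)"
    by (rule P.Fubini'[symmetric]) measurable
  then show ?thesis unfolding mutual_energy_def by (simp add: shifted_kernel_commute)
qed

lemma mutual_energy_mix: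
  assumes "prob_on K \<mu>" "prob_on K \<sigma>" "0 \<le> t" "t \<le> 1"
  shows "mutual_energy D (mix_measure t \<mu> \<sigma>) (mix_measure t \<mu> \<sigma>) =
    ennreal (1 - t) * (ennreal (1 - t) * mutual_energy D \<mu> \<mu> + ennreal t * mutual_energy D \<mu> \<sigma>) +
    ennreal t * (ennreal (1 - t) * mutual_energy D \<sigma> \<mu> + ennreal t * mutual_energy D \<sigma> \<sigma>)"
proof -
  interpret M: prob_space \<mu> using assms by (simp add: prob_on_def)
  interpret S: prob_space \<sigma> using assms by (simp add: prob_on_def)
  have [measurable_cong]: "sets \<mu> = sets borel" "sets \<sigma> = sets borel" using assms by (auto simp: prob_on_def)
  let ?U = "\<lambda>\<nu> z. \<integral>\<^sup>+w. shifted_kernel D z w \<partial>\<nu>"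
  have inner: "(\<integral>\<^sup>+w. shifted_kernel D z w \<partial>mix_measure t \<mu> \<sigma>) = ennreal (1 - t) * ?U \<mu> z + ennreal t * ?U \<sigma> z" for z
    by (rule nn_integral_mix[OF assms]) measurable
  have m[measurable]: "?U \<mu> \<in> borel_measurable borel" "?U \<sigma> \<in> borel_measurable borel"
    by measurable
  have lin: "(\<integral>\<^sup>+z. ennreal (1 - t) * ?U \<mu> z + ennreal t * ?U \<sigma> z \<partial>\<nu>) = ennreal (1 - t) * mutual_energy D \<nu> \<mu> + ennreal t * mutual_energy D \<nu> \<sigma>"
    if [measurable_cong]: "sets \<nu> = sets borel" for \<nu>
    unfolding mutual_energy_def by (simp add: nn_integral_add nn_integral_cmult)
  have "mutual_energy D (mix_measure t \<mu> \<sigma>) (mix_measure t \<mu> \<sigma>) = (\<integral>\<^sup>+z. ennreal (1 - t) * ?U \<mu> z + ennreal t * ?U \<sigma> z \<partial>mix_measure t \<mu> \<sigma>)"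
    unfolding mutual_energy_def inner ..
  also have "\<dots> = ennreal (1 - t) * (\<integral>\<^sup>+z. ennreal (1 - t) * ?U \<mu> z + ennreal t * ?U \<sigma> z \<partial>\<mu>) + ennreal t * (\<integral>\<^sup>+z. ennreal (1 - t) * ?U \<mu> z + ennreal t * ?U \<sigma> z \<partial>\<sigma>)"
    by (rule nn_integral_mix[OF assms]) measurable
  finally show ?thesis using lin[of \<mu>] lin[of \<sigma>] assms by (simp add: prob_on_def)
qed

text \<open>
  The difference of the two sides is \<open>2 t (m - a)\<close> up to terms of order \<open>t\<^sup>2\<close>.
\<close>

lemma convex_quadratic_slope:
  fixes a m s :: real
  assumes "\<And>t. 0 < t \<Longrightarrow> t < 1 \<Longrightarrow> a \<le> (1 - t) * ((1 - t) * a + t * m) + t * ((1 - t) * m + t * s)"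
  shows "a \<le> m"
proof (rule ccontr)
  assume "\<not> a \<le> m"
  then have d: "a - m > 0" by simp
  define c where "c = \<bar>a - 2 * m + s\<bar> + 1"
  define t where "t = min (1/2) ((a - m) / c)"
  have c: "c > 0" by (simp add: c_def)
  have t: "0 < t" "t < 1" "t * c \<le> a - m" using d c by (auto simp: t_def min_def field_simps)
  have "0 \<le> t * (2 * (m - a) + t * (a - 2 * m + s))" using assms[OF t(1,2)] by (simp add: algebra_simps)
  then have "0 \<le> 2 * (m - a) + t * (a - 2 * m + s)" using t(1) by (simp add: zero_le_mult_iff)
  moreover have "t * (a - 2 * m + s) \<le> t * c" using t(1) by (intro mult_left_mono) (auto simp: c_def)
  moreover have "0 \<le> 2 * (m - a) + x \<Longrightarrow> x \<le> y \<Longrightarrow> y \<le> a - m \<Longrightarrow> 0 < a - m \<Longrightarrow> False" for x y :: real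
    by argo
  ultimately show False using t(3) d by blast
qed

text \<open>
  The disc of radius \<open>D / 4\<close> leaves room: points within distance \<open>D / 4\<close> of \<open>E\<close> still have distance at
  most \<open>D\<close> from all points of \<open>E\<close>, so that the kernel is nonnegative near \<open>E\<close> as well.
\<close>

locale energy_minimizer =
  fixes E :: "complex set" and D :: real and \<mu> :: "complex measure"
  assumes compact_E: "compact E" and E_ball: "E \<subseteq> cball 0 (D/4)" and D_pos: "D > 0"
    and \<mu>_E: "prob_on E \<mu>" and energy_finite: "mutual_energy D \<mu> \<mu> < \<infinity>"
    and minimal: "\<And>\<sigma>. prob_on E \<sigma> \<Longrightarrow> mutual_energy D \<mu> \<mu> \<le> mutual_energy D \<sigma> \<sigma>"
begin

definition a :: real where "a = enn2real (mutual_energy D \<mu> \<mu>)"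
definition U :: "complex \<Rightarrow> ennreal" where "U z = (\<integral>\<^sup>+w. shifted_kernel D z w \<partial>\<mu>)"

lemma energy_eq_a: "mutual_energy D \<mu> \<mu> = ennreal a"
  using energy_finite by (simp add: a_def)

lemma a_nonneg: "a \<ge> 0" by (simp add: a_def)

lemma sets_\<mu> [measurable_cong]: "sets \<mu> = sets borel" using \<mu>_E by (simp add: prob_on_def)

lemma E_borel [measurable]: "E \<in> sets borel" by (rule borel_compact[OF compact_E])

lemma measurable_U [measurable]: "U \<in> borel_measurable borel"
proof -
  interpret M: prob_space \<mu> using \<mu>_E by (simp add: prob_on_def)
  show ?thesis unfolding U_def[abs_def] by measurable
qed

text \<open>
  Differentiate the energy of \<open>(1 - t) \<mu> + t \<sigma>\<close> at \<open>t = 0\<close>.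
\<close>

lemma energy_variation:
  assumes \<sigma>: "prob_on E \<sigma>" and fin: "mutual_energy D \<sigma> \<sigma> < \<infinity>"
  shows "ennreal a \<le> (\<integral>\<^sup>+z. U z \<partial>\<sigma>)"
proof (cases "mutual_energy D \<sigma> \<mu> = \<infinity>")
  case True
  then show ?thesis by (simp add: mutual_energy_def U_def)
next
  case False
  define m where "m = enn2real (mutual_energy D \<sigma> \<mu>)"
  define s where "s = enn2real (mutual_energy D \<sigma> \<sigma>)"
  have m: "mutual_energy D \<sigma> \<mu> = ennreal m" "m \<ge> 0" using False by (auto simp: m_def less_top)
  have s: "mutual_energy D \<sigma> \<sigma> = ennreal s" "s \<ge> 0" using fin by (auto simp: s_def)
  have "a \<le> m"
  proof (rule convex_quadratic_slope)
    fix t :: real assume t: "0 < t" "t < 1"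
    have "ennreal a \<le> mutual_energy D (mix_measure t \<mu> \<sigma>) (mix_measure t \<mu> \<sigma>)"
      unfolding energy_eq_a[symmetric] by (rule minimal, rule prob_on_mix[OF \<mu>_E \<sigma>]) (use t in auto)
    also have "\<dots> = ennreal (1 - t) * (ennreal (1 - t) * ennreal a + ennreal t * ennreal m) + ennreal t * (ennreal (1 - t) * ennreal m + ennreal t * ennreal s)"
      using t by (subst mutual_energy_mix[OF \<mu>_E \<sigma>]) (auto simp: energy_eq_a m s mutual_energy_commute[OF \<mu>_E \<sigma>])
    also have "\<dots> = ennreal ((1 - t) * ((1 - t) * a + t * m) + t * ((1 - t) * m + t * s))"
      using t a_nonneg m s by (simp add: ennreal_mult ennreal_plus)
    finally show "a \<le> (1 - t) * ((1 - t) * a + t * m) + t * ((1 - t) * m + t * s)"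
      using t a_nonneg m s by (subst (asm) ennreal_le_iff) auto
  qed
  then have "ennreal a \<le> mutual_energy D \<sigma> \<mu>" unfolding m by (rule ennreal_leI)
  then show ?thesis by (simp add: mutual_energy_def U_def)
qed

text \<open>
  If \<open>U\<close> were at most \<open>c < a\<close> on a set of positive \<open>\<sigma>\<close>-measure, then \<open>\<sigma>\<close> conditioned on this set would
  contradict the variational inequality.
\<close>

lemma U_ge_AE:
  assumes \<sigma>: "prob_on E \<sigma>" and fin: "mutual_energy D \<sigma> \<sigma> < \<infinity>"
  shows "AE z in \<sigma>. ennreal a \<le> U z"
proof -
  have s\<sigma>[measurable_cong]: "sets \<sigma> = sets borel" using \<sigma> by (simp add: prob_on_def)
  interpret S: prob_space \<sigma> using \<sigma> by (simp add: prob_on_def)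
  have null: "{z. U z \<le> ennreal c} \<in> null_sets \<sigma>" if c: "c < a" "c \<ge> 0" for c
  proof (rule ccontr)
    define S where "S = {z. U z \<le> ennreal c}"
    have Sb[measurable]: "S \<in> sets borel" unfolding S_def by measurable
    assume "\<not> ?thesis"
    then have pos: "emeasure \<sigma> S \<noteq> 0" using Sb s\<sigma> by (auto simp: null_sets_def S_def)
    have finS: "emeasure \<sigma> S < \<infinity>" using S.emeasure_finite[of S] by (simp add: less_top[symmetric])
    define \<tau> where "\<tau> = uniform_measure \<sigma> S"
    have st[measurable_cong]: "sets \<tau> = sets borel" by (simp add: \<tau>_def s\<sigma>)
    have pt: "prob_space \<tau>" unfolding \<tau>_def by (rule prob_space_uniform_measure) (use pos finS in auto)
    have nnt: "(\<integral>\<^sup>+z. f z \<partial>\<tau>) = (\<integral>\<^sup>+z. f z * indicator S z \<partial>\<sigma>) / emeasure \<sigma> S" if [measurable]: "f \<in> borel_measurable borel" for f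
      unfolding \<tau>_def by (rule nn_integral_uniform_measure) (use that s\<sigma> in auto)
    have "emeasure \<tau> (- E) = emeasure \<sigma> (S \<inter> - E) / emeasure \<sigma> S"
      unfolding \<tau>_def by (rule emeasure_uniform_measure) (auto simp: s\<sigma>)
    also have "emeasure \<sigma> (S \<inter> - E) \<le> emeasure \<sigma> (- E)" by (rule emeasure_mono) (auto simp: s\<sigma>)
    then have "emeasure \<sigma> (S \<inter> - E) = 0" using \<sigma> by (simp add: prob_on_def)
    finally have pE: "prob_on E \<tau>" using st pt by (simp add: prob_on_def)
    interpret T: prob_space \<tau> by (rule pt)
    have le: "(\<integral>\<^sup>+z. f z \<partial>\<tau>) \<le> (\<integral>\<^sup>+z. f z \<partial>\<sigma>) / emeasure \<sigma> S" if [measurable]: "f \<in> borel_measurable borel" for f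
      unfolding nnt[OF that] by (intro divide_right_mono_ennreal nn_integral_mono) (auto simp: indicator_def)
    have "mutual_energy D \<tau> \<tau> \<le> (\<integral>\<^sup>+z. \<integral>\<^sup>+w. shifted_kernel D z w \<partial>\<tau> \<partial>\<sigma>) / emeasure \<sigma> S"
      unfolding mutual_energy_def by (rule le) measurable
    also have "\<dots> \<le> (\<integral>\<^sup>+z. (\<integral>\<^sup>+w. shifted_kernel D z w \<partial>\<sigma>) / emeasure \<sigma> S \<partial>\<sigma>) / emeasure \<sigma> S"
      by (intro divide_right_mono_ennreal nn_integral_mono le) measurable
    also have "\<dots> = mutual_energy D \<sigma> \<sigma> / emeasure \<sigma> S / emeasure \<sigma> S"
      unfolding mutual_energy_def by (subst nn_integral_divide) auto
    also have "\<dots> < \<infinity>" using fin pos by (simp add: ennreal_divide_eq_top_iff less_top[symmetric])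
    finally have "ennreal a \<le> (\<integral>\<^sup>+z. U z \<partial>\<tau>)" by (rule energy_variation[OF pE])
    also have "\<dots> \<le> (\<integral>\<^sup>+z. ennreal c * indicator S z \<partial>\<sigma>) / emeasure \<sigma> S"
      unfolding nnt[OF measurable_U] by (intro divide_right_mono_ennreal nn_integral_mono) (auto simp: indicator_def S_def)
    also have "(\<integral>\<^sup>+z. ennreal c * indicator S z \<partial>\<sigma>) = ennreal c * emeasure \<sigma> S"
      by (rule nn_integral_cmult_indicator) (simp add: s\<sigma>)
    also have "ennreal c * emeasure \<sigma> S / emeasure \<sigma> S = ennreal c"
      using pos finS by (simp add: ennreal_mult_divide_eq)
    finally show False using c by (simp add: ennreal_le_iff2)
  qed
  have "AE z in \<sigma>. \<forall>k::nat. a - 1 / (real k + 1) \<ge> 0 \<longrightarrow> \<not> U z \<le> ennreal (a - 1 / (real k + 1))"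
    unfolding AE_all_countable
  proof
    fix k :: nat
    show "AE z in \<sigma>. a - 1 / (real k + 1) \<ge> 0 \<longrightarrow> \<not> U z \<le> ennreal (a - 1 / (real k + 1))"
    proof (cases "a - 1 / (real k + 1) \<ge> 0")
      case True
      from null[OF _ True] have "{z. U z \<le> ennreal (a - 1 / (real k + 1))} \<in> null_sets \<sigma>" by simp
      then have "AE z in \<sigma>. z \<notin> {z. U z \<le> ennreal (a - 1 / (real k + 1))}" by (rule AE_not_in)
      then show ?thesis by eventually_elim auto
    qed simp
  qed
  then show ?thesis
  proof eventually_elim
    case (elim z)
    show ?case
    proof (rule ccontr)
      assume "\<not> ennreal a \<le> U z"
      then have lt: "U z < ennreal a" by simp
      then obtain u where u: "U z = ennreal u" "u \<ge> 0" by (cases "U z") auto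
      then have "u < a" using lt by (simp add: ennreal_less_iff)
      then obtain k :: nat where k: "1 / (real k + 1) < a - u"
        using reals_Archimedean[of "a - u"] by (auto simp: inverse_eq_divide add.commute)
      then show False using elim[rule_format, of k] u by (auto simp: ennreal_leI)
    qed
  qed
qed

text \<open>
  The \<open>\<mu>\<close>-mean of \<open>U\<close> is \<open>a\<close>, and \<open>U \<ge> a\<close> almost everywhere.
\<close>

lemma U_le_AE_\<mu>: "AE z in \<mu>. U z \<le> ennreal a"
proof -
  have ge: "AE z in \<mu>. ennreal a \<le> U z" by (rule U_ge_AE[OF \<mu>_E energy_finite])
  interpret M: prob_space \<mu> using \<mu>_E by (simp add: prob_on_def)
  have "(\<integral>\<^sup>+z. (U z - ennreal a) \<partial>\<mu>) = (\<integral>\<^sup>+z. U z \<partial>\<mu>) - (\<integral>\<^sup>+z. ennreal a \<partial>\<mu>)"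
    by (rule nn_integral_diff) (use ge in \<open>auto simp: M.emeasure_space_1\<close>)
  also have "(\<integral>\<^sup>+z. U z \<partial>\<mu>) = ennreal a" unfolding U_def energy_eq_a[symmetric] mutual_energy_def ..
  also have "(\<integral>\<^sup>+z. ennreal a \<partial>\<mu>) = ennreal a" by (simp add: M.emeasure_space_1)
  finally have "(\<integral>\<^sup>+z. (U z - ennreal a) \<partial>\<mu>) = 0" by simp
  then have "AE z in \<mu>. U z - ennreal a = 0" by (subst (asm) nn_integral_0_iff_AE) auto
  then show ?thesis by eventually_elim (auto simp: diff_eq_0_iff_ennreal)
qed

lemma support_subset_E: "support \<mu> \<subseteq> E"
  by (rule support_subset[OF \<mu>_E compact_imp_closed[OF compact_E]])

lemma compact_support: "compact (support \<mu>)"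
  using compact_Int_closed[OF compact_E closed_support[OF sets_\<mu>]] support_subset_E by (simp add: Int_absorb1)

text \<open>
  Every neighbourhood of a point of the support contains points where \<open>U \<le> a\<close>, and \<open>U\<close> is lower
  semicontinuous as a supremum of potentials of truncated, continuous kernels.
\<close>

lemma U_le_on_support:
  assumes z: "z \<in> support \<mu>"
  shows "U z \<le> ennreal a"
proof -
  interpret M: prob_space \<mu> using \<mu>_E by (simp add: prob_on_def)
  have tm[measurable]: "(\<lambda>w. trunc_kernel D \<delta> x w) \<in> borel_measurable borel" for \<delta> x
    unfolding trunc_kernel_def by measurable
  have tr: "(\<integral>\<^sup>+w. ennreal (trunc_kernel D \<delta> z w) \<partial>\<mu>) \<le> ennreal a" if \<delta>: "\<delta> > 0" for \<delta>
  proof (rule ennreal_le_epsilon)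
    fix e :: real assume e: "e > 0"
    have "emeasure \<mu> (ball z (e * \<delta>)) > 0" using z e \<delta> by (auto simp: support_def)
    moreover have "\<not> (\<forall>x\<in>ball z (e * \<delta>). \<not> U x \<le> ennreal a)"
    proof
      assume A: "\<forall>x\<in>ball z (e * \<delta>). \<not> U x \<le> ennreal a"
      have "AE x in \<mu>. x \<notin> ball z (e * \<delta>)" using U_le_AE_\<mu> by eventually_elim (use A in auto)
      then have "ball z (e * \<delta>) \<in> null_sets \<mu>" by (subst AE_iff_null_sets) (auto simp: sets_\<mu>)
      with \<open>emeasure \<mu> (ball z (e * \<delta>)) > 0\<close> show False by auto
    qed
    ultimately obtain x where x: "dist z x < e * \<delta>" "U x \<le> ennreal a" by auto
    have d: "dist z x / \<delta> \<le> e" using x \<delta> by (simp add: field_simps)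
    have "(\<integral>\<^sup>+w. ennreal (trunc_kernel D \<delta> z w) \<partial>\<mu>) \<le> (\<integral>\<^sup>+w. shifted_kernel D x w + ennreal e \<partial>\<mu>)"
    proof (rule nn_integral_mono)
      fix w
      have "trunc_kernel D \<delta> z w \<le> trunc_kernel D \<delta> x w + e" using trunc_kernel_lipschitz[OF D_pos \<delta>, of z w x] d by linarith
      then have "ennreal (trunc_kernel D \<delta> z w) \<le> ennreal (trunc_kernel D \<delta> x w + e)" by (rule ennreal_leI)
      also have "\<dots> \<le> ennreal (trunc_kernel D \<delta> x w) + ennreal e"
        by (cases "trunc_kernel D \<delta> x w \<ge> 0") (use e in \<open>auto simp: ennreal_neg intro: ennreal_leI\<close>)
      also have "ennreal (trunc_kernel D \<delta> x w) \<le> shifted_kernel D x w" by (rule trunc_kernel_le_shifted[OF \<delta> D_pos])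
      finally show "ennreal (trunc_kernel D \<delta> z w) \<le> shifted_kernel D x w + ennreal e" by (simp add: add_right_mono)
    qed
    also have "\<dots> = U x + ennreal e" unfolding U_def by (subst nn_integral_add) (auto simp: M.emeasure_space_1)
    also have "\<dots> \<le> ennreal a + ennreal e" using x by (intro add_right_mono)
    finally show "(\<integral>\<^sup>+w. ennreal (trunc_kernel D \<delta> z w) \<partial>\<mu>) \<le> ennreal a + ennreal e" .
  qed
  have inc: "incseq (\<lambda>k w. ennreal (trunc_kernel D (D / (real k + 1)) z w))"
    by (rule incseq_trunc_kernel[OF D_pos])
  have "U z = (\<integral>\<^sup>+w. (SUP k. ennreal (trunc_kernel D (D / (real k + 1)) z w)) \<partial>\<mu>)"
    unfolding U_def shifted_kernel_eq_SUP[OF D_pos] ..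
  also have "\<dots> = (SUP k. \<integral>\<^sup>+w. ennreal (trunc_kernel D (D / (real k + 1)) z w) \<partial>\<mu>)"
    by (rule nn_integral_monotone_convergence_SUP[OF inc]) measurable
  also have "\<dots> \<le> ennreal a" by (rule SUP_least, rule tr) (use D_pos in auto)
  finally show ?thesis .
qed

end

context energy_minimizer
begin

lemma AE_in_support: "AE w in \<mu>. w \<in> support \<mu>"
  by (rule prob_on_AE[OF prob_on_support[OF \<mu>_E] borel_closed[OF closed_support[OF sets_\<mu>]]])

lemma dist_support_le:
  assumes "cmod z \<le> D/2" "w \<in> E" shows "cmod (z - w) \<le> D"
proof -
  have "cmod w \<le> D/4" using assms E_ball by auto
  then show ?thesis using norm_triangle_ineq4[of z w] assms D_pos by linarith
qed

lemma U_eq_log_pot: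
  assumes z: "cmod z \<le> D/2" and ne: "AE w in \<mu>. w \<noteq> z" and int: "integrable \<mu> (\<lambda>w. ln (cmod (z - w)))"
  shows "U z = ennreal (ln D - log_pot \<mu> z)" "log_pot \<mu> z \<le> ln D"
proof -
  interpret M: prob_space \<mu> using \<mu>_E by (simp add: prob_on_def)
  have eq: "AE w in \<mu>. shifted_kernel D z w = ennreal (ln D - ln (cmod (z - w)))"
    using ne by eventually_elim (use D_pos in \<open>auto simp: shifted_kernel_def ln_div\<close>)
  have nn: "AE w in \<mu>. 0 \<le> ln D - ln (cmod (z - w))"
    using ne prob_on_AE[OF \<mu>_E E_borel]
    by eventually_elim (use dist_support_le[OF z] D_pos in auto)
  have "U z = (\<integral>\<^sup>+w. ennreal (ln D - ln (cmod (z - w))) \<partial>\<mu>)" unfolding U_def by (rule nn_integral_cong_AE[OF eq])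
  also have "\<dots> = ennreal (LINT w|\<mu>. ln D - ln (cmod (z - w)))"
    by (rule nn_integral_eq_integral[OF _ nn]) (use int in auto)
  also have i: "(LINT w|\<mu>. ln D - ln (cmod (z - w))) = ln D - log_pot \<mu> z"
    using int by (simp add: log_pot_def M.prob_space)
  finally show "U z = ennreal (ln D - log_pot \<mu> z)" .
  show "log_pot \<mu> z \<le> ln D" using integral_nonneg_AE[OF nn] i by simp
qed

lemma U_finite_imp:
  assumes z: "cmod z \<le> D/2" and fin: "U z < \<infinity>"
  shows "AE w in \<mu>. w \<noteq> z" "integrable \<mu> (\<lambda>w. ln (cmod (z - w)))"
proof -
  interpret M: prob_space \<mu> using \<mu>_E by (simp add: prob_on_def)
  have [measurable]: "shifted_kernel D z \<in> borel_measurable borel" by measurable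
  have "AE w in \<mu>. shifted_kernel D z w \<noteq> \<infinity>"
    by (rule nn_integral_noteq_infinite) (use fin in \<open>auto simp: U_def\<close>)
  then show ne: "AE w in \<mu>. w \<noteq> z" by eventually_elim (auto simp: shifted_kernel_def)
  have nn: "AE w in \<mu>. 0 \<le> ln D - ln (cmod (z - w))"
    using ne prob_on_AE[OF \<mu>_E E_borel]
    by eventually_elim (use dist_support_le[OF z] D_pos in auto)
  have eq: "AE w in \<mu>. shifted_kernel D z w = ennreal (ln D - ln (cmod (z - w)))"
    using ne by eventually_elim (use D_pos in \<open>auto simp: shifted_kernel_def ln_div\<close>)
  have "(\<integral>\<^sup>+w. ennreal (ln D - ln (cmod (z - w))) \<partial>\<mu>) = U z" unfolding U_def by (rule nn_integral_cong_AE[symmetric, OF eq])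
  then have "integrable \<mu> (\<lambda>w. ln D - ln (cmod (z - w)))"
    by (intro integrableI_nonneg nn) (use fin in auto)
  from Bochner_Integration.integrable_diff[OF M.integrable_const[of "ln D"] this]
  show "integrable \<mu> (\<lambda>w. ln (cmod (z - w)))" by simp
qed

text \<open>
  A point mass would make \<open>U\<close> infinite.  Quantitatively, the kernel is at least \<open>L\<close> on the disc of
  radius \<open>D exp (- L)\<close>, so that the measure of this disc is at most \<open>a / L\<close>.
\<close>

lemma measure_ball_small:
  assumes z0: "z0 \<in> support \<mu>" and e: "e > 0"
  obtains \<rho> where "\<rho> > 0" "measure \<mu> (ball z0 \<rho>) \<le> e"
proof -
  interpret M: prob_space \<mu> using \<mu>_E by (simp add: prob_on_def)
  define L where "L = (a + 1) / e"
  have L: "L > 0" using e a_nonneg by (simp add: L_def)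
  define \<rho> where "\<rho> = D * exp (- L)"
  have \<rho>: "\<rho> > 0" using D_pos by (simp add: \<rho>_def)
  have "ennreal L * emeasure \<mu> (ball z0 \<rho>) = (\<integral>\<^sup>+w. ennreal L * indicator (ball z0 \<rho>) w \<partial>\<mu>)"
    by (rule nn_integral_cmult_indicator[symmetric]) (simp add: sets_\<mu>)
  also have "\<dots> \<le> U z0" unfolding U_def
  proof (rule nn_integral_mono)
    fix w
    show "ennreal L * indicator (ball z0 \<rho>) w \<le> shifted_kernel D z0 w"
    proof (cases "w \<in> ball z0 \<rho> \<and> w \<noteq> z0")
      case True
      then have c: "cmod (z0 - w) < \<rho>" "cmod (z0 - w) > 0" by (auto simp: dist_norm)
      have "L = ln (D / \<rho>)" using D_pos by (simp add: \<rho>_def ln_div ln_mult)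
      also have "\<dots> \<le> ln (D / cmod (z0 - w))"
        by (rule ln_mono) (use c \<rho> D_pos in \<open>auto intro!: divide_left_mono\<close>)
      finally show ?thesis using True by (auto simp: shifted_kernel_def intro: ennreal_leI)
    qed (auto simp: shifted_kernel_def indicator_def)
  qed
  also have "\<dots> \<le> ennreal a" by (rule U_le_on_support[OF z0])
  finally have "ennreal (L * measure \<mu> (ball z0 \<rho>)) \<le> ennreal a"
    using L by (simp add: M.emeasure_eq_measure ennreal_mult)
  then have "L * measure \<mu> (ball z0 \<rho>) \<le> a" using a_nonneg by (simp add: ennreal_le_iff)
  also have "\<dots> \<le> a + 1" by simp
  finally have "(a + 1) * measure \<mu> (ball z0 \<rho>) \<le> (a + 1) * e" using e by (simp add: L_def field_simps)
  then have "measure \<mu> (ball z0 \<rho>) \<le> e" using a_nonneg by (subst (asm) mult_le_cancel_left_pos) auto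
  with \<rho> show ?thesis by (rule that)
qed

text \<open>
  The potential near the support is compared with its value at the nearest point \<open>z'\<close> of the
  support.  Every point \<open>w\<close> of the support satisfies \<open>\<bar>z' - w\<bar> \<le> 2 \<bar>z - w\<bar>\<close>, which costs at most \<open>ln 2\<close>
  times the mass close to \<open>z0\<close>; for the remaining \<open>w\<close> the two kernels differ by a multiple of
  \<open>dist z z0\<close>.
\<close>

lemma U_boundary_bound:
  assumes z0: "z0 \<in> support \<mu>" and \<rho>: "\<rho> > 0" and z: "z \<notin> support \<mu>" and d: "dist z z0 \<le> \<rho> / 2"
  shows "U z \<le> ennreal (a + ln 2 * measure \<mu> (ball z0 \<rho>) + 2 * dist z z0 / \<rho>)"
proof -
  interpret M: prob_space \<mu> using \<mu>_E by (simp add: prob_on_def)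
  obtain z' where z': "z' \<in> support \<mu>" "\<And>y. y \<in> support \<mu> \<Longrightarrow> dist z z' \<le> dist z y"
    using distance_attains_inf[OF closed_support[OF sets_\<mu>], of z] z0 by blast
  have zz': "dist z z' \<le> dist z z0" by (rule z'(2)[OF z0])
  let ?c = "2 * dist z z0 / \<rho>"
  have "U z \<le> (\<integral>\<^sup>+w. shifted_kernel D z' w + (ennreal (ln 2) * indicator (ball z0 \<rho>) w + ennreal ?c) \<partial>\<mu>)"
    unfolding U_def
  proof (rule nn_integral_mono_AE)
    show "AE w in \<mu>. shifted_kernel D z w \<le> shifted_kernel D z' w + (ennreal (ln 2) * indicator (ball z0 \<rho>) w + ennreal ?c)"
      using AE_in_support
    proof eventually_elim
      case (elim w)
      then have zw: "z \<noteq> w" using z by auto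
      show ?case
      proof (cases "z' = w")
        case False
        define x where "x = cmod (z - w)"
        define y where "y = cmod (z' - w)"
        have xy: "x > 0" "y > 0" using zw False by (auto simp: x_def y_def)
        have tri: "y \<le> dist z z' + x" using norm_triangle_ineq[of "z' - z" "z - w"] by (simp add: x_def y_def dist_norm norm_minus_commute)
        have nn: "ln (D / y) \<ge> 0"
        proof -
          have "cmod z' \<le> D/2" "w \<in> E" using z'(1) elim support_subset_E E_ball D_pos by force+
          then have "y \<le> D" unfolding y_def by (rule dist_support_le)
          then show ?thesis using xy by (intro ln_ge_zero) (simp add: le_divide_eq)
        qed
        define e where "e = ln 2 * indicator (ball z0 \<rho>) w + ?c"
        have e0: "e \<ge> 0" using \<rho> by (simp add: e_def)
        have "ln (y / x) \<le> e"
        proof (cases "w \<in> ball z0 \<rho>")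
          case True
          have "dist z z' \<le> x" using z'(2)[OF elim] by (simp add: x_def dist_norm)
          then have "y / x \<le> 2" using tri xy by (simp add: divide_le_eq)
          then have "ln (y / x) \<le> ln 2" using xy by (intro ln_mono) auto
          then show ?thesis using True \<rho> by (simp add: e_def add_increasing2)
        next
          case False
          then have "\<rho> \<le> dist z0 w" by simp
          also have "dist z0 w \<le> dist z z0 + x" using dist_triangle[of z0 w z] by (simp add: x_def dist_norm norm_minus_commute)
          finally have x2: "x \<ge> \<rho> / 2" using d by linarith
          have "ln (y / x) \<le> y / x - 1" using xy by (intro ln_le_minus_one) auto
          also have "\<dots> = (y - x) / x" using xy by (simp add: diff_divide_distrib)
          also have "\<dots> \<le> dist z z0 / x" using tri zz' xy by (intro divide_right_mono) auto
          also have "\<dots> \<le> dist z z0 / (\<rho> / 2)" using x2 xy \<rho> by (intro divide_left_mono) auto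
          also have "\<dots> = e" using False by (simp add: e_def)
          finally show ?thesis .
        qed
        moreover have "ln (D / x) = ln (D / y) + ln (y / x)" using xy D_pos by (simp add: ln_div)
        ultimately have "ln (D / x) \<le> ln (D / y) + e" by linarith
        then have "ennreal (ln (D / x)) \<le> ennreal (ln (D / y) + e)" by (rule ennreal_leI)
        also have "\<dots> = ennreal (ln (D / y)) + ennreal e" using nn e0 by simp
        also have "ennreal e = ennreal (ln 2) * indicator (ball z0 \<rho>) w + ennreal ?c"
          using \<rho> by (cases "w \<in> ball z0 \<rho>") (simp_all add: e_def)
        finally show ?thesis using zw False by (simp add: shifted_kernel_def x_def y_def)
      qed (simp add: shifted_kernel_def)
    qed
  qed
  also have "\<dots> = U z' + ((\<integral>\<^sup>+w. ennreal (ln 2) * indicator (ball z0 \<rho>) w \<partial>\<mu>) + ennreal ?c)"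
  proof -
    have [measurable]: "ball z0 \<rho> \<in> sets borel" by simp
    have "(\<integral>\<^sup>+w. shifted_kernel D z' w + (ennreal (ln 2) * indicator (ball z0 \<rho>) w + ennreal ?c) \<partial>\<mu>)
      = (\<integral>\<^sup>+w. shifted_kernel D z' w \<partial>\<mu>) + (\<integral>\<^sup>+w. ennreal (ln 2) * indicator (ball z0 \<rho>) w + ennreal ?c \<partial>\<mu>)"
      by (rule nn_integral_add) measurable
    also have "(\<integral>\<^sup>+w. ennreal (ln 2) * indicator (ball z0 \<rho>) w + ennreal ?c \<partial>\<mu>)
      = (\<integral>\<^sup>+w. ennreal (ln 2) * indicator (ball z0 \<rho>) w \<partial>\<mu>) + (\<integral>\<^sup>+w. ennreal ?c \<partial>\<mu>)"
      by (rule nn_integral_add) measurable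
    finally show ?thesis by (simp only: U_def nn_integral_const M.emeasure_space_1 mult_1_right)
  qed
  also have "(\<integral>\<^sup>+w. ennreal (ln 2) * indicator (ball z0 \<rho>) w \<partial>\<mu>) = ennreal (ln 2) * emeasure \<mu> (ball z0 \<rho>)"
    by (rule nn_integral_cmult_indicator) (simp add: sets_\<mu>)
  also have "U z' + (ennreal (ln 2) * emeasure \<mu> (ball z0 \<rho>) + ennreal ?c) \<le> ennreal a + (ennreal (ln 2) * emeasure \<mu> (ball z0 \<rho>) + ennreal ?c)"
    by (intro add_right_mono U_le_on_support z'(1))
  also have "\<dots> = ennreal (a + (ln 2 * measure \<mu> (ball z0 \<rho>) + ?c))"
    using a_nonneg \<rho> by (simp add: M.emeasure_eq_measure ennreal_mult ennreal_plus)
  finally show ?thesis by (simp add: add.assoc)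
qed

text \<open>
  The maximum principle for the constant polynomial 1 with \<open>s = 1\<close>; the bound on the boundary
  comes from the previous estimate.
\<close>

lemma log_pot_ge_off_support:
  assumes z: "z \<notin> support \<mu>"
  shows "log_pot \<mu> z \<ge> ln D - a"
proof -
  let ?S = "support \<mu>"
  define B where "B = exp (- (ln D - a))"
  have pS: "prob_on ?S \<mu>" by (rule prob_on_support[OF \<mu>_E])
  have cS: "closed ?S" by (rule closed_support[OF sets_\<mu>])
  have "cmod (poly 1 z) * exp (- 1 * log_pot \<mu> z) \<le> B"
  proof (rule weighted_poly_maximum_principle[OF pS compact_support, where W="- ?S"])
    show "open (- ?S)" using cS by (rule open_Compl)
    show "z \<in> - ?S" using z by simp
    fix z0 B' assume z0: "z0 \<in> frontier (- ?S)" and B': "B' > B"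
    have z0S: "z0 \<in> ?S" using z0 frontier_subset_closed[OF cS] by (auto simp: frontier_complement)
    have "B > 0" by (simp add: B_def)
    \<comment> \<open>The boundary estimate yields the factor \<open>exp e\<close>; half of \<open>ln (B' / B)\<close> leaves a strict inequality.\<close>
    define e where "e = (ln B' - ln B) / 2"
    have e: "e > 0" using B' \<open>B > 0\<close> by (simp add: e_def)
    obtain \<rho> where \<rho>: "\<rho> > 0" "measure \<mu> (ball z0 \<rho>) \<le> e / 2" by (rule measure_ball_small[OF z0S, of "e/2"]) (use e in auto)
    define r where "r = Min {\<rho> / 2, \<rho> * e / 4, D / 4}"
    have r: "r > 0" "r \<le> \<rho> / 2" "r \<le> \<rho> * e / 4" "r \<le> D / 4" using \<rho> e D_pos by (auto simp: r_def)
    show "\<exists>r>0. \<forall>z\<in>- ?S. dist z z0 < r \<longrightarrow> cmod (poly 1 z) * exp (- 1 * log_pot \<mu> z) < B'"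
    proof (intro exI[of _ r] conjI ballI impI r(1))
      fix x assume x: "x \<in> - ?S" "dist x z0 < r"
      have z0D: "cmod z0 \<le> D/4" using z0S support_subset_E E_ball by force
      have xD: "cmod x \<le> D/2" using z0D x(2) r(4) norm_triangle_ineq2[of x z0] by (simp add: dist_norm)
      have "U x \<le> ennreal (a + ln 2 * measure \<mu> (ball z0 \<rho>) + 2 * dist x z0 / \<rho>)"
        by (rule U_boundary_bound[OF z0S \<rho>(1)]) (use x r in auto)
      also have "\<dots> \<le> ennreal (a + e)"
      proof (rule ennreal_leI)
        have "ln 2 * measure \<mu> (ball z0 \<rho>) \<le> 1 * (e / 2)" using \<rho> ln_2_less_1 by (intro mult_mono) auto
        moreover have "2 * dist x z0 / \<rho> \<le> e / 2"
        proof -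
          have "dist x z0 \<le> e * \<rho> / 4" using x(2) r(3) by (simp add: mult.commute)
          then show ?thesis using \<rho>(1) by (simp add: divide_le_eq)
        qed
        ultimately show "a + ln 2 * measure \<mu> (ball z0 \<rho>) + 2 * dist x z0 / \<rho> \<le> a + e" by linarith
      qed
      finally have Ux: "U x \<le> ennreal (a + e)" .
      have "AE w in \<mu>. w \<noteq> x" using AE_in_support by eventually_elim (use x in auto)
      then have "U x = ennreal (ln D - log_pot \<mu> x)"
        by (rule U_eq_log_pot(1)[OF xD _ integrable_log_off_support[OF pS compact_support]]) (use x in auto)
      with Ux have "ennreal (ln D - log_pot \<mu> x) \<le> ennreal (a + e)" by (simp only:)
      moreover have "0 \<le> a + e" using a_nonneg e by simp
      ultimately have "ln D - log_pot \<mu> x \<le> a + e" by (simp only: ennreal_le_iff)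
      then have "exp (- log_pot \<mu> x) \<le> exp (- (ln D - a) + e)" by simp
      also have "\<dots> = B * exp e" by (simp add: B_def flip: exp_add)
      also have "\<dots> < B * exp (2 * e)" using e \<open>B > 0\<close> by simp
      also have "2 * e = ln B' - ln B" by (simp add: e_def)
      also have "B * exp (ln B' - ln B) = B'" using B' \<open>B > 0\<close> by (simp add: exp_diff)
      finally show "cmod (poly 1 x) * exp (- 1 * log_pot \<mu> x) < B'" by simp
    qed
  qed (auto simp: B_def)
  then have "exp (- log_pot \<mu> z) \<le> exp (- (ln D - a))" by (simp add: B_def)
  then show ?thesis by (simp only: exp_le_cancel_iff)
qed

lemma U_le_E: assumes "z \<in> E" shows "U z \<le> ennreal a"
proof (cases "z \<in> support \<mu>")
  case False
  have zD: "cmod z \<le> D/2" using assms E_ball D_pos by force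
  have "AE w in \<mu>. w \<noteq> z" using AE_in_support by eventually_elim (use False in auto)
  then have "U z = ennreal (ln D - log_pot \<mu> z)"
    by (rule U_eq_log_pot(1)[OF zD _ integrable_log_off_support[OF prob_on_support[OF \<mu>_E] compact_support False]])
  also have "\<dots> \<le> ennreal a" using log_pot_ge_off_support[OF False] by (intro ennreal_leI) simp
  finally show ?thesis .
qed (rule U_le_on_support)

text \<open>
  This makes Lebesgue measure an admissible competitor, so that statements which hold
  \<open>\<sigma>\<close>-almost everywhere for all \<open>\<sigma>\<close> of finite energy hold almost everywhere for the area on \<open>E\<close>.
\<close>

lemma area_energy_finite:
  assumes pos: "emeasure lborel E > 0"
  shows "prob_on E (uniform_measure lborel E)" "mutual_energy D (uniform_measure lborel E) (uniform_measure lborel E) < \<infinity>"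
proof -
  let ?\<sigma> = "uniform_measure lborel E"
  have finE: "emeasure lborel E < \<infinity>" using compact_E by (rule emeasure_compact_finite)
  have ne: "emeasure lborel E \<noteq> 0" using pos by simp
  have ps: "prob_space ?\<sigma>" by (rule prob_space_uniform_measure) (use ne finE in auto)
  have "emeasure ?\<sigma> (- E) = emeasure lborel (E \<inter> - E) / emeasure lborel E"
    by (rule emeasure_uniform_measure) auto
  then have "emeasure ?\<sigma> (- E) = 0" by simp
  with ps show "prob_on E ?\<sigma>" by (simp add: prob_on_def)
  have s[measurable_cong]: "sets ?\<sigma> = sets borel" by simp
  interpret S: prob_space ?\<sigma> by (rule ps)
  have nn: "(\<integral>\<^sup>+z. f z \<partial>?\<sigma>) = (\<integral>\<^sup>+z. f z * indicator E z \<partial>lborel) / emeasure lborel E" if "f \<in> borel_measurable borel" for f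
    by (rule nn_integral_uniform_measure) (use that in auto)
  \<comment> \<open>\<open>J\<close> bounds the potential of the area at every point of \<open>E\<close>, by translation to the origin.\<close>
  define J where "J = (\<integral>\<^sup>+v. ennreal (indicator (ball 0 D) v * (\<bar>ln D\<bar> + \<bar>ln (cmod v)\<bar>)) \<partial>lborel)"
  have [measurable]: "ball (0::complex) D \<in> sets borel" by simp
  have "integrable lborel (\<lambda>v. indicator (ball (0::complex) D) v * \<bar>ln D\<bar> + \<bar>indicator (ball (0::complex) D) v * ln (cmod v)\<bar>)"
    using emeasure_lborel_ball_finite[of "0::complex" D]
    by (intro Bochner_Integration.integrable_add integrable_abs integrable_log_ball integrable_mult_left integrable_real_indicator) auto
  then have "integrable lborel (\<lambda>v. indicator (ball (0::complex) D) v * (\<bar>ln D\<bar> + \<bar>ln (cmod v)\<bar>))"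
    by (simp add: distrib_left abs_mult)
  then have J: "J < \<infinity>" unfolding J_def by (subst nn_integral_eq_integral) auto
  have inner: "(\<integral>\<^sup>+w. shifted_kernel D z w * indicator E w \<partial>lborel) \<le> J" if z: "z \<in> E" for z
  proof -
    have "(\<integral>\<^sup>+w. shifted_kernel D z w * indicator E w \<partial>lborel) \<le> (\<integral>\<^sup>+w. ennreal (indicator (ball 0 D) (-z + w) * (\<bar>ln D\<bar> + \<bar>ln (cmod (-z + w))\<bar>)) \<partial>lborel)"
    proof (rule nn_integral_mono_AE)
      show "AE w in lborel. shifted_kernel D z w * indicator E w \<le> ennreal (indicator (ball 0 D) (-z + w) * (\<bar>ln D\<bar> + \<bar>ln (cmod (-z + w))\<bar>))"
        using AE_lborel_cmod_neq[of z 0]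
      proof eventually_elim
        case (elim w)
        show ?case
        proof (cases "w \<in> E")
          case True
          then have "cmod w \<le> D/4" "cmod z \<le> D/4" using z E_ball by auto
          then have "cmod (-z + w) < D" using norm_triangle_ineq4[of w z] D_pos by simp
          then have "indicator (ball 0 D) (-z + w) = (1::real)" by simp
          moreover have "ln (D / cmod (z - w)) \<le> \<bar>ln D\<bar> + \<bar>ln (cmod (-z + w))\<bar>"
            using elim D_pos by (subst ln_div) (auto simp: norm_minus_commute)
          ultimately show ?thesis using True elim
            by (auto simp: shifted_kernel_def simp del: ennreal_plus intro: ennreal_leI)
        qed simp
      qed
    qed
    also have "\<dots> = (\<integral>\<^sup>+v. ennreal (indicator (ball 0 D) v * (\<bar>ln D\<bar> + \<bar>ln (cmod v)\<bar>)) \<partial>distr lborel borel ((+) (-z)))"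
      by (rule nn_integral_distr[symmetric]) measurable
    also have "\<dots> = J" unfolding lborel_distr_plus J_def ..
    finally show ?thesis .
  qed
  have "mutual_energy D ?\<sigma> ?\<sigma> = (\<integral>\<^sup>+z. (\<integral>\<^sup>+w. shifted_kernel D z w \<partial>?\<sigma>) * indicator E z \<partial>lborel) / emeasure lborel E"
    unfolding mutual_energy_def by (rule nn) measurable
  also have "\<dots> \<le> (\<integral>\<^sup>+z. (J / emeasure lborel E) * indicator E z \<partial>lborel) / emeasure lborel E"
  proof (intro divide_right_mono_ennreal nn_integral_mono)
    fix z
    have "(\<integral>\<^sup>+w. shifted_kernel D z w \<partial>?\<sigma>) = (\<integral>\<^sup>+w. shifted_kernel D z w * indicator E w \<partial>lborel) / emeasure lborel E"
      by (rule nn) measurable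
    also have "z \<in> E \<Longrightarrow> \<dots> \<le> J / emeasure lborel E" by (intro divide_right_mono_ennreal inner)
    finally show "(\<integral>\<^sup>+w. shifted_kernel D z w \<partial>?\<sigma>) * indicator E z \<le> (J / emeasure lborel E) * indicator E z"
      by (cases "z \<in> E") auto
  qed
  also have "(\<integral>\<^sup>+z. (J / emeasure lborel E) * indicator E z \<partial>lborel) = (J / emeasure lborel E) * emeasure lborel E"
    by (rule nn_integral_cmult_indicator) simp
  also have "(J / emeasure lborel E) * emeasure lborel E / emeasure lborel E < \<infinity>"
    using J ne finE by (simp add: ennreal_mult_divide_eq ennreal_divide_eq_top_iff less_top[symmetric])
  finally show "mutual_energy D ?\<sigma> ?\<sigma> < \<infinity>" .
qed

text \<open>
  The lower bound for \<open>U\<close> holds almost everywhere on \<open>E\<close> with respect to the area, and the upper bound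
  holds at every point of \<open>E\<close>.
\<close>

lemma log_pot_eq_AE_E: "AE z in lborel. z \<in> E \<longrightarrow> log_pot \<mu> z = ln D - a"
proof (cases "emeasure lborel E > 0")
  case False
  then have "E \<in> null_sets lborel" by (auto simp: null_sets_def)
  then have "AE z in lborel. z \<notin> E" by (rule AE_not_in)
  then show ?thesis by eventually_elim simp
next
  case True
  have "AE z in uniform_measure lborel E. ennreal a \<le> U z" by (rule U_ge_AE[OF area_energy_finite[OF True]])
  moreover have "emeasure lborel E < \<infinity>" using compact_E by (rule emeasure_compact_finite)
  ultimately have "AE z in lborel. z \<in> E \<longrightarrow> ennreal a \<le> U z"
    using True by (subst (asm) AE_uniform_measure) auto
  then show ?thesis
  proof eventually_elim
    case (elim z)
    show ?case
    proof
      assume z: "z \<in> E"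
      then have U: "U z = ennreal a" using elim U_le_E[OF z] by simp
      have zD: "cmod z \<le> D/2" using z E_ball D_pos by force
      have fin: "U z < \<infinity>" using U by simp
      note i = U_finite_imp[OF zD fin]
      show "log_pot \<mu> z = ln D - a"
        using U U_eq_log_pot[OF zD i] a_nonneg by simp
    qed
  qed
qed

end

section \<open>Chebyshev polynomials\<close>

lemma supnorm_poly_upper:
  assumes "compact E" "z \<in> E"
  shows "cmod (poly p z) \<le> supnorm_on E (poly p)"
  unfolding supnorm_on_def
proof (rule cSUP_upper[OF assms(2)])
  have "compact ((\<lambda>z. cmod (poly p z)) ` E)"
    by (rule compact_continuous_image) (auto intro!: continuous_intros assms)
  then show "bdd_above ((\<lambda>z. cmod (poly p z)) ` E)" by (intro bounded_imp_bdd_above compact_imp_bounded)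
qed

lemma supnorm_poly_least:
  assumes "E \<noteq> {}" "\<And>z. z \<in> E \<Longrightarrow> cmod (poly p z) \<le> B"
  shows "supnorm_on E (poly p) \<le> B"
  unfolding supnorm_on_def using assms by (rule cSUP_least)

lemma supnorm_poly_attained:
  assumes "compact E" "E \<noteq> {}"
  obtains z where "z \<in> E" "supnorm_on E (poly p) = cmod (poly p z)"
proof -
  have "continuous_on E (\<lambda>z. cmod (poly p z))" by (intro continuous_intros)
  from continuous_attains_sup[OF assms this] obtain z where z: "z \<in> E" "\<forall>y\<in>E. cmod (poly p y) \<le> cmod (poly p z)" by blast
  have "supnorm_on E (poly p) = cmod (poly p z)"
    by (intro antisym supnorm_poly_least supnorm_poly_upper) (use assms z in auto)
  with z(1) show ?thesis by (rule that)
qed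

lemma supnorm_poly_pos:
  assumes "compact E" "infinite E" "p \<noteq> 0"
  shows "supnorm_on E (poly p) > 0"
proof -
  have "finite {z. poly p z = 0}" by (rule poly_roots_finite[OF assms(3)])
  then obtain z where "z \<in> E" "poly p z \<noteq> 0" using assms(2) by (metis (mono_tags, lifting) finite_subset mem_Collect_eq subsetI)
  then have "0 < cmod (poly p z)" "cmod (poly p z) \<le> supnorm_on E (poly p)" using supnorm_poly_upper[OF assms(1)] by auto
  then show ?thesis by linarith
qed

lemma closest_point_closer:
  fixes H :: "complex set"
  assumes "convex H" "closed H" "z \<in> H" "w \<notin> H"
  shows "cmod (z - closest_point H w) < cmod (z - w)"
proof -
  define c where "c = closest_point H w"
  have "c \<in> H" unfolding c_def using assms by (intro closest_point_in_set) auto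
  then have "c \<noteq> w" using assms(4) by auto
  have dot: "inner (w - c) (z - c) \<le> 0" unfolding c_def by (rule closest_point_dot[OF assms(1-3)])
  have "(norm (z - w))\<^sup>2 = (norm (z - c))\<^sup>2 + (norm (c - w))\<^sup>2 - 2 * inner (w - c) (z - c)"
    by (simp add: power2_norm_eq_inner inner_diff_left inner_diff_right inner_commute)
  moreover have "(norm (c - w))\<^sup>2 > 0" using \<open>c \<noteq> w\<close> by simp
  ultimately have "(norm (z - c))\<^sup>2 < (norm (z - w))\<^sup>2" using dot by linarith
  then show ?thesis unfolding c_def by (rule power_less_imp_less_base) simp
qed

definition prod_poly :: "'a set \<Rightarrow> ('a \<Rightarrow> complex) \<Rightarrow> complex poly" where
  "prod_poly A x = (\<Prod>i\<in>A. [:- x i, 1:])"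

lemma poly_prod_poly: "poly (prod_poly A x) z = (\<Prod>i\<in>A. z - x i)"
  by (simp add: prod_poly_def poly_prod)

lemma monic_prod_poly: "monic_of_degree (card A) (prod_poly A x)"
proof -
  have "lead_coeff (prod_poly A x) = 1" unfolding prod_poly_def lead_coeff_prod by simp
  moreover have "degree (prod_poly A x) = card A"
    unfolding prod_poly_def by (subst degree_prod_sum_eq) auto
  ultimately show ?thesis by (simp add: monic_of_degree_def)
qed

lemma monic_eq_prod_poly:
  assumes "monic_of_degree n p"
  obtains x where "\<And>z. poly p z = (\<Prod>i<n. z - x i)"
proof -
  obtain xs where xs: "mset xs = proots p" using ex_mset by blast
  have len: "length xs = n" using size_proots_complex[of p] assms by (simp add: monic_of_degree_def flip: xs)
  have "poly p z = (\<Prod>i<n. z - xs ! i)" for z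
  proof -
    have lc: "lead_coeff p = 1" using assms unfolding monic_of_degree_def by blast
    have "poly p z = (\<Prod>w\<in>#mset xs. z - w)" unfolding xs by (rule monic_poly_eq_prod[OF lc])
    also have "\<dots> = prod_list (map (\<lambda>w. z - w) xs)" by (simp flip: prod_mset_prod_list)
    also have "\<dots> = (\<Prod>i<n. z - xs ! i)" by (simp add: prod.list_conv_set_nth len atLeast0LessThan)
    finally show ?thesis .
  qed
  then show ?thesis by (rule that)
qed

lemma compact_function_space:
  fixes H :: "complex set"
  assumes "compact H"
  shows "compact {x :: nat \<Rightarrow> complex. \<forall>i. x i \<in> H}"
proof -
  have "compactin (product_topology (\<lambda>i::nat. euclidean) UNIV) (PiE UNIV (\<lambda>_. H))"
    using assms by (simp add: compactin_PiE)
  then have "compact (PiE UNIV (\<lambda>_::nat. H))" by (simp add: euclidean_product_topology)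
  moreover have "PiE UNIV (\<lambda>_::nat. H) = {x. \<forall>i. x i \<in> H}" by (auto simp: PiE_def)
  ultimately show ?thesis by simp
qed

text \<open>
  Moving the roots to their nearest points in the convex hull of \<open>E\<close> does not increase the
  supremum norm, so that only roots in a compact set matter.  The sets of root sequences
  whose norm is at most \<open>c\<close> are closed, and those with \<open>c\<close> above the infimum have the finite
  intersection property.
\<close>

lemma chebyshev_minimizer_exists:
  assumes E: "compact E" "infinite E"
  obtains p where "monic_of_degree n p" "\<And>q. monic_of_degree n q \<Longrightarrow> supnorm_on E (poly p) \<le> supnorm_on E (poly q)"
proof -
  have Ene: "E \<noteq> {}" using E by auto
  define H where "H = convex hull E"
  have H: "compact H" "convex H" "closed H" "E \<subseteq> H" "H \<noteq> {}"
    using E Ene by (auto simp: H_def compact_convex_hull hull_subset compact_imp_closed intro: hull_inc)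
  define X where "X = {x :: nat \<Rightarrow> complex. \<forall>i. x i \<in> H}"
  have cX: "compact X" unfolding X_def by (rule compact_function_space[OF H(1)])
  have toX: "\<exists>x\<in>X. supnorm_on E (poly (prod_poly {..<n} x)) \<le> supnorm_on E (poly q)" if q: "monic_of_degree n q" for q
  proof -
    obtain y where y: "\<And>z. poly q z = (\<Prod>i<n. z - y i)" using monic_eq_prod_poly[OF q] by blast
    define x where "x = (\<lambda>i. closest_point H (y i))"
    have "x \<in> X" unfolding X_def x_def using closest_point_in_set[OF H(3,5)] by auto
    moreover have "supnorm_on E (poly (prod_poly {..<n} x)) \<le> supnorm_on E (poly q)"
    proof (rule supnorm_poly_least[OF Ene])
      fix z assume z: "z \<in> E"
      have "cmod (z - x i) \<le> cmod (z - y i)" for i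
      proof (cases "y i \<in> H")
        case True then show ?thesis by (simp add: x_def closest_point_self)
      next
        case False then show ?thesis using closest_point_closer[OF H(2,3), of z "y i"] z H(4) by (auto simp: x_def)
      qed
      then have "cmod (poly (prod_poly {..<n} x) z) \<le> cmod (poly q z)"
        unfolding poly_prod_poly y prod_norm[symmetric] by (intro prod_mono) auto
      also have "\<dots> \<le> supnorm_on E (poly q)" by (rule supnorm_poly_upper[OF E(1) z])
      finally show "cmod (poly (prod_poly {..<n} x) z) \<le> supnorm_on E (poly q)" .
    qed
    ultimately show ?thesis by blast
  qed
  define N where "N = (\<lambda>x. supnorm_on E (poly (prod_poly {..<n} x)))"
  have N0: "N x \<ge> 0" for x
    unfolding N_def using Ene supnorm_poly_upper[OF E(1)] by (meson ex_in_conv norm_ge_zero order_trans)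
  have Xne: "X \<noteq> {}" using H(5) by (auto simp: X_def)
  define m where "m = (INF x\<in>X. N x)"
  have bdd: "bdd_below (N ` X)" using N0 by (intro bdd_belowI2)
  define F where "F = (\<lambda>c. {x. \<forall>z\<in>E. cmod (\<Prod>i<n. z - x i) \<le> c})"
  have Fcl: "closed (F c)" for c
  proof -
    have "F c = (\<Inter>z\<in>E. {x. cmod (\<Prod>i<n. z - x i) \<le> c})" by (auto simp: F_def)
    moreover have "closed {x :: nat \<Rightarrow> complex. cmod (\<Prod>i<n. z - x i) \<le> c}" for z
      by (intro closed_Collect_le continuous_intros continuous_on_product_coordinates)
    ultimately show ?thesis by auto
  qed
  have FN: "x \<in> F c \<longleftrightarrow> N x \<le> c" for x c
  proof
    assume "x \<in> F c"
    then show "N x \<le> c" unfolding N_def by (intro supnorm_poly_least[OF Ene]) (auto simp: F_def poly_prod_poly)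
  next
    assume "N x \<le> c"
    then show "x \<in> F c" unfolding F_def N_def
      using supnorm_poly_upper[OF E(1), of _ "prod_poly {..<n} x"] by (force simp: poly_prod_poly)
  qed
  have "X \<inter> (\<Inter>c\<in>{m<..}. F c) \<noteq> {}"
  proof (rule compact_imp_fip_image[OF cX Fcl])
    fix I' assume I': "finite I'" "I' \<subseteq> {m<..}"
    show "X \<inter> (\<Inter>c\<in>I'. F c) \<noteq> {}"
    proof (cases "I' = {}")
      case False
      then have "Min I' > m" using I' by (auto dest: Min_in)
      then obtain x where x: "x \<in> X" "N x < Min I'" unfolding m_def using cINF_less_iff[OF Xne bdd] by blast
      have "x \<in> F c" if "c \<in> I'" for c using Min_le[OF I'(1) that] x(2) by (simp add: FN)
      then show ?thesis using x by blast
    qed (use Xne in auto)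
  qed
  then obtain x where x: "x \<in> X" "\<forall>c\<in>{m<..}. N x \<le> c" by (auto simp: FN)
  have "N x \<le> m" by (rule dense_ge) (use x in auto)
  show ?thesis
  proof (rule that[OF monic_prod_poly[of "{..<n}" x, simplified]])
    fix q assume q: "monic_of_degree n q"
    obtain y where y: "y \<in> X" "N y \<le> supnorm_on E (poly q)" using toX[OF q] by (auto simp: N_def)
    have "m \<le> N y" unfolding m_def by (rule cINF_lower[OF bdd y(1)])
    then show "supnorm_on E (poly (prod_poly {..<n} x)) \<le> supnorm_on E (poly q)" using \<open>N x \<le> m\<close> y(2) unfolding N_def by linarith
  qed
qed

text \<open>
  The bound on \<open>\<rho>\<^sup>2 + \<delta>\<^sup>2 / 4\<close> gives \<open>\<rho> \<le> m - \<delta>\<^sup>2 / (8 m)\<close>.  The loss \<open>\<delta>\<^sup>2 / (16 m)\<close> absorbs \<open>\<epsilon> \<delta> C\<close> up to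
  \<open>4 m \<epsilon>\<^sup>2 C\<^sup>2\<close>, which is at most \<open>\<epsilon> m / 2\<close> by the choice of \<open>\<epsilon>\<close>.
\<close>

lemma real_perturbation_bound:
  fixes m \<rho> \<delta> C :: real
  assumes m: "m > 0" and \<rho>: "\<rho> \<ge> 0" "\<rho>\<^sup>2 + \<delta>\<^sup>2 / 4 \<le> m\<^sup>2" and \<delta>: "\<delta> \<ge> 0" and C: "C \<ge> 0"
    and \<epsilon>: "\<epsilon> = 1 / (8 * (C\<^sup>2 + 1))"
  shows "(1 - \<epsilon>) * \<rho> + \<epsilon> * (\<delta> * C) \<le> m - \<epsilon> * m / 2"
proof -
  have e: "\<epsilon> > 0" "\<epsilon> \<le> 1/8" "4 * \<epsilon> * C\<^sup>2 \<le> 1/2"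
    unfolding \<epsilon> by (auto simp: field_simps add_pos_nonneg)
  have "\<rho>\<^sup>2 \<le> (m - \<delta>\<^sup>2 / (8 * m))\<^sup>2"
  proof -
    have "(m - \<delta>\<^sup>2 / (8 * m))\<^sup>2 = m\<^sup>2 - \<delta>\<^sup>2 / 4 + (\<delta>\<^sup>2 / (8 * m))\<^sup>2"
      using m by (simp add: power2_eq_square field_simps)
    then show ?thesis using \<rho>(2) zero_le_power2[of "\<delta>\<^sup>2 / (8 * m)"] by linarith
  qed
  moreover have "0 \<le> m - \<delta>\<^sup>2 / (8 * m)"
  proof -
    have "\<delta>\<^sup>2 \<le> 4 * m\<^sup>2" using \<rho>(2) zero_le_power2[of \<rho>] by linarith
    also have "\<dots> \<le> 8 * m * m" by (simp add: power2_eq_square)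
    finally show ?thesis using m by (simp add: divide_le_eq mult.commute)
  qed
  ultimately have r: "\<rho> \<le> m - \<delta>\<^sup>2 / (8 * m)" by (rule power2_le_imp_le)
  have "(1 - \<epsilon>) * \<rho> \<le> (1 - \<epsilon>) * (m - \<delta>\<^sup>2 / (8 * m))" using r e by (intro mult_left_mono) auto
  also have "\<dots> = m - \<epsilon> * m - (1 - \<epsilon>) * (\<delta>\<^sup>2 / (8 * m))" by (simp add: algebra_simps)
  also have "\<dots> \<le> m - \<epsilon> * m - (1/2) * (\<delta>\<^sup>2 / (8 * m))"
    using e m by (intro diff_left_mono mult_right_mono) auto
  finally have 1: "(1 - \<epsilon>) * \<rho> \<le> m - \<epsilon> * m - \<delta>\<^sup>2 / (16 * m)" by simp
  have "0 \<le> (\<delta> - 8 * m * \<epsilon> * C)\<^sup>2 / (16 * m)" using m by simp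
  also have "\<dots> = \<delta>\<^sup>2 / (16 * m) - \<epsilon> * (\<delta> * C) + 4 * m * \<epsilon>\<^sup>2 * C\<^sup>2"
    using m by (simp add: power2_eq_square field_simps)
  finally have 2: "\<epsilon> * (\<delta> * C) \<le> \<delta>\<^sup>2 / (16 * m) + 4 * m * \<epsilon>\<^sup>2 * C\<^sup>2" by linarith
  have "4 * m * \<epsilon>\<^sup>2 * C\<^sup>2 = (4 * \<epsilon> * C\<^sup>2) * (m * \<epsilon>)" by (simp add: power2_eq_square)
  also have "\<dots> \<le> 1/2 * (m * \<epsilon>)" using e m by (intro mult_right_mono) auto
  finally have 3: "4 * m * \<epsilon>\<^sup>2 * C\<^sup>2 \<le> \<epsilon> * m / 2" by (simp add: mult.commute[of \<epsilon> m])
  show ?thesis using 1 2 3 by linarith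
qed

text \<open>
  Let \<open>r\<close> be the mean of two minimizers of norm \<open>m\<close> and \<open>d\<close> their difference, a polynomial of degree
  less than \<open>n\<close>.  The parallelogram law shows that \<open>\<bar>r\<bar>\<close> can only be close to \<open>m\<close> where \<open>d\<close> is small.
  The remainder \<open>g = r mod d\<close> agrees there with \<open>r\<close> up to a multiple of \<open>\<bar>d\<bar>\<close>, so that subtracting a
  small multiple of \<open>g\<close> lowers the norm of \<open>r\<close>.  The result is still monic of degree \<open>n\<close>.
\<close>

lemma chebyshev_minimizer_unique:
  assumes E: "compact E" "infinite E"
    and p: "monic_of_degree n p" "\<And>q. monic_of_degree n q \<Longrightarrow> supnorm_on E (poly p) \<le> supnorm_on E (poly q)"
    and q: "monic_of_degree n q" "\<And>p. monic_of_degree n p \<Longrightarrow> supnorm_on E (poly q) \<le> supnorm_on E (poly p)"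
  shows "p = q"
proof (rule ccontr)
  assume "p \<noteq> q"
  have Ene: "E \<noteq> {}" using E by auto
  define m where "m = supnorm_on E (poly p)"
  have mq: "supnorm_on E (poly q) = m" unfolding m_def by (intro antisym p(2) q(2) p(1) q(1))
  have "p \<noteq> 0" using p(1) by (auto simp: monic_of_degree_def)
  then have m: "m > 0" unfolding m_def by (rule supnorm_poly_pos[OF E])
  define d where "d = p - q"
  have d: "d \<noteq> 0" using \<open>p \<noteq> q\<close> by (simp add: d_def)
  have cn: "coeff p n = 1" "coeff q n = 1" "degree p = n" "degree q = n" using p(1) q(1) by (auto simp: monic_of_degree_def)
  have dn: "degree d < n"
  proof -
    have "degree d \<le> n" unfolding d_def using degree_diff_le_max[of p q] cn by simp
    moreover have "degree d \<noteq> n"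
    proof
      assume "degree d = n"
      then have "lead_coeff d = 0" by (simp add: d_def cn)
      then show False using d by simp
    qed
    ultimately show ?thesis by simp
  qed
  define r where "r = smult (1/2) (p + q)"
  define e where "e = r div d"
  define g where "g = r mod d"
  have rdeg: "r = d * e + g" by (simp add: e_def g_def)
  have gn: "degree g < n" using degree_mod_less[OF d, of r] dn by (auto simp: g_def)
  define C where "C = supnorm_on E (poly e)"
  have C: "cmod (poly e z) \<le> C" if "z \<in> E" for z unfolding C_def by (rule supnorm_poly_upper[OF E(1) that])
  obtain z0 where z0: "z0 \<in> E" using Ene by blast
  have C0: "C \<ge> 0" using C[OF z0] norm_ge_zero[of "poly e z0"] by linarith
  define \<epsilon> where "\<epsilon> = 1 / (8 * (C\<^sup>2 + 1))"
  have e0: "\<epsilon> > 0" "\<epsilon> \<le> 1" unfolding \<epsilon>_def by (auto simp: field_simps add_pos_nonneg)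
  define s where "s = r - smult (of_real \<epsilon>) g"
  have "coeff s n = 1" using gn by (simp add: s_def r_def cn coeff_eq_0)
  moreover have "degree s \<le> n"
    unfolding s_def by (intro degree_diff_le degree_smult_le[THEN order_trans]) (use gn cn in \<open>auto simp: r_def intro!: degree_add_le\<close>)
  ultimately have "monic_of_degree n s" unfolding monic_of_degree_def using le_degree[of s n] by fastforce
  then have "m \<le> supnorm_on E (poly s)" unfolding m_def by (rule p(2))
  also have "\<dots> \<le> m - \<epsilon> * m / 2"
  proof (rule supnorm_poly_least[OF Ene])
    fix z assume z: "z \<in> E"
    define P where "P = poly p z"
    define Q where "Q = poly q z"
    have PQ: "cmod P \<le> m" "cmod Q \<le> m"
      using supnorm_poly_upper[OF E(1) z, of p] supnorm_poly_upper[OF E(1) z, of q] mq by (auto simp: P_def Q_def m_def)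
    have R: "poly r z = (P + Q) / 2" "poly d z = P - Q" by (simp_all add: r_def d_def P_def Q_def)
    have "(cmod ((P + Q) / 2))\<^sup>2 + (cmod (P - Q))\<^sup>2 / 4 = ((cmod P)\<^sup>2 + (cmod Q)\<^sup>2) / 2"
      by (simp add: cmod_power2 norm_divide power_divide) (simp add: power2_eq_square field_simps)
    also have "\<dots> \<le> m\<^sup>2"
    proof -
      have "(cmod P)\<^sup>2 \<le> m\<^sup>2" "(cmod Q)\<^sup>2 \<le> m\<^sup>2" using PQ by (auto intro!: power_mono)
      then show ?thesis by simp
    qed
    finally have sq: "(cmod (poly r z))\<^sup>2 + (cmod (poly d z))\<^sup>2 / 4 \<le> m\<^sup>2" unfolding R .
    have "poly s z = poly r z - of_real \<epsilon> * poly g z" by (simp add: s_def)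
    also have "poly g z = poly r z - poly d z * poly e z"
    proof -
      have "poly r z = poly d z * poly e z + poly g z" by (subst rdeg) simp
      then show ?thesis by simp
    qed
    also have "poly r z - of_real \<epsilon> * (poly r z - poly d z * poly e z) = of_real (1 - \<epsilon>) * poly r z + of_real \<epsilon> * (poly d z * poly e z)"
      by (simp add: algebra_simps)
    also have "cmod \<dots> \<le> (1 - \<epsilon>) * cmod (poly r z) + \<epsilon> * (cmod (poly d z) * cmod (poly e z))"
      by (rule order_trans[OF norm_triangle_ineq]) (use e0 in \<open>simp only: norm_mult norm_of_real abs_of_nonneg diff_ge_0_iff_ge less_imp_le\<close>)
    also have "\<dots> \<le> (1 - \<epsilon>) * cmod (poly r z) + \<epsilon> * (cmod (poly d z) * C)"
      using e0 C[OF z] by (intro add_left_mono mult_left_mono) auto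
    also have "\<dots> \<le> m - \<epsilon> * m / 2"
      by (rule real_perturbation_bound[OF m _ sq _ C0 \<epsilon>_def]) auto
    finally show "cmod (poly s z) \<le> m - \<epsilon> * m / 2" .
  qed
  finally show False using mult_pos_pos[OF e0(1) m] by linarith
qed

lemma chebyshev_poly_spec:
  assumes "compact E" "infinite E"
  shows "monic_of_degree n (chebyshev_poly E n)"
    and "monic_of_degree n q \<Longrightarrow> supnorm_on E (poly (chebyshev_poly E n)) \<le> supnorm_on E (poly q)"
proof -
  obtain p where p: "monic_of_degree n p" "\<And>q. monic_of_degree n q \<Longrightarrow> supnorm_on E (poly p) \<le> supnorm_on E (poly q)"
    using chebyshev_minimizer_exists[OF assms] by blast
  have "\<exists>!p. monic_of_degree n p \<and> (\<forall>q. monic_of_degree n q \<longrightarrow> supnorm_on E (poly p) \<le> supnorm_on E (poly q))"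
  proof (rule ex1I[of _ p])
    fix q assume q: "monic_of_degree n q \<and> (\<forall>r. monic_of_degree n r \<longrightarrow> supnorm_on E (poly q) \<le> supnorm_on E (poly r))"
    show "q = p" by (rule chebyshev_minimizer_unique[OF assms]) (use p q in auto)
  qed (use p in auto)
  from theI'[OF this] show "monic_of_degree n (chebyshev_poly E n)"
    and "monic_of_degree n q \<Longrightarrow> supnorm_on E (poly (chebyshev_poly E n)) \<le> supnorm_on E (poly q)"
    unfolding chebyshev_poly_def by auto
qed

text \<open>
  Moving a zero outside the convex hull to its nearest point in the hull brings it closer to
  every point of \<open>E\<close>.
\<close>

lemma chebyshev_zeros_in_convex_hull:
  assumes E: "compact E" "infinite E" and w: "poly (chebyshev_poly E n) w = 0"
  shows "w \<in> convex hull E"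
proof (rule ccontr)
  assume nH: "w \<notin> convex hull E"
  have Ene: "E \<noteq> {}" using E by auto
  let ?H = "convex hull E"
  have H: "convex ?H" "closed ?H" using E by (auto simp: compact_convex_hull compact_imp_closed)
  define p where "p = chebyshev_poly E n"
  have pm: "degree p = n" "lead_coeff p = 1" using chebyshev_poly_spec(1)[OF E, of n] by (auto simp: p_def monic_of_degree_def)
  obtain r where r: "p = [:-w, 1:] * r" using w unfolding p_def poly_eq_0_iff_dvd by (elim dvdE)
  have "r \<noteq> 0" using pm r by auto
  define w' where "w' = closest_point ?H w"
  define q where "q = [:-w', 1:] * r"
  have "degree q = degree p" unfolding q_def r using \<open>r \<noteq> 0\<close> by (simp add: degree_mult_eq del: mult_pCons_left)
  moreover have "lead_coeff q = lead_coeff p" unfolding q_def r by (simp only: lead_coeff_mult) simp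
  ultimately have qm: "monic_of_degree n q" using pm by (simp add: monic_of_degree_def)
  then have "q \<noteq> 0" by (auto simp: monic_of_degree_def)
  obtain z where z: "z \<in> E" "supnorm_on E (poly q) = cmod (poly q z)" by (rule supnorm_poly_attained[OF E(1) Ene])
  have "cmod (poly q z) > 0" using supnorm_poly_pos[OF E \<open>q \<noteq> 0\<close>] z by simp
  then have rz: "cmod (poly r z) > 0" by (auto simp: q_def)
  have "cmod (z - w') < cmod (z - w)" unfolding w'_def by (rule closest_point_closer[OF H _ nH]) (rule hull_inc[OF z(1)])
  then have "cmod (z - w') * cmod (poly r z) < cmod (z - w) * cmod (poly r z)" using rz by (rule mult_strict_right_mono)
  then have "cmod (poly q z) < cmod (poly p z)" by (simp add: q_def r norm_mult flip: distrib_right left_diff_distrib)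
  also have "\<dots> \<le> supnorm_on E (poly p)" by (rule supnorm_poly_upper[OF E(1) z(1)])
  also have "\<dots> \<le> supnorm_on E (poly q)" unfolding p_def by (rule chebyshev_poly_spec(2)[OF E qm])
  finally show False using z(2) by simp
qed

section \<open>Fekete points\<close>

definition distance_product :: "nat \<Rightarrow> (nat \<Rightarrow> complex) \<Rightarrow> real" where
  "distance_product n x = (\<Prod>i\<le>n. \<Prod>j\<in>{..n} - {i}. cmod (x i - x j))"

text \<open>
  The second factor does not involve \<open>x i\<close>.
\<close>

lemma distance_product_split:
  assumes "i \<le> n"
  shows "distance_product n x = (\<Prod>j\<in>{..n} - {i}. cmod (x i - x j))\<^sup>2 * (\<Prod>k\<in>{..n} - {i}. \<Prod>j\<in>{..n} - {k} - {i}. cmod (x k - x j))"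
proof -
  have inner: "(\<Prod>j\<in>{..n} - {k}. cmod (x k - x j)) = cmod (x i - x k) * (\<Prod>j\<in>{..n} - {k} - {i}. cmod (x k - x j))" if "k \<in> {..n} - {i}" for k
    using that assms by (subst prod.remove[of _ i]) (auto simp: norm_minus_commute)
  have "distance_product n x = (\<Prod>j\<in>{..n} - {i}. cmod (x i - x j)) * (\<Prod>k\<in>{..n} - {i}. \<Prod>j\<in>{..n} - {k}. cmod (x k - x j))"
    unfolding distance_product_def using assms by (subst prod.remove[of _ i]) auto
  also have "(\<Prod>k\<in>{..n} - {i}. \<Prod>j\<in>{..n} - {k}. cmod (x k - x j)) = (\<Prod>k\<in>{..n} - {i}. cmod (x i - x k) * (\<Prod>j\<in>{..n} - {k} - {i}. cmod (x k - x j)))"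
    by (rule prod.cong) (use inner in auto)
  finally show ?thesis by (simp add: prod.distrib power2_eq_square)
qed

text \<open>
  The points maximize the product of the mutual distances; hence no single point \<open>x i\<close> can be
  moved so as to increase the product of its distances to the others.
\<close>

lemma fekete_points_exist:
  fixes n :: nat
  assumes E: "compact E" "infinite E"
  obtains x where "\<And>i. x i \<in> E" "inj_on x {..n}"
    "\<And>i z. i \<le> n \<Longrightarrow> z \<in> E \<Longrightarrow> (\<Prod>j\<in>{..n} - {i}. cmod (z - x j)) \<le> (\<Prod>j\<in>{..n} - {i}. cmod (x i - x j))"
proof -
  define X where "X = {x :: nat \<Rightarrow> complex. \<forall>i. x i \<in> E}"
  have cX: "compact X" unfolding X_def by (rule compact_function_space[OF E(1)])
  obtain y :: "nat \<Rightarrow> complex" where y: "inj y" "range y \<subseteq> E" using infinite_countable_subset[OF E(2)] by blast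
  have yX: "y \<in> X" using y by (auto simp: X_def)
  have cont: "continuous_on X (distance_product n)"
    unfolding distance_product_def[abs_def]
    by (intro continuous_intros continuous_on_product_coordinates[THEN continuous_on_subset]) auto
  obtain x where x: "x \<in> X" "\<And>x'. x' \<in> X \<Longrightarrow> distance_product n x' \<le> distance_product n x"
    using continuous_attains_sup[OF cX _ cont] yX by blast
  have pos: "distance_product n x > 0"
  proof -
    have "0 < distance_product n y" unfolding distance_product_def
      using y(1) by (intro prod_pos ballI) (auto simp: inj_def)
    then show ?thesis using x(2)[OF yX] by linarith
  qed
  have ne: "x i \<noteq> x j" if "i \<le> n" "j \<le> n" "i \<noteq> j" for i j
  proof
    assume "x i = x j"
    then have z: "(\<Prod>j\<in>{..n} - {i}. cmod (x i - x j)) = 0" using that by (intro prod_zero) auto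
    have "distance_product n x = 0" unfolding distance_product_split[OF that(1), of x] z by simp
    with pos show False by simp
  qed
  have ext: "(\<Prod>j\<in>{..n} - {i}. cmod (z - x j)) \<le> (\<Prod>j\<in>{..n} - {i}. cmod (x i - x j))" if i: "i \<le> n" and z: "z \<in> E" for i z
  proof -
    define R where "R = (\<Prod>k\<in>{..n} - {i}. \<Prod>j\<in>{..n} - {k} - {i}. cmod (x k - x j))"
    let ?P = "\<lambda>z. \<Prod>j\<in>{..n} - {i}. cmod (z - x j)"
    have R: "R > 0" unfolding R_def using ne by (intro prod_pos ballI) auto
    have "x(i := z) \<in> X" using x(1) z by (auto simp: X_def)
    then have "distance_product n (x(i := z)) \<le> distance_product n x" by (rule x(2))
    moreover have "distance_product n (x(i := z)) = (?P z)\<^sup>2 * R"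
      unfolding distance_product_split[OF i] R_def by (intro arg_cong2[where f="(*)"] arg_cong[where f="\<lambda>t. t\<^sup>2"] prod.cong) auto
    moreover have "distance_product n x = (?P (x i))\<^sup>2 * R" unfolding distance_product_split[OF i] R_def ..
    ultimately have "(?P z)\<^sup>2 \<le> (?P (x i))\<^sup>2" using R by simp
    then show ?thesis by (rule power2_le_imp_le) (auto intro: prod_nonneg)
  qed
  show ?thesis
  proof (rule that[OF _ _ ext])
    show "x i \<in> E" for i using x(1) by (simp add: X_def)
    show "inj_on x {..n}" using ne by (auto simp: inj_on_def)
  qed
qed

text \<open>
  For each \<open>i\<close> the monic polynomial with zeros \<open>x j\<close>, \<open>j \<noteq> i\<close>, attains its maximal modulus on \<open>E\<close> at
  \<open>x i\<close>, and this maximum is at least the norm of \<open>T\<^sub>n\<close>.  The logarithms of these maxima add up to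
  minus the discrete energy of the points; the diagonal terms of the truncated energy give
  the summand \<open>ln (D / \<delta>)\<close>.
\<close>

lemma fekete_measure:
  assumes E: "compact E" "infinite E" and D: "D > 0" and ED: "\<And>z w. z \<in> E \<Longrightarrow> w \<in> E \<Longrightarrow> cmod (z - w) \<le> D"
  obtains \<nu> where "prob_on E \<nu>"
    "\<And>\<delta>. \<delta> > 0 \<Longrightarrow> (LINT z|\<nu>. LINT w|\<nu>. trunc_kernel D \<delta> z w) \<le>
       (real n * ln D - ln (supnorm_on E (poly (chebyshev_poly E n))) + ln (D / \<delta>)) / (real n + 1)"
proof -
  obtain x where x: "\<And>i. x i \<in> E" "inj_on x {..n}"
    "\<And>i z. i \<le> n \<Longrightarrow> z \<in> E \<Longrightarrow> (\<Prod>j\<in>{..n} - {i}. cmod (z - x j)) \<le> (\<Prod>j\<in>{..n} - {i}. cmod (x i - x j))"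
    using fekete_points_exist[OF E, of n] by blast
  define T where "T = supnorm_on E (poly (chebyshev_poly E n))"
  have T: "T > 0" unfolding T_def
  proof (rule supnorm_poly_pos[OF E])
    show "chebyshev_poly E n \<noteq> 0" using chebyshev_poly_spec(1)[OF E, of n] by (auto simp: monic_of_degree_def)
  qed
  have ne: "x i \<noteq> x j" if "i \<le> n" "j \<in> {..n} - {i}" for i j using x(2) that by (auto simp: inj_on_def)
  have Ti: "ln T \<le> (\<Sum>j\<in>{..n} - {i}. ln (cmod (x i - x j)))" if i: "i \<le> n" for i
  proof -
    have "monic_of_degree n (prod_poly ({..n} - {i}) x)" using monic_prod_poly[of "{..n} - {i}" x] i by simp
    then have "T \<le> supnorm_on E (poly (prod_poly ({..n} - {i}) x))" unfolding T_def by (rule chebyshev_poly_spec(2)[OF E])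
    also have "\<dots> \<le> (\<Prod>j\<in>{..n} - {i}. cmod (x i - x j))"
    proof (rule supnorm_poly_least)
      show "E \<noteq> {}" using E by auto
      fix z assume "z \<in> E"
      then show "cmod (poly (prod_poly ({..n} - {i}) x) z) \<le> (\<Prod>j\<in>{..n} - {i}. cmod (x i - x j))"
        unfolding poly_prod_poly prod_norm[symmetric] by (rule x(3)[OF i])
    qed
    finally have "ln T \<le> ln (\<Prod>j\<in>{..n} - {i}. cmod (x i - x j))" using T by (intro ln_mono)
    also have "\<dots> = (\<Sum>j\<in>{..n} - {i}. ln (cmod (x i - x j)))" by (rule ln_prod) (use ne[OF i] in auto)
    finally show ?thesis .
  qed
  define \<nu> where "\<nu> = distr (measure_pmf (pmf_of_set {..n})) borel x"
  have s: "sets \<nu> = sets borel" by (simp add: \<nu>_def)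
  have p: "prob_space \<nu>" unfolding \<nu>_def by (rule prob_space.prob_space_distr[OF prob_space_measure_pmf]) auto
  have "emeasure \<nu> (- E) = emeasure (measure_pmf (pmf_of_set {..n})) (x -` (- E))"
    unfolding \<nu>_def using borel_compact[OF E(1)] by (subst emeasure_distr) auto
  also have "x -` (- E) = {}" using x(1) by auto
  finally have pE: "prob_on E \<nu>" using s p by (simp add: prob_on_def)
  have int: "(LINT z|\<nu>. f z) = (\<Sum>i\<le>n. f (x i)) / (real n + 1)" if "f \<in> borel_measurable borel" for f :: "complex \<Rightarrow> real"
  proof -
    have "(LINT z|\<nu>. f z) = measure_pmf.expectation (pmf_of_set {..n}) (\<lambda>i. f (x i))"
      unfolding \<nu>_def by (rule integral_distr) (use that in auto)
    also have "\<dots> = (\<Sum>i\<le>n. f (x i)) / (real n + 1)" by (subst integral_pmf_of_set) (auto simp: add.commute)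
    finally show ?thesis .
  qed
  show thesis
  proof (rule that[OF pE])
    fix \<delta> :: real assume \<delta>: "\<delta> > 0"
    let ?t = "trunc_kernel D \<delta>"
    have m1: "?t z \<in> borel_measurable borel" for z by (rule borel_measurable_continuous_onI[OF continuous_trunc_kernel[OF D \<delta>]])
    have "(LINT z|\<nu>. LINT w|\<nu>. ?t z w) = (LINT z|\<nu>. (\<Sum>j\<le>n. ?t z (x j)) / (real n + 1))"
      by (simp only: int[OF m1])
    also have "\<dots> = (\<Sum>i\<le>n. (\<Sum>j\<le>n. ?t (x i) (x j)) / (real n + 1)) / (real n + 1)"
    proof (rule int)
      have "(\<lambda>z. ?t (x j) z) \<in> borel_measurable borel" for j by (rule m1)
      then have "(\<lambda>z. ?t z (x j)) \<in> borel_measurable borel" for j by (simp only: trunc_kernel_commute)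
      then show "(\<lambda>z. (\<Sum>j\<le>n. ?t z (x j)) / (real n + 1)) \<in> borel_measurable borel" by measurable
    qed
    also have "\<dots> \<le> (\<Sum>i\<le>n. (real n * ln D - ln T + ln (D / \<delta>)) / (real n + 1)) / (real n + 1)"
    proof (intro divide_right_mono sum_mono)
      fix i assume "i \<in> {..n}"
      then have i: "i \<le> n" by simp
      have "(\<Sum>j\<le>n. ?t (x i) (x j)) = ?t (x i) (x i) + (\<Sum>j\<in>{..n} - {i}. ?t (x i) (x j))"
        using i by (subst sum.remove[of _ i]) auto
      also have "?t (x i) (x i) = ln (D / \<delta>)" using \<delta> by (simp add: trunc_kernel_def)
      also have "(\<Sum>j\<in>{..n} - {i}. ?t (x i) (x j)) \<le> (\<Sum>j\<in>{..n} - {i}. ln D - ln (cmod (x i - x j)))"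
      proof (rule sum_mono)
        fix j assume "j \<in> {..n} - {i}"
        then have c: "cmod (x i - x j) > 0" using ne[OF i] by auto
        have "?t (x i) (x j) \<le> ln (D / cmod (x i - x j))" unfolding trunc_kernel_def
          by (rule ln_mono) (use c D in \<open>auto intro!: divide_left_mono divide_pos_pos simp: less_max_iff_disj\<close>)
        then show "?t (x i) (x j) \<le> ln D - ln (cmod (x i - x j))" using c D by (simp add: ln_div)
      qed
      also have "\<dots> = real n * ln D - (\<Sum>j\<in>{..n} - {i}. ln (cmod (x i - x j)))" using i by (simp add: sum_subtractf)
      also have "\<dots> \<le> real n * ln D - ln T" using Ti[OF i] by simp
      finally show "(\<Sum>j\<le>n. ?t (x i) (x j)) \<le> real n * ln D - ln T + ln (D / \<delta>)" by simp
    qed auto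
    also have "\<dots> = (real n * ln D - ln T + ln (D / \<delta>)) / (real n + 1)" by (simp add: add.commute)
    finally show "(LINT z|\<nu>. LINT w|\<nu>. ?t z w) \<le> (real n * ln D - ln (supnorm_on E (poly (chebyshev_poly E n))) + ln (D / \<delta>)) / (real n + 1)"
      unfolding T_def .
  qed
qed

context energy_minimizer
begin

lemma dist_E_le: "z \<in> E \<Longrightarrow> w \<in> E \<Longrightarrow> cmod (z - w) \<le> D"
  by (rule dist_support_le) (use E_ball D_pos in force)+

text \<open>
  Two points of \<open>E\<close> have distance at most \<open>D / 2\<close>, so the kernel is at least \<open>ln 2\<close> on \<open>E\<close>.
\<close>

lemma a_pos: "a > 0"
proof -
  interpret M: prob_space \<mu> using \<mu>_E by (simp add: prob_on_def)
  have le: "ennreal (ln 2) \<le> shifted_kernel D z w" if "z \<in> E" "w \<in> E" for z w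
  proof (cases "z = w")
    case False
    have "cmod z \<le> D/4" "cmod w \<le> D/4" using that E_ball by auto
    then have "cmod (z - w) \<le> D/2" using norm_triangle_ineq4[of z w] by linarith
    then have "ln 2 \<le> ln (D / cmod (z - w))" using False D_pos by (intro ln_mono) (auto simp: le_divide_eq)
    then show ?thesis using False by (simp add: shifted_kernel_def ennreal_leI)
  qed (simp add: shifted_kernel_def)
  have "ennreal (ln 2) = (\<integral>\<^sup>+z. \<integral>\<^sup>+w. ennreal (ln 2) \<partial>\<mu> \<partial>\<mu>)" by (simp add: M.emeasure_space_1)
  also have "\<dots> \<le> mutual_energy D \<mu> \<mu>" unfolding mutual_energy_def
  proof (rule nn_integral_mono_AE)
    show "AE z in \<mu>. (\<integral>\<^sup>+w. ennreal (ln 2) \<partial>\<mu>) \<le> (\<integral>\<^sup>+w. shifted_kernel D z w \<partial>\<mu>)"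
      using prob_on_AE[OF \<mu>_E E_borel]
    proof eventually_elim
      case (elim z)
      show ?case
      proof (rule nn_integral_mono_AE)
        show "AE w in \<mu>. ennreal (ln 2) \<le> shifted_kernel D z w"
          using prob_on_AE[OF \<mu>_E E_borel] by eventually_elim (use le elim in auto)
      qed
    qed
  qed
  finally have "ennreal (ln 2) \<le> ennreal a" by (simp only: energy_eq_a)
  then have "ln 2 \<le> a" using a_nonneg by (simp add: ennreal_le_iff)
  then show ?thesis using ln_gt_zero[of "2::real"] by linarith
qed

lemma infinite_E: "infinite E"
proof
  assume fin: "finite E"
  interpret M: prob_space \<mu> using \<mu>_E by (simp add: prob_on_def)
  have "AE w in \<mu>. w \<noteq> z" if "z \<in> support \<mu>" for z
  proof -
    have zE: "z \<in> E" using that support_subset_E by auto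
    have "cmod z \<le> D/2" using zE E_ball D_pos by force
    moreover have "U z < \<infinity>" using U_le_on_support[OF that] by (simp add: le_less_trans)
    ultimately show ?thesis by (rule U_finite_imp(1))
  qed
  moreover have "finite (support \<mu>)" using fin support_subset_E finite_subset by blast
  ultimately have "AE w in \<mu>. \<forall>z\<in>support \<mu>. w \<noteq> z" by (subst AE_ball_countable) (auto intro: countable_finite)
  with AE_in_support have "AE w in \<mu>. False" by eventually_elim auto
  then show False by simp
qed

text \<open>
  Otherwise the truncated energies of the Fekete measures are at most \<open>a - e'\<close> in the limit along a
  subsequence, and a weak limit of these measures has smaller energy than \<open>\<mu>\<close>.
\<close>

lemma chebyshev_norm_upper:
  assumes e: "e > 0"
  shows "\<forall>\<^sub>F n in sequentially. ln (supnorm_on E (poly (chebyshev_poly E n))) \<le> real n * (ln D - a + e)"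
proof (rule ccontr)
  let ?T = "\<lambda>n. supnorm_on E (poly (chebyshev_poly E n))"
  assume "\<not> ?thesis"
  then have fr: "\<exists>\<^sub>F n in sequentially. real n * (ln D - a + e) < ln (?T n)"
    by (simp add: not_eventually not_le)
  then have "infinite {n. real n * (ln D - a + e) < ln (?T n)}" by (simp add: frequently_cofinite cofinite_eq_sequentially[symmetric])
  then obtain s :: "nat \<Rightarrow> nat" where s: "strict_mono s" "\<And>k. s k \<in> {n. real n * (ln D - a + e) < ln (?T n)}"
    using infinite_enumerate by blast
  \<comment> \<open>Extended nonnegative reals truncate at 0, so the energy bound \<open>a - e'\<close> has to stay positive.\<close>
  define e' where "e' = min e (a / 2)"
  have e': "e' > 0" "e' \<le> e" "a - e' > 0" using e a_pos by (auto simp: e'_def min_def)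
  have "\<exists>\<nu>. prob_on E \<nu> \<and> (\<forall>\<delta>>0. (LINT z|\<nu>. LINT w|\<nu>. trunc_kernel D \<delta> z w) \<le>
       (real n * ln D - ln (?T n) + ln (D / \<delta>)) / (real n + 1))" for n
  proof (rule fekete_measure[OF compact_E infinite_E D_pos dist_E_le])
    fix \<nu> assume "prob_on E \<nu>" "\<And>\<delta>. \<delta> > 0 \<Longrightarrow> (LINT z|\<nu>. LINT w|\<nu>. trunc_kernel D \<delta> z w) \<le>
       (real n * ln D - ln (?T n) + ln (D / \<delta>)) / (real n + 1)"
    then show ?thesis by blast
  qed
  then obtain \<nu> where \<nu>: "\<And>n. prob_on E (\<nu> n)"
    "\<And>n \<delta>. \<delta> > 0 \<Longrightarrow> (LINT z|\<nu> n. LINT w|\<nu> n. trunc_kernel D \<delta> z w) \<le> (real n * ln D - ln (?T n) + ln (D / \<delta>)) / (real n + 1)"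
    by metis
  obtain \<nu>' where \<nu>': "prob_on E \<nu>'" "mutual_energy D \<nu>' \<nu>' \<le> ennreal (a - e')"
  proof (rule energy_lower_semicontinuous[OF compact_E D_pos dist_E_le, of "\<lambda>k. \<nu> (s k)" "a - e'"])
    show "prob_on E (\<nu> (s k))" for k by (rule \<nu>(1))
    fix \<delta> \<eta> :: real assume \<delta>: "\<delta> > 0" "\<delta> \<le> D" and \<eta>: "\<eta> > 0"
    define M where "M = ln (D / \<delta>)"
    have M: "M \<ge> 0" unfolding M_def using \<delta> by (intro ln_ge_zero) (simp add: le_divide_eq)
    have bound: "(LINT z|\<nu> (s k). LINT w|\<nu> (s k). trunc_kernel D \<delta> z w) \<le> (a - e') + M / (real k + 1)" for k
    proof -
      let ?n = "s k"
      have kn: "k \<le> ?n" by (rule strict_mono_imp_increasing[OF s(1)])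
      have "(LINT z|\<nu> ?n. LINT w|\<nu> ?n. trunc_kernel D \<delta> z w) \<le> (real ?n * ln D - ln (?T ?n) + M) / (real ?n + 1)"
        unfolding M_def by (rule \<nu>(2)[OF \<delta>(1)])
      also have "\<dots> \<le> (real ?n * (a - e') + M) / (real ?n + 1)"
      proof (intro divide_right_mono add_right_mono)
        have "real ?n * (ln D - a + e) < ln (?T ?n)" using s(2)[of k] by simp
        moreover have "real ?n * (ln D - a + e') \<le> real ?n * (ln D - a + e)" using e' by (intro mult_left_mono) auto
        ultimately have "real ?n * (ln D - a + e') \<le> ln (?T ?n)" by linarith
        then show "real ?n * ln D - ln (?T ?n) \<le> real ?n * (a - e')" by (simp add: algebra_simps)
      qed auto
      also have "\<dots> = real ?n * (a - e') / (real ?n + 1) + M / (real ?n + 1)" by (simp add: add_divide_distrib)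
      also have "\<dots> \<le> (a - e') + M / (real k + 1)"
      proof (rule add_mono)
        have "real ?n * (a - e') \<le> (a - e') * (real ?n + 1)" using e' by (simp add: distrib_left mult.commute)
        then show "real ?n * (a - e') / (real ?n + 1) \<le> a - e'" by (subst pos_divide_le_eq) auto
        show "M / (real ?n + 1) \<le> M / (real k + 1)" using M kn by (intro divide_left_mono) auto
      qed
      finally show ?thesis .
    qed
    have "(\<lambda>k. M / (real k + 1)) \<longlonglongrightarrow> 0"
      using tendsto_mult[OF tendsto_const[of M] LIMSEQ_inverse_real_of_nat] by (simp add: divide_inverse add.commute)
    then have "\<forall>\<^sub>F k in sequentially. M / (real k + 1) < \<eta>" using \<eta> by (intro order_tendstoD(2))
    then show "\<forall>\<^sub>F k in sequentially. (LINT z|\<nu> (s k). LINT w|\<nu> (s k). trunc_kernel D \<delta> z w) \<le> a - e' + \<eta>"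
    proof eventually_elim
      case (elim k)
      then show ?case using bound[of k] by linarith
    qed
  qed
  have "ennreal a \<le> ennreal (a - e')" using minimal[OF \<nu>'(1)] \<nu>'(2) unfolding energy_eq_a by (rule order_trans)
  then show False using e' by (simp add: ennreal_le_iff)
qed

end

section \<open>Potentials of zero counting measures\<close>

lemma sum_mset_count:
  fixes f :: "'a \<Rightarrow> real"
  assumes "finite S" "set_mset A \<subseteq> S"
  shows "(\<Sum>x\<in>S. f x * real (count A x)) = (\<Sum>x\<in>#A. f x)"
  using assms(2)
proof (induction A)
  case (add y A)
  have "(\<Sum>x\<in>S. f x * real (count (add_mset y A) x)) = (\<Sum>x\<in>S. f x * real (count A x) + (if x = y then f x else 0))"
    by (intro sum.cong) (auto simp: algebra_simps)
  also have "\<dots> = (\<Sum>x\<in>S. f x * real (count A x)) + f y" using add.prems assms(1) by (simp add: sum.distrib)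
  finally show ?case using add by simp
qed simp

lemma zero_counting_measure_integral:
  fixes f :: "complex \<Rightarrow> real"
  assumes "degree p > 0" "f \<in> borel_measurable borel"
  shows "(LINT z|zero_counting_measure p. f z) = (\<Sum>w\<in>#proots p. f w) / real (degree p)"
proof -
  have ne: "proots p \<noteq> {#}" using assms(1) size_proots_complex[of p] by auto
  have "(LINT z|zero_counting_measure p. f z) = measure_pmf.expectation (pmf_of_multiset (proots p)) f"
    unfolding zero_counting_measure_def by (rule integral_distr) (use assms in auto)
  also have "\<dots> = (\<Sum>a\<in>set_mset (proots p). f a * pmf (pmf_of_multiset (proots p)) a)"
    by (rule integral_measure_pmf_real) (use ne in auto)
  also have "\<dots> = (\<Sum>a\<in>set_mset (proots p). f a * real (count (proots p) a)) / real (degree p)"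
    using ne by (simp add: size_proots_complex sum_divide_distrib del: count_proots set_count_proots)
  also have "(\<Sum>a\<in>set_mset (proots p). f a * real (count (proots p) a)) = (\<Sum>w\<in>#proots p. f w)"
    by (rule sum_mset_count) auto
  finally show ?thesis .
qed

lemma prob_on_zero_counting_measure:
  assumes "degree p > 0" "\<And>w. poly p w = 0 \<Longrightarrow> w \<in> K" "K \<in> sets borel"
  shows "prob_on K (zero_counting_measure p)"
proof -
  have ne: "proots p \<noteq> {#}" using assms(1) size_proots_complex[of p] by auto
  have pn: "p \<noteq> 0" using assms(1) by auto
  have "emeasure (zero_counting_measure p) (- K) = emeasure (measure_pmf (pmf_of_multiset (proots p))) (- K)"
    unfolding zero_counting_measure_def using assms(3) by (subst emeasure_distr) auto
  also have "\<dots> = 0"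
    using ne pn assms(2) by (auto simp: measure_pmf.emeasure_eq_measure measure_pmf_zero_iff)
  finally show ?thesis unfolding prob_on_def
    by (auto simp: zero_counting_measure_def intro: prob_space.prob_space_distr prob_space_measure_pmf)
qed

lemma borel_measurable_log_pot:
  assumes "prob_on K \<nu>"
  shows "log_pot \<nu> \<in> borel_measurable borel"
proof -
  interpret prob_space \<nu> using assms by (simp add: prob_on_def)
  have [measurable_cong]: "sets \<nu> = sets borel" using assms by (simp add: prob_on_def)
  show ?thesis unfolding log_pot_def[abs_def] by measurable
qed

lemma integrable_log_pot_on:
  assumes "prob_on (cball 0 \<rho>) \<nu>" "S \<in> sets borel" "bounded S"
  shows "integrable lborel (\<lambda>z. indicator S z * log_pot \<nu> z)"
proof -
  obtain R where R: "\<forall>z\<in>S. cmod z \<le> R" using assms(3) by (auto simp: bounded_iff)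
  have m: "(indicator S :: complex \<Rightarrow> real) \<in> borel_measurable borel" using assms(2) by (rule borel_measurable_indicator)
  show ?thesis
  proof (rule log_pot_Fubini(1)[OF assms(1) m, of 1 "R + 1"])
    fix z assume "R + 1 \<le> cmod z"
    then show "indicator S z = (0::real)" using R by (cases "z \<in> S") force+
  qed (auto simp: indicator_def)
qed

lemma log_pot_integral_swap:
  assumes "prob_on (cball 0 \<rho>) \<nu>" "S \<in> sets borel" "bounded S"
  shows "(LINT z|lborel. indicator S z * log_pot \<nu> z) = (LINT w|\<nu>. LINT z|lborel. indicator S z * ln (cmod (z - w)))"
    and "integrable \<nu> (\<lambda>w. LINT z|lborel. indicator S z * ln (cmod (z - w)))"
proof -
  obtain R where R: "\<forall>z\<in>S. cmod z \<le> R" using assms(3) by (auto simp: bounded_iff)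
  have m: "(indicator S :: complex \<Rightarrow> real) \<in> borel_measurable borel" using assms(2) by (rule borel_measurable_indicator)
  have z: "indicator S z = (0::real)" if "R + 1 \<le> cmod z" for z
    using R that by (cases "z \<in> S") force+
  show "(LINT z|lborel. indicator S z * log_pot \<nu> z) = (LINT w|\<nu>. LINT z|lborel. indicator S z * ln (cmod (z - w)))"
    by (rule log_pot_Fubini(2)[OF assms(1) m, of 1 "R + 1"]) (use z in \<open>auto simp: indicator_def\<close>)
  show "integrable \<nu> (\<lambda>w. LINT z|lborel. indicator S z * ln (cmod (z - w)))"
    by (rule log_pot_Fubini(4)[OF assms(1) m, of 1 "R + 1"]) (use z in \<open>auto simp: indicator_def\<close>)
qed

lemma log_pot_annulus:
  assumes \<nu>: "prob_on (cball 0 s) \<nu>" and s: "s > 0"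
  shows "(LINT z|lborel. indicator (ball 0 r - cball 0 s) z * log_pot \<nu> z) = (LINT z|lborel. indicator (ball 0 r - cball 0 s) z * ln (cmod z))"
proof -
  interpret prob_space \<nu> using \<nu> by (simp add: prob_on_def)
  let ?S = "ball 0 r - cball 0 s :: complex set"
  have b: "bounded ?S" by (rule bounded_subset[OF bounded_ball[of 0 r]]) auto
  have "(LINT z|lborel. indicator ?S z * log_pot \<nu> z) = (LINT w|\<nu>. LINT z|lborel. indicator ?S z * ln (cmod (z - w)))"
    by (rule log_pot_integral_swap(1)[OF \<nu> _ b]) simp
  also have "\<dots> = (LINT w|\<nu>. LINT z|lborel. indicator ?S z * ln (cmod z))"
  proof (rule integral_cong_AE)
    show "(\<lambda>w. LINT z|lborel. indicator ?S z * ln (cmod (z - w))) \<in> borel_measurable \<nu>"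
      by (rule borel_measurable_integrable, rule log_pot_integral_swap(2)[OF \<nu> _ b]) simp
    show "AE w in \<nu>. (LINT z|lborel. indicator ?S z * ln (cmod (z - w))) = (LINT z|lborel. indicator ?S z * ln (cmod z))"
      using prob_on_AE[OF \<nu> borel_closed[OF closed_cball]] by eventually_elim (rule annulus_mean_log[OF s], simp)
  qed simp
  also have "\<dots> = (LINT z|lborel. indicator ?S z * ln (cmod z))" by (simp add: prob_space)
  finally show ?thesis .
qed

text \<open>
  Fubini is applied with the bounded function \<open>sgn (log_pot \<nu> z)\<close> in place of the absolute value.
\<close>

lemma log_pot_abs_small:
  assumes \<nu>: "prob_on (cball 0 R) \<nu>"
    and G: "G \<in> sets borel" "bounded G" and small: "\<And>w. cmod w \<le> R \<Longrightarrow> (LINT z|lborel. indicator G z * \<bar>ln (cmod (z - w))\<bar>) \<le> e"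
  shows "(LINT z|lborel. indicator G z * \<bar>log_pot \<nu> z\<bar>) \<le> e"
proof -
  interpret prob_space \<nu> using \<nu> by (simp add: prob_on_def)
  note [measurable] = borel_measurable_log_pot[OF \<nu>] G(1)
  obtain R' where R': "\<forall>z\<in>G. cmod z \<le> R'" using G(2) by (auto simp: bounded_iff)
  define g where "g = (\<lambda>z. indicator G z * sgn (log_pot \<nu> z))"
  have gm: "g \<in> borel_measurable borel" unfolding g_def by measurable
  have gb: "\<bar>g z\<bar> \<le> 1" for z by (simp add: g_def abs_mult indicator_def abs_sgn_eq)
  have gR: "g z = 0" if "R' + 1 \<le> cmod z" for z using R' that by (cases "z \<in> G") (force simp: g_def)+
  have iG: "integrable lborel (\<lambda>z. indicator G z * \<bar>ln (cmod (z - w))\<bar>)" for w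
  proof -
    have "integrable lborel (\<lambda>z. indicator G z * ln (cmod (z - w)))"
    proof (rule integrable_log_bounded[where B=1 and R="R' + 1"])
      show "indicator G z = (0::real)" if "R' + 1 \<le> cmod z" for z using R' that by (cases "z \<in> G") force+
    qed (auto simp: indicator_def)
    from integrable_abs[OF this] show ?thesis by (simp add: abs_mult)
  qed
  have "(LINT z|lborel. indicator G z * \<bar>log_pot \<nu> z\<bar>) = (LINT z|lborel. g z * log_pot \<nu> z)"
    by (intro Bochner_Integration.integral_cong) (auto simp: g_def mult.assoc linordered_idom_class.abs_sgn mult.commute)
  also have "\<dots> = (LINT w|\<nu>. LINT z|lborel. g z * ln (cmod (z - w)))"
    by (rule log_pot_Fubini(2)[OF \<nu> gm, of 1 "R' + 1"]) (use gb gR in auto)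
  also have "\<dots> \<le> (LINT w|\<nu>. e)"
  proof (rule integral_mono_AE)
    show "integrable \<nu> (\<lambda>w. LINT z|lborel. g z * ln (cmod (z - w)))"
      by (rule log_pot_Fubini(4)[OF \<nu> gm, of 1 "R' + 1"]) (use gb gR in auto)
    show "AE w in \<nu>. (LINT z|lborel. g z * ln (cmod (z - w))) \<le> e"
      using prob_on_AE[OF \<nu> borel_closed[OF closed_cball]]
    proof eventually_elim
      case (elim w)
      have "(LINT z|lborel. g z * ln (cmod (z - w))) \<le> (LINT z|lborel. indicator G z * \<bar>ln (cmod (z - w))\<bar>)"
      proof (rule integral_mono)
        show "integrable lborel (\<lambda>z. g z * ln (cmod (z - w)))"
          by (rule integrable_log_bounded[OF gm, of 1 "R' + 1"]) (use gb gR in auto)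
        fix z
        have "sgn (log_pot \<nu> z) * ln (cmod (z - w)) \<le> \<bar>sgn (log_pot \<nu> z) * ln (cmod (z - w))\<bar>" by simp
        also have "\<dots> \<le> 1 * \<bar>ln (cmod (z - w))\<bar>" unfolding abs_mult by (intro mult_right_mono) (auto simp: abs_sgn_eq)
        finally show "g z * ln (cmod (z - w)) \<le> indicator G z * \<bar>ln (cmod (z - w))\<bar>" by (simp add: g_def indicator_def)
      qed (rule iG)
      also have "\<dots> \<le> e" by (rule small) (use elim in simp)
      finally show ?case .
    qed
  qed auto
  also have "\<dots> = e" by (simp add: prob_space)
  finally show ?thesis .
qed

lemma tendsto_0_if_le:
  fixes f g :: "nat \<Rightarrow> real"
  assumes "\<forall>\<^sub>F n in sequentially. 0 \<le> f n" "\<forall>\<^sub>F n in sequentially. f n \<le> g n" "g \<longlonglongrightarrow> 0"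
  shows "f \<longlonglongrightarrow> 0"
  by (rule tendsto_sandwich[OF assms(1,2) tendsto_const assms(3)])

context energy_minimizer
begin

text \<open>
  Superharmonic comparison of \<open>log_pot (\<nu> n)\<close> with \<open>log_pot \<mu>\<close>.  The potential of \<open>\<nu> n\<close> is \<open>ln \<bar>T n\<bar> / n\<close>
  for \<open>n > 0\<close> only, and away from the zeros of \<open>T n\<close>, because \<open>ln 0 = 0\<close>; for \<open>n = 0\<close> the zero
  counting measure is unspecified.
\<close>

abbreviation "T n \<equiv> chebyshev_poly E n"
abbreviation "\<nu> n \<equiv> zero_counting_measure (T n)"

definition excess :: "nat \<Rightarrow> real" where
  "excess n = ln (supnorm_on E (poly (T n))) / real n - (ln D - a)"

definition gap :: "nat \<Rightarrow> complex \<Rightarrow> real" where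
  "gap n z = log_pot \<mu> z + excess n - log_pot (\<nu> n) z"

abbreviation gap_integral :: "nat \<Rightarrow> complex set \<Rightarrow> real" where
  "gap_integral n S \<equiv> LINT z|lborel. indicator S z * gap n z"

abbreviation pot_distance :: "nat \<Rightarrow> complex set \<Rightarrow> real" where
  "pot_distance n S \<equiv> LINT z|lborel. indicator S z * \<bar>log_pot (\<nu> n) z - log_pot \<mu> z\<bar>"

lemma T_monic: "degree (T n) = n" "lead_coeff (T n) = 1"
  using chebyshev_poly_spec(1)[OF compact_E infinite_E, of n] by (auto simp: monic_of_degree_def)

lemma T_nonzero: "T n \<noteq> 0" using T_monic(2)[of n] by auto

lemma supnorm_T_pos: "supnorm_on E (poly (T n)) > 0"
  by (rule supnorm_poly_pos[OF compact_E infinite_E T_nonzero])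

lemma \<nu>_ball: "n > 0 \<Longrightarrow> prob_on (cball 0 (D/4)) (\<nu> n)"
proof (rule prob_on_zero_counting_measure)
  fix w assume "poly (T n) w = 0"
  then have "w \<in> convex hull E" by (rule chebyshev_zeros_in_convex_hull[OF compact_E infinite_E])
  also have "convex hull E \<subseteq> cball 0 (D/4)" by (rule hull_minimal[OF E_ball]) simp
  finally show "w \<in> cball 0 (D/4)" .
qed (auto simp: T_monic)

lemma \<mu>_ball: "prob_on (cball 0 (D/4)) \<mu>"
  by (rule prob_on_subset[OF \<mu>_E E_ball]) auto

lemma log_pot_\<nu>: "n > 0 \<Longrightarrow> log_pot (\<nu> n) z = log_sum (proots (T n)) z / real n"
  unfolding log_pot_def log_sum_def by (subst zero_counting_measure_integral) (auto simp: T_monic)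

text \<open>
  The maximum principle on the complement of \<open>E\<close> needs \<open>s > n\<close>; afterwards \<open>s\<close> tends to \<open>n\<close>.
\<close>

lemma bernstein_walsh:
  assumes z: "z \<notin> E"
  shows "cmod (poly (T n) z) \<le> supnorm_on E (poly (T n)) * exp (real n * (log_pot \<mu> z - (ln D - a)))"
proof -
  let ?M = "supnorm_on E (poly (T n))"
  have E_cl: "closed E" using compact_E by (rule compact_imp_closed)
  have b: "cmod (poly (T n) z) * exp (- s * log_pot \<mu> z) \<le> ?M * exp (- s * (ln D - a))" if s: "s > real n" for s
  proof (rule weighted_poly_maximum_principle[OF prob_on_support[OF \<mu>_E] compact_support, where W="- E"])
    show "real (degree (T n)) < s" using s by (simp add: T_monic)
    show "open (- E)" using E_cl by (rule open_Compl)
    show "- E \<inter> support \<mu> = {}" using support_subset_E by auto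
    show "0 \<le> ?M * exp (- s * (ln D - a))" using supnorm_T_pos[of n] by simp
    fix z0 B' assume z0: "z0 \<in> frontier (- E)" and B': "B' > ?M * exp (- s * (ln D - a))"
    have z0E: "z0 \<in> E" using z0 frontier_subset_closed[OF E_cl] by (auto simp: frontier_complement)
    have "isCont (\<lambda>z. cmod (poly (T n) z) * exp (- s * (ln D - a))) z0" by (intro continuous_intros)
    moreover have "cmod (poly (T n) z0) * exp (- s * (ln D - a)) < B'"
      by (rule le_less_trans[OF mult_right_mono[OF supnorm_poly_upper[OF compact_E z0E]] B']) simp
    ultimately have "\<forall>\<^sub>F x in at z0. cmod (poly (T n) x) * exp (- s * (ln D - a)) < B'"
      unfolding isCont_def by (rule order_tendstoD(2))
    then obtain r where r: "r > 0" "\<And>x. x \<noteq> z0 \<Longrightarrow> dist x z0 < r \<Longrightarrow> cmod (poly (T n) x) * exp (- s * (ln D - a)) < B'"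
      unfolding eventually_at by auto
    show "\<exists>r>0. \<forall>x\<in>- E. dist x z0 < r \<longrightarrow> cmod (poly (T n) x) * exp (- s * log_pot \<mu> x) < B'"
    proof (intro exI[of _ r] conjI ballI impI r(1))
      fix x assume x: "x \<in> - E" "dist x z0 < r"
      then have ne: "x \<noteq> z0" using z0E by auto
      have "ln D - a \<le> log_pot \<mu> x" using x(1) support_subset_E by (intro log_pot_ge_off_support) auto
      then have "exp (- s * log_pot \<mu> x) \<le> exp (- s * (ln D - a))" using s by (simp add: mult_left_mono)
      then have "cmod (poly (T n) x) * exp (- s * log_pot \<mu> x) \<le> cmod (poly (T n) x) * exp (- s * (ln D - a))"
        by (intro mult_left_mono) auto
      also have "\<dots> < B'" by (rule r(2)[OF ne x(2)])
      finally show "cmod (poly (T n) x) * exp (- s * log_pot \<mu> x) < B'" .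
    qed
  qed (use z T_monic in auto)
  have "cmod (poly (T n) z) * exp (- real n * log_pot \<mu> z) \<le> ?M * exp (- real n * (ln D - a))"
  proof (rule tendsto_le[of "at_right (real n)"])
    show "((\<lambda>s. cmod (poly (T n) z) * exp (- s * log_pot \<mu> z)) \<longlongrightarrow> cmod (poly (T n) z) * exp (- real n * log_pot \<mu> z)) (at_right (real n))"
      by (intro tendsto_intros)
    show "((\<lambda>s. ?M * exp (- s * (ln D - a))) \<longlongrightarrow> ?M * exp (- real n * (ln D - a))) (at_right (real n))"
      by (intro tendsto_intros)
    show "\<forall>\<^sub>F s in at_right (real n). cmod (poly (T n) z) * exp (- s * log_pot \<mu> z) \<le> ?M * exp (- s * (ln D - a))"
      using eventually_at_right_less[of "real n"] by eventually_elim (rule b)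
  qed simp
  then have "cmod (poly (T n) z) * exp (- real n * log_pot \<mu> z) * exp (real n * log_pot \<mu> z) \<le> ?M * exp (- real n * (ln D - a)) * exp (real n * log_pot \<mu> z)"
    by (intro mult_right_mono) auto
  then show ?thesis by (simp add: mult.assoc algebra_simps flip: exp_add)
qed

lemma gap_nonneg:
  assumes n: "n > 0" and z: "z \<notin> E" "z \<notin># proots (T n)"
  shows "gap n z \<ge> 0"
proof -
  let ?M = "supnorm_on E (poly (T n))"
  have pz: "poly (T n) z \<noteq> 0" using z(2) T_nonzero by simp
  have "ln (cmod (poly (T n) z)) \<le> ln (?M * exp (real n * (log_pot \<mu> z - (ln D - a))))"
    by (rule ln_mono[OF bernstein_walsh[OF z(1)]]) (use pz in simp)
  also have "\<dots> = ln ?M + real n * (log_pot \<mu> z - (ln D - a))" using supnorm_T_pos[of n] by (simp add: ln_mult)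
  finally have "log_sum (proots (T n)) z \<le> ln ?M + real n * (log_pot \<mu> z - (ln D - a))"
    using ln_cmod_poly[OF T_monic(2) pz] by simp
  then have "log_sum (proots (T n)) z / real n \<le> (ln ?M + real n * (log_pot \<mu> z - (ln D - a))) / real n"
    using n by (intro divide_right_mono) auto
  also have "\<dots> = log_pot \<mu> z + excess n" using n by (simp add: excess_def add_divide_distrib)
  finally show ?thesis using log_pot_\<nu>[OF n] by (simp add: gap_def)
qed

lemma gap_nonneg_AE: "n > 0 \<Longrightarrow> AE z in lborel. z \<notin> E \<longrightarrow> gap n z \<ge> 0"
  using AE_lborel_notin_mset[of "proots (T n)"] by eventually_elim (auto intro: gap_nonneg)

lemma integrable_gap:
  assumes n: "n > 0" and S: "S \<in> sets borel" "bounded S"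
  shows "integrable lborel (\<lambda>z. indicator S z * gap n z)"
proof -
  have "emeasure lborel S < \<infinity>" by (rule emeasure_bounded_finite[OF S(2)])
  then have "integrable lborel (\<lambda>z. indicator S z * excess n)"
    using S by (intro integrable_mult_left integrable_real_indicator) auto
  then have "integrable lborel (\<lambda>z. indicator S z * log_pot \<mu> z + indicator S z * excess n - indicator S z * log_pot (\<nu> n) z)"
    by (intro Bochner_Integration.integrable_add Bochner_Integration.integrable_diff integrable_log_pot_on[OF \<mu>_ball S] integrable_log_pot_on[OF \<nu>_ball[OF n] S])
  then show ?thesis by (simp add: gap_def algebra_simps)
qed

lemma integral_gap:
  assumes n: "n > 0" and S: "S \<in> sets borel" "bounded S"
  shows "gap_integral n S = (LINT z|lborel. indicator S z * log_pot \<mu> z) + measure lborel S * excess n - (LINT z|lborel. indicator S z * log_pot (\<nu> n) z)"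
proof -
  have fin: "emeasure lborel S < \<infinity>" by (rule emeasure_bounded_finite[OF S(2)])
  have i: "integrable lborel (\<lambda>z. indicator S z * excess n)"
    using S fin by (intro integrable_mult_left integrable_real_indicator) auto
  have "gap_integral n S = (LINT z|lborel. indicator S z * log_pot \<mu> z + indicator S z * excess n - indicator S z * log_pot (\<nu> n) z)"
    by (simp add: gap_def algebra_simps)
  also have "\<dots> = (LINT z|lborel. indicator S z * log_pot \<mu> z) + (LINT z|lborel. indicator S z * excess n) - (LINT z|lborel. indicator S z * log_pot (\<nu> n) z)"
    using i integrable_log_pot_on[OF \<mu>_ball S] integrable_log_pot_on[OF \<nu>_ball[OF n] S] by simp
  also have "(LINT z|lborel. indicator S z * excess n) = measure lborel S * excess n" using S fin by simp
  finally show ?thesis .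
qed

lemma integral_gap_nonneg:
  assumes n: "n > 0" and S: "S \<subseteq> - E"
  shows "gap_integral n S \<ge> 0"
proof (rule integral_nonneg_AE)
  show "AE z in lborel. 0 \<le> indicator S z * gap n z"
    using gap_nonneg_AE[OF n] by eventually_elim (use S in \<open>auto simp: indicator_def\<close>)
qed

lemma integral_gap_mono:
  assumes n: "n > 0" and S: "S \<in> sets borel" "S' \<in> sets borel" "bounded S'" "S \<subseteq> S'" "S' \<subseteq> - E"
  shows "gap_integral n S \<le> gap_integral n S'"
proof (rule integral_mono_AE)
  show "integrable lborel (\<lambda>z. indicator S z * gap n z)" "integrable lborel (\<lambda>z. indicator S' z * gap n z)"
    using S bounded_subset by (auto intro!: integrable_gap[OF n])
  show "AE z in lborel. indicator S z * gap n z \<le> indicator S' z * gap n z"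
    using gap_nonneg_AE[OF n] by eventually_elim (use S in \<open>auto simp: indicator_def\<close>)
qed

text \<open>
  The gap is superharmonic off \<open>E\<close>: the potential of \<open>\<mu>\<close> is harmonic there and that of \<open>\<nu> n\<close> is
  subharmonic.
\<close>

lemma gap_ball_mean_le:
  assumes n: "n > 0" and r: "r > 0" "ball c r \<subseteq> - E" and c: "c \<notin># proots (T n)"
  shows "gap_integral n (ball c r) \<le> measure lborel (ball c r) * gap n c"
proof -
  have m: "(LINT z|lborel. indicator (ball c r) z * log_pot \<mu> z) = measure lborel (ball c r) * log_pot \<mu> c"
    by (rule log_pot_ball_mean(2)[OF \<mu>_E compact_E r(1)]) (use r in auto)
  have "measure lborel (ball c r) * log_sum (proots (T n)) c / real n \<le> (LINT z|lborel. indicator (ball c r) z * log_sum (proots (T n)) z) / real n"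
    by (intro divide_right_mono log_sum_ball_mean(2)[OF c]) auto
  then have "measure lborel (ball c r) * log_pot (\<nu> n) c \<le> (LINT z|lborel. indicator (ball c r) z * log_pot (\<nu> n) z)"
    by (simp add: log_pot_\<nu>[OF n])
  moreover have "gap_integral n (ball c r) = measure lborel (ball c r) * log_pot \<mu> c + measure lborel (ball c r) * excess n - (LINT z|lborel. indicator (ball c r) z * log_pot (\<nu> n) z)"
    unfolding m[symmetric] by (rule integral_gap[OF n]) auto
  ultimately show ?thesis by (simp add: gap_def right_diff_distrib distrib_left)
qed

definition outer_annulus :: "complex set" where "outer_annulus = ball 0 D - cball 0 (D/4)"

lemma annulus_gap:
  assumes n: "n > 0"
  shows "gap_integral n outer_annulus = measure lborel outer_annulus * excess n"
proof -
  have b: "bounded outer_annulus" unfolding outer_annulus_def by (rule bounded_subset[OF bounded_ball[of 0 D]]) auto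
  have s: "outer_annulus \<in> sets borel" by (simp add: outer_annulus_def)
  have D4: "D/4 > 0" using D_pos by simp
  show ?thesis
    unfolding integral_gap[OF n s b] unfolding outer_annulus_def log_pot_annulus[OF \<mu>_ball D4] log_pot_annulus[OF \<nu>_ball[OF n] D4] by simp
qed

lemma outer_annulus_props: "outer_annulus \<in> sets borel" "bounded outer_annulus" "outer_annulus \<subseteq> - E" "open outer_annulus" "measure lborel outer_annulus > 0" "outer_annulus \<noteq> {}"
proof -
  show "outer_annulus \<in> sets borel" by (simp add: outer_annulus_def)
  show b: "bounded outer_annulus" unfolding outer_annulus_def by (rule bounded_subset[OF bounded_ball[of 0 D]]) auto
  show "outer_annulus \<subseteq> - E" using E_ball by (auto simp: outer_annulus_def)
  show o: "open outer_annulus" unfolding outer_annulus_def by (intro open_Diff) auto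
  have x: "of_real (D/2) \<in> outer_annulus" using D_pos by (simp add: outer_annulus_def)
  then show "outer_annulus \<noteq> {}" by auto
  obtain r where r: "r > 0" "ball (of_real (D/2)) r \<subseteq> outer_annulus" using o x unfolding open_contains_ball by blast
  have "0 < measure lborel (ball (of_real (D/2) :: complex) r)" using r(1) by (simp add: measure_ball_complex)
  also have "\<dots> \<le> measure lborel outer_annulus"
    by (rule measure_mono_fmeasurable[OF r(2)]) (use emeasure_bounded_finite[OF b] in \<open>auto simp: outer_annulus_def fmeasurable_def\<close>)
  finally show "measure lborel outer_annulus > 0" .
qed

text \<open>
  The lower bound \<open>excess n \<ge> 0\<close> comes from the annulus, where the mean of the nonnegative gap is
  \<open>excess n\<close>.
\<close>

lemma excess_tendsto_0: "excess \<longlonglongrightarrow> 0"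
proof (rule tendstoI)
  fix e :: real assume e: "e > 0"
  have "\<forall>\<^sub>F n in sequentially. ln (supnorm_on E (poly (T n))) \<le> real n * (ln D - a + e/2)"
    by (rule chebyshev_norm_upper) (use e in simp)
  then show "\<forall>\<^sub>F n in sequentially. dist (excess n) 0 < e"
    using eventually_gt_at_top[of 0]
  proof eventually_elim
    case (elim n)
    have "0 \<le> measure lborel outer_annulus * excess n"
      unfolding annulus_gap[OF elim(2), symmetric] by (rule integral_gap_nonneg[OF elim(2) outer_annulus_props(3)])
    then have "0 \<le> excess n" using outer_annulus_props(5) by (simp add: zero_le_mult_iff)
    moreover have "ln (supnorm_on E (poly (T n))) / real n \<le> ln D - a + e/2" using elim by (simp add: divide_le_eq mult.commute)
    ultimately show ?case using e by (simp add: excess_def dist_real_def)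
  qed
qed

definition gap_vanishes :: "complex \<Rightarrow> bool" where
  "gap_vanishes c \<longleftrightarrow> (\<exists>r>0. ball c r \<subseteq> - E \<and> (\<lambda>n. gap_integral n (ball c r)) \<longlonglongrightarrow> 0)"

lemma gap_vanishes_mono:
  assumes S: "S \<in> sets borel" "S' \<in> sets borel" "bounded S'" "S \<subseteq> S'" "S' \<subseteq> - E"
    and lim: "(\<lambda>n. gap_integral n S') \<longlonglongrightarrow> 0"
  shows "(\<lambda>n. gap_integral n S) \<longlonglongrightarrow> 0"
proof (rule tendsto_0_if_le[OF _ _ lim])
  show "\<forall>\<^sub>F n in sequentially. 0 \<le> gap_integral n S"
    using eventually_gt_at_top[of 0] by eventually_elim (rule integral_gap_nonneg, use S in auto)
  show "\<forall>\<^sub>F n in sequentially. gap_integral n S \<le> gap_integral n S'"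
    using eventually_gt_at_top[of 0] by eventually_elim (rule integral_gap_mono, use S in auto)
qed

lemma gap_vanishes_annulus:
  assumes "c \<in> outer_annulus"
  shows "gap_vanishes c"
proof -
  obtain r where r: "r > 0" "ball c r \<subseteq> outer_annulus" using outer_annulus_props(4) assms unfolding open_contains_ball by blast
  have "(\<lambda>n. measure lborel outer_annulus * excess n) \<longlonglongrightarrow> measure lborel outer_annulus * 0"
    by (intro tendsto_intros excess_tendsto_0)
  moreover have "\<forall>\<^sub>F n in sequentially. measure lborel outer_annulus * excess n = gap_integral n outer_annulus"
    using eventually_gt_at_top[of 0] by eventually_elim (simp add: annulus_gap)
  ultimately have "(\<lambda>n. gap_integral n outer_annulus) \<longlonglongrightarrow> 0"
    by (simp add: tendsto_cong)
  then have "(\<lambda>n. gap_integral n (ball c r)) \<longlonglongrightarrow> 0"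
    by (rule gap_vanishes_mono[rotated -1]) (use r outer_annulus_props in auto)
  then show ?thesis unfolding gap_vanishes_def using r outer_annulus_props(3) by blast
qed

text \<open>
  A function cannot exceed its mean everywhere on the disc about \<open>c'\<close>, so some point \<open>w\<close> close to \<open>c\<close>
  has a small gap.  By superharmonicity the mean over the disc of radius \<open>2 s\<close> about \<open>w\<close>, which
  contains the disc of radius \<open>s\<close> about \<open>c\<close>, is small as well.
\<close>

lemma gap_vanishes_step:
  assumes c': "gap_vanishes c'" and s: "s > 0" "ball c (3 * s) \<subseteq> - E" and d: "dist c c' < s / 2"
  shows "gap_vanishes c"
proof -
  obtain r0 where r0: "r0 > 0" "ball c' r0 \<subseteq> - E" "(\<lambda>n. gap_integral n (ball c' r0)) \<longlonglongrightarrow> 0"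
    using c' by (auto simp: gap_vanishes_def)
  define r where "r = min r0 (s / 2)"
  have r: "r > 0" "r \<le> r0" "r \<le> s / 2" using r0 s by (auto simp: r_def)
  define V where "V = measure lborel (ball c' r)"
  have V: "V > 0" unfolding V_def using r by (simp add: measure_ball_complex)
  have Icr: "(\<lambda>n. gap_integral n (ball c' r)) \<longlonglongrightarrow> 0"
    by (rule gap_vanishes_mono[OF _ _ _ _ r0(2,3)]) (use r in auto)
  let ?W = "measure lborel (ball (0::complex) (2 * s))"
  have bound: "gap_integral n (ball c s) \<le> ?W / V * gap_integral n (ball c' r)" if n: "n > 0" for n
  proof -
    define A where "A = gap_integral n (ball c' r) / V"
    have "\<exists>w. w \<in> ball c' r \<and> w \<notin># proots (T n) \<and> gap n w \<le> A"
    proof (rule ccontr)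
      assume none: "\<nexists>w. w \<in> ball c' r \<and> w \<notin># proots (T n) \<and> gap n w \<le> A"
      let ?h = "\<lambda>z. indicator (ball c' r) z * gap n z - indicator (ball c' r) z * A"
      have iA: "integrable lborel (\<lambda>z. indicator (ball c' r) z * A)"
        using emeasure_lborel_ball_finite[of c' r] by (intro integrable_mult_left integrable_real_indicator) auto
      have ig: "integrable lborel (\<lambda>z. indicator (ball c' r) z * gap n z)" by (rule integrable_gap[OF n]) auto
      have hi: "integrable lborel ?h" by (rule Bochner_Integration.integrable_diff[OF ig iA])
      have "(LINT z|lborel. ?h z) = gap_integral n (ball c' r) - V * A"
        using Bochner_Integration.integral_diff[OF ig iA] by (simp add: V_def)
      also have "\<dots> = 0" using V by (simp add: A_def)
      finally have h0: "(LINT z|lborel. ?h z) = 0" .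
      have hp: "AE z in lborel. z \<in> ball c' r \<longrightarrow> ?h z > 0"
        using AE_lborel_notin_mset[of "proots (T n)"] by eventually_elim (use none in \<open>auto simp: not_le\<close>)
      have hnn: "AE z in lborel. 0 \<le> ?h z"
        using hp by eventually_elim (auto simp: indicator_def)
      have "AE z in lborel. ?h z = 0" using integral_nonneg_eq_0_iff_AE[OF hi hnn] h0 by simp
      then have "AE z in lborel. z \<notin> ball c' r" using hp by eventually_elim auto
      then have "ball c' r \<in> null_sets lborel" by (subst AE_iff_null_sets) auto
      then show False using V by (simp add: V_def measure_def null_sets_def)
    qed
    then obtain w where w: "w \<in> ball c' r" "w \<notin># proots (T n)" "gap n w \<le> A" by blast
    have wc: "dist c w < s" using w(1) d r(3) dist_triangle[of c w c'] by simp
    have sub1: "ball c s \<subseteq> ball w (2 * s)"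
    proof
      fix x assume "x \<in> ball c s"
      then show "x \<in> ball w (2 * s)" using wc dist_triangle[of w x c] by (simp add: dist_commute)
    qed
    have sub2: "ball w (2 * s) \<subseteq> - E"
    proof -
      have "ball w (2 * s) \<subseteq> ball c (3 * s)"
      proof
        fix x assume "x \<in> ball w (2 * s)"
        then show "x \<in> ball c (3 * s)" using wc dist_triangle[of c x w] by simp
      qed
      then show ?thesis using s by auto
    qed
    have "gap_integral n (ball c s) \<le> gap_integral n (ball w (2 * s))"
      by (rule integral_gap_mono[OF n _ _ _ sub1 sub2]) auto
    also have "\<dots> \<le> measure lborel (ball w (2 * s)) * gap n w"
      by (rule gap_ball_mean_le[OF n _ sub2 w(2)]) (use s in simp)
    also have "\<dots> \<le> ?W * A" using w(3) s by (simp add: measure_ball_complex mult_left_mono)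
    finally show ?thesis by (simp add: A_def)
  qed
  have cs: "ball c s \<subseteq> - E" using subset_ball[of s "3 * s" c] s by auto
  have "(\<lambda>n. gap_integral n (ball c s)) \<longlonglongrightarrow> 0"
  proof (rule tendsto_0_if_le)
    show "\<forall>\<^sub>F n in sequentially. 0 \<le> gap_integral n (ball c s)"
      using eventually_gt_at_top[of 0] by eventually_elim (rule integral_gap_nonneg, use cs in auto)
    show "\<forall>\<^sub>F n in sequentially. gap_integral n (ball c s) \<le> ?W / V * gap_integral n (ball c' r)"
      using eventually_gt_at_top[of 0] by eventually_elim (rule bound)
    show "(\<lambda>n. ?W / V * gap_integral n (ball c' r)) \<longlonglongrightarrow> 0"
      using tendsto_mult[OF tendsto_const[of "?W / V"] Icr] by simp
  qed
  then show ?thesis unfolding gap_vanishes_def using s(1) cs by blast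
qed

text \<open>
  The points with vanishing gap form a nonempty, open and relatively closed subset of the
  complement of \<open>E\<close>.
\<close>

lemma gap_vanishes_everywhere:
  assumes conn: "connected (- E)" and c: "c \<notin> E"
  shows "gap_vanishes c"
proof -
  define G where "G = {c. gap_vanishes c}"
  have opE: "open (- E)" using compact_imp_closed[OF compact_E] by (rule open_Compl)
  have GE: "G \<subseteq> - E"
  proof
    fix x assume "x \<in> G"
    then obtain r where "r > 0" "ball x r \<subseteq> - E" unfolding G_def gap_vanishes_def by blast
    then show "x \<in> - E" using centre_in_ball[of x r] by blast
  qed
  \<comment> \<open>A third of the radius serves as \<open>s\<close> in the comparison of neighbouring discs, and \<open>s / 2\<close> is the reach of a step.\<close>
  have step: "\<exists>e>0. \<forall>c'. dist c c' < e \<and> c' \<in> G \<longrightarrow> c \<in> G" if "c \<in> - E" for c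
  proof -
    obtain e where e: "e > 0" "ball c e \<subseteq> - E" using opE \<open>c \<in> - E\<close> unfolding open_contains_ball by blast
    have "c \<in> G" if "dist c c' < e / 6" "c' \<in> G" for c'
      using gap_vanishes_step[of c' "e/3" c] that e by (simp add: G_def)
    then show ?thesis using e by (intro exI[of _ "e/6"]) auto
  qed
  have "open G"
    unfolding open_contains_ball
  proof
    fix c assume "c \<in> G"
    then obtain r where r: "r > 0" "ball c r \<subseteq> - E" "(\<lambda>n. gap_integral n (ball c r)) \<longlonglongrightarrow> 0"
      by (auto simp: G_def gap_vanishes_def)
    have "x \<in> G" if x: "x \<in> ball c r" for x
    proof -
      define r' where "r' = r - dist c x"
      have sub: "ball x r' \<subseteq> ball c r"
      proof
        fix y assume "y \<in> ball x r'"
        then show "y \<in> ball c r" using dist_triangle[of c y x] by (simp add: r'_def)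
      qed
      have "(\<lambda>n. gap_integral n (ball x r')) \<longlonglongrightarrow> 0"
        by (rule gap_vanishes_mono[OF _ _ _ sub r(2,3)]) auto
      then show ?thesis unfolding G_def gap_vanishes_def using x sub r(2) by (auto intro!: exI[of _ r'] simp: r'_def)
    qed
    then show "\<exists>e>0. ball c e \<subseteq> G" using r(1) by blast
  qed
  moreover have "open (- E - G)"
    unfolding open_contains_ball
  proof
    fix x assume x: "x \<in> - E - G"
    then obtain e where e: "e > 0" "\<forall>c'. dist x c' < e \<and> c' \<in> G \<longrightarrow> x \<in> G" using step by blast
    obtain e' where e': "e' > 0" "ball x e' \<subseteq> - E" using opE x unfolding open_contains_ball by blast
    have "ball x (min e e') \<subseteq> - E - G" using e e' x by auto
    then show "\<exists>e>0. ball x e \<subseteq> - E - G" using e(1) e'(1) by (intro exI[of _ "min e e'"]) auto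
  qed
  moreover have "G \<noteq> {}" using gap_vanishes_annulus outer_annulus_props(6) by (auto simp: G_def)
  ultimately have "- E - G = {}"
    using connectedD[OF conn, of G "- E - G"] GE by auto
  then show ?thesis using c by (auto simp: G_def)
qed

lemma potential_L1_off_E:
  assumes conn: "connected (- E)" and K: "compact K" "K \<subseteq> - E"
  shows "(\<lambda>n. pot_distance n K) \<longlonglongrightarrow> 0"
proof -
  have Kb: "K \<in> sets borel" "bounded K" using K by (auto simp: borel_compact compact_imp_bounded)
  have "\<forall>c\<in>K. \<exists>r>0. ball c r \<subseteq> - E \<and> (\<lambda>n. gap_integral n (ball c r)) \<longlonglongrightarrow> 0"
    using gap_vanishes_everywhere[OF conn] K(2) unfolding gap_vanishes_def by blast
  then obtain r where r: "\<And>c. c \<in> K \<Longrightarrow> r c > 0" "\<And>c. c \<in> K \<Longrightarrow> ball c (r c) \<subseteq> - E"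
    "\<And>c. c \<in> K \<Longrightarrow> (\<lambda>n. gap_integral n (ball c (r c))) \<longlonglongrightarrow> 0"
    by metis
  have cov: "K \<subseteq> (\<Union>c\<in>K. ball c (r c))" using r(1) by auto
  obtain C where C: "C \<subseteq> K" "finite C" "K \<subseteq> (\<Union>c\<in>C. ball c (r c))"
    by (rule compactE_image[OF K(1) open_ball cov])
  have "(\<lambda>n. \<Sum>c\<in>C. gap_integral n (ball c (r c))) \<longlonglongrightarrow> (\<Sum>c\<in>C. 0)"
    by (rule tendsto_sum) (use C r(3) in auto)
  then have s0: "(\<lambda>n. (\<Sum>c\<in>C. gap_integral n (ball c (r c))) + measure lborel K * \<bar>excess n\<bar>) \<longlonglongrightarrow> 0"
    using tendsto_add[OF _ tendsto_mult[OF tendsto_const[of "measure lborel K"] tendsto_rabs[OF excess_tendsto_0]], of _ 0] by simp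
  show ?thesis
  proof (rule tendsto_0_if_le[OF _ _ s0])
    show "\<forall>\<^sub>F n in sequentially. 0 \<le> pot_distance n K"
      by (intro always_eventually allI integral_nonneg_AE AE_I2) auto
    show "\<forall>\<^sub>F n in sequentially. pot_distance n K \<le> (\<Sum>c\<in>C. gap_integral n (ball c (r c))) + measure lborel K * \<bar>excess n\<bar>"
      using eventually_gt_at_top[of 0]
    proof eventually_elim
      case (elim n)
      have finK: "emeasure lborel K < \<infinity>" by (rule emeasure_compact_finite[OF K(1)])
      have ie: "integrable lborel (\<lambda>z. indicator K z * \<bar>excess n\<bar>)"
        using Kb finK by (intro integrable_mult_left integrable_real_indicator) auto
      have ic: "integrable lborel (\<lambda>z. indicator (ball c (r c)) z * gap n z)" for c by (rule integrable_gap[OF elim]) auto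
      have id: "integrable lborel (\<lambda>z. indicator K z * \<bar>log_pot (\<nu> n) z - log_pot \<mu> z\<bar>)"
      proof -
        have "integrable lborel (\<lambda>z. \<bar>indicator K z * log_pot (\<nu> n) z - indicator K z * log_pot \<mu> z\<bar>)"
          by (intro integrable_abs Bochner_Integration.integrable_diff integrable_log_pot_on[OF \<mu>_ball Kb] integrable_log_pot_on[OF \<nu>_ball[OF elim] Kb])
        then show ?thesis by (simp add: abs_mult flip: right_diff_distrib)
      qed
      have "pot_distance n K
          \<le> (LINT z|lborel. (\<Sum>c\<in>C. indicator (ball c (r c)) z * gap n z) + indicator K z * \<bar>excess n\<bar>)"
      proof (rule integral_mono_AE[OF id])
        show "integrable lborel (\<lambda>z. (\<Sum>c\<in>C. indicator (ball c (r c)) z * gap n z) + indicator K z * \<bar>excess n\<bar>)"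
          by (intro Bochner_Integration.integrable_add Bochner_Integration.integrable_sum ic ie)
        show "AE z in lborel. indicator K z * \<bar>log_pot (\<nu> n) z - log_pot \<mu> z\<bar> \<le> (\<Sum>c\<in>C. indicator (ball c (r c)) z * gap n z) + indicator K z * \<bar>excess n\<bar>"
          using gap_nonneg_AE[OF elim]
        proof eventually_elim
          case (elim z)
          have nn: "0 \<le> indicator (ball c (r c)) z * gap n z" if "c \<in> C" for c
          proof (cases "z \<in> ball c (r c)")
            case True
            then have "z \<notin> E" using r(2)[OF subsetD[OF C(1) that]] by blast
            then show ?thesis using elim True by simp
          qed simp
          show ?case
          proof (cases "z \<in> K")
            case True
            then obtain c where c: "c \<in> C" "z \<in> ball c (r c)" using C(3) by auto
            have "gap n z = indicator (ball c (r c)) z * gap n z" using c by simp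
            also have "\<dots> \<le> (\<Sum>c\<in>C. indicator (ball c (r c)) z * gap n z)"
              by (rule member_le_sum[OF c(1)]) (use nn C in auto)
            finally have g: "gap n z \<le> (\<Sum>c\<in>C. indicator (ball c (r c)) z * gap n z)" .
            have "gap n z \<ge> 0" using elim True K(2) by auto
            then have "\<bar>log_pot (\<nu> n) z - log_pot \<mu> z\<bar> \<le> gap n z + \<bar>excess n\<bar>" unfolding gap_def by linarith
            then show ?thesis using g True by simp
          qed (use nn in \<open>auto intro: sum_nonneg\<close>)
        qed
      qed
      also have "\<dots> = (\<Sum>c\<in>C. gap_integral n (ball c (r c))) + measure lborel K * \<bar>excess n\<bar>"
        using ic ie Kb finK by simp
      finally show ?case .
    qed
  qed
qed

end

section \<open>Convergence of measures and uniqueness of the minimizer\<close>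

lemma AE_eq_0_if_abs_integral_0:
  fixes f :: "complex \<Rightarrow> real"
  assumes "integrable lborel (\<lambda>z. indicator K z * \<bar>f z\<bar>)" "(LINT z|lborel. indicator K z * \<bar>f z\<bar>) = 0"
  shows "AE z in lborel. z \<in> K \<longrightarrow> f z = 0"
proof -
  have "AE z in lborel. indicator K z * \<bar>f z\<bar> = 0"
    using integral_nonneg_eq_0_iff_AE[OF assms(1)] assms(2) by simp
  then show ?thesis by eventually_elim (auto simp: indicator_def)
qed

lemma integrable_pot_diff:
  assumes "prob_on (cball 0 \<rho>) \<nu>" "prob_on (cball 0 \<rho>) \<nu>'" "K \<in> sets borel" "bounded K"
  shows "integrable lborel (\<lambda>z. indicator K z * \<bar>log_pot \<nu> z - log_pot \<nu>' z\<bar>)"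
proof -
  have "integrable lborel (\<lambda>z. \<bar>indicator K z * log_pot \<nu> z - indicator K z * log_pot \<nu>' z\<bar>)"
    by (intro integrable_abs Bochner_Integration.integrable_diff integrable_log_pot_on[OF assms(1,3,4)] integrable_log_pot_on[OF assms(2,3,4)])
  then show ?thesis by (simp add: abs_mult flip: right_diff_distrib)
qed

context energy_minimizer
begin

text \<open>
  An open set of small area covers the null set \<open>K \<inter> E\<close>.  Its part in \<open>K\<close> contributes little to the
  integrals of both potentials, and the rest of \<open>K\<close> is a compact set off \<open>E\<close>.
\<close>

lemma potential_L1_null:
  assumes conn: "connected (- E)" and K: "compact K" "K \<inter> E \<in> null_sets lborel"
  shows "(\<lambda>n. pot_distance n K) \<longlonglongrightarrow> 0"
proof (rule tendstoI)
  fix e :: real assume e: "e > 0"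
  have Kb: "K \<in> sets borel" "bounded K" using K by (auto simp: borel_compact compact_imp_bounded)
  obtain R0 where R0: "\<forall>z\<in>K. cmod z \<le> R0" using Kb(2) by (auto simp: bounded_iff)
  define R where "R = max (D/4) (R0 + 1)"
  have R: "D/4 \<le> R" "K \<subseteq> ball 0 R" using R0 by (auto simp: R_def)
  have pr: "prob_on (cball 0 R) \<mu>" "n > 0 \<Longrightarrow> prob_on (cball 0 R) (\<nu> n)" for n
    using R(1) by (auto intro: prob_on_subset[OF \<mu>_ball] prob_on_subset[OF \<nu>_ball])
  obtain d where d: "d > 0" "\<And>G w. G \<in> sets borel \<Longrightarrow> G \<subseteq> ball 0 R \<Longrightarrow> measure lborel G < d \<Longrightarrow> cmod w \<le> R \<Longrightarrow>
     (LINT z|lborel. indicator G z * \<bar>ln (cmod (z - w))\<bar>) \<le> e/4"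
    using integral_abs_log_small[of "e/4" R] e by auto
  have KE: "K \<inter> E \<in> sets borel" using Kb E_borel by auto
  obtain U0 where U0: "open U0" "K \<inter> E \<subseteq> U0" "emeasure lborel (U0 - K \<inter> E) < d"
    by (rule outer_regular_lborel[OF KE d(1)])
  define G where "G = K \<inter> U0"
  have Gb[measurable]: "G \<in> sets borel" "bounded G" using Kb U0 by (auto simp: G_def intro: bounded_subset)
  have GR: "G \<subseteq> ball 0 R" using R by (auto simp: G_def)
  have "emeasure lborel G \<le> emeasure lborel ((U0 - K \<inter> E) \<union> (K \<inter> E))"
    by (rule emeasure_mono) (use U0 KE in \<open>auto simp: G_def\<close>)
  also have "\<dots> \<le> emeasure lborel (U0 - K \<inter> E) + emeasure lborel (K \<inter> E)"
    by (rule emeasure_subadditive) (use U0 KE in auto)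
  also have "\<dots> = emeasure lborel (U0 - K \<inter> E)" using K(2) by auto
  also have "\<dots> < ennreal d" by (rule U0(3))
  finally have "ennreal (measure lborel G) < ennreal d"
    using emeasure_bounded_finite[OF Gb(2)] by (subst (asm) emeasure_eq_ennreal_measure) auto
  then have Gd: "measure lborel G < d" using d(1) by (simp add: ennreal_less_iff)
  define K' where "K' = K - U0"
  have K': "compact K'" "K' \<subseteq> - E" using K(1) U0 by (auto simp: K'_def intro: compact_diff)
  have K'b: "K' \<in> sets borel" "bounded K'" using K' by (auto simp: borel_compact compact_imp_bounded)
  have "\<forall>\<^sub>F n in sequentially. dist (pot_distance n K') 0 < e/4"
    by (rule tendstoD[OF potential_L1_off_E[OF conn K']]) (use e in simp)
  then show "\<forall>\<^sub>F n in sequentially. dist (pot_distance n K) 0 < e"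
    using eventually_gt_at_top[of 0]
  proof eventually_elim
    case (elim n)
    note p = pr(2)[OF elim(2)] pr(1)
    have i1: "integrable lborel (\<lambda>z. indicator K' z * \<bar>log_pot (\<nu> n) z - log_pot \<mu> z\<bar>)"
      by (rule integrable_pot_diff[OF p K'b])
    have iG: "integrable lborel (\<lambda>z. indicator G z * \<bar>log_pot \<sigma> z\<bar>)" if "prob_on (cball 0 R) \<sigma>" for \<sigma>
      using integrable_abs[OF integrable_log_pot_on[OF that Gb]] by (simp add: abs_mult)
    have sG: "(LINT z|lborel. indicator G z * \<bar>log_pot \<sigma> z\<bar>) \<le> e/4" if "prob_on (cball 0 R) \<sigma>" for \<sigma>
      by (rule log_pot_abs_small[OF that Gb d(2)[OF Gb(1) GR Gd]])
    have "pot_distance n K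
      \<le> (LINT z|lborel. indicator K' z * \<bar>log_pot (\<nu> n) z - log_pot \<mu> z\<bar> + (indicator G z * \<bar>log_pot (\<nu> n) z\<bar> + indicator G z * \<bar>log_pot \<mu> z\<bar>))"
    proof (rule integral_mono)
      show "integrable lborel (\<lambda>z. indicator K z * \<bar>log_pot (\<nu> n) z - log_pot \<mu> z\<bar>)" by (rule integrable_pot_diff[OF p Kb])
      show "integrable lborel (\<lambda>z. indicator K' z * \<bar>log_pot (\<nu> n) z - log_pot \<mu> z\<bar> + (indicator G z * \<bar>log_pot (\<nu> n) z\<bar> + indicator G z * \<bar>log_pot \<mu> z\<bar>))"
        by (intro Bochner_Integration.integrable_add i1 iG p)
      fix z
      show "indicator K z * \<bar>log_pot (\<nu> n) z - log_pot \<mu> z\<bar> \<le> indicator K' z * \<bar>log_pot (\<nu> n) z - log_pot \<mu> z\<bar> + (indicator G z * \<bar>log_pot (\<nu> n) z\<bar> + indicator G z * \<bar>log_pot \<mu> z\<bar>)"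
        using abs_triangle_ineq4[of "log_pot (\<nu> n) z" "log_pot \<mu> z"] by (auto simp: indicator_def K'_def G_def)
    qed
    also have "\<dots> = pot_distance n K' + ((LINT z|lborel. indicator G z * \<bar>log_pot (\<nu> n) z\<bar>) + (LINT z|lborel. indicator G z * \<bar>log_pot \<mu> z\<bar>))"
      using i1 iG[OF p(1)] iG[OF p(2)] by simp
    also have "\<dots> < e/4 + (e/4 + e/4)"
      using elim(1) sG[OF p(1)] sG[OF p(2)] by (intro add_less_le_mono add_mono) (auto simp: dist_real_def)
    also have "\<dots> < e" using e by simp
    finally have "pot_distance n K < e" .
    moreover have "0 \<le> pot_distance n K" by (rule integral_nonneg_AE) auto
    ultimately show ?case by (simp add: dist_real_def)
  qed
qed

lemma zeros_integral_tendsto: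
  fixes f :: "complex \<Rightarrow> real"
  assumes conn: "connected (- E)" and N: "open N" "N \<inter> E \<in> null_sets lborel"
    and f: "continuous_on UNIV f" "compact (closure {z. f z \<noteq> 0})" "closure {z. f z \<noteq> 0} \<subseteq> N"
  shows "(\<lambda>n. LINT z|\<nu> n. f z) \<longlonglongrightarrow> (LINT z|\<mu>. f z)"
proof (rule tendstoI)
  fix e :: real assume e: "e > 0"
  obtain \<phi> K B where \<phi>: "\<phi> \<in> borel_measurable borel" "\<And>z. \<bar>\<phi> z\<bar> \<le> B" "compact K" "K \<subseteq> N" "\<And>z. z \<notin> K \<Longrightarrow> \<phi> z = 0"
    "\<And>\<rho> \<nu>. prob_on (cball 0 \<rho>) \<nu> \<Longrightarrow> \<bar>(LINT z|\<nu>. f z) - (LINT z|lborel. \<phi> z * log_pot \<nu> z)\<bar> \<le> e/4"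
  proof (rule test_function_by_log_potential[OF f N(1), of "e/4"])
    show "e/4 > 0" using e by simp
    fix \<phi> :: "complex \<Rightarrow> real" and B K
    assume "\<phi> \<in> borel_measurable borel" "\<And>z. \<bar>\<phi> z\<bar> \<le> B" "compact K" "K \<subseteq> N" "\<And>z. z \<notin> K \<Longrightarrow> \<phi> z = 0"
      "\<And>\<rho> \<nu>. prob_on (cball 0 \<rho>) \<nu> \<Longrightarrow> \<bar>(LINT z|\<nu>. f z) - (LINT z|lborel. \<phi> z * log_pot \<nu> z)\<bar> \<le> e/4"
    then show thesis by (rule that)
  qed
  have B: "B \<ge> 0" using \<phi>(2)[of 0] by linarith
  have Kb: "K \<in> sets borel" "bounded K" using \<phi>(3) by (auto simp: borel_compact compact_imp_bounded)
  have KE: "K \<inter> E \<in> null_sets lborel"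
    by (rule null_sets_subset[OF N(2)]) (use \<phi>(4) Kb E_borel in auto)
  have \<phi>i: "integrable lborel (\<lambda>z. \<phi> z * log_pot \<sigma> z)" if "prob_on (cball 0 (D/4)) \<sigma>" for \<sigma>
  proof -
    note [measurable] = \<phi>(1) borel_measurable_log_pot[OF that]
    have "integrable lborel (\<lambda>z. B * (indicator K z * log_pot \<sigma> z))"
      by (intro integrable_mult_right integrable_log_pot_on[OF that Kb])
    then show ?thesis
    proof (rule Bochner_Integration.integrable_bound)
      show "AE z in lborel. norm (\<phi> z * log_pot \<sigma> z) \<le> norm (B * (indicator K z * log_pot \<sigma> z))"
      proof (intro AE_I2)
        fix z
        show "norm (\<phi> z * log_pot \<sigma> z) \<le> norm (B * (indicator K z * log_pot \<sigma> z))"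
          using \<phi>(2)[of z] \<phi>(5)[of z] B by (cases "z \<in> K") (auto simp: abs_mult intro!: mult_right_mono)
      qed
    qed measurable
  qed
  have "(\<lambda>n. B * pot_distance n K) \<longlonglongrightarrow> B * 0"
    by (intro tendsto_intros potential_L1_null[OF conn \<phi>(3) KE])
  then have "\<forall>\<^sub>F n in sequentially. B * pot_distance n K < e/4"
    using e by (intro order_tendstoD(2)) auto
  then show "\<forall>\<^sub>F n in sequentially. dist (LINT z|\<nu> n. f z) (LINT z|\<mu>. f z) < e"
    using eventually_gt_at_top[of 0]
  proof eventually_elim
    case (elim n)
    note p = \<nu>_ball[OF elim(2)] \<mu>_ball
    have "(LINT z|lborel. \<phi> z * log_pot (\<nu> n) z) - (LINT z|lborel. \<phi> z * log_pot \<mu> z) = (LINT z|lborel. \<phi> z * log_pot (\<nu> n) z - \<phi> z * log_pot \<mu> z)"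
      by (rule Bochner_Integration.integral_diff[OF \<phi>i[OF p(1)] \<phi>i[OF p(2)], symmetric])
    also have "\<bar>\<dots>\<bar> \<le> (LINT z|lborel. \<bar>\<phi> z * log_pot (\<nu> n) z - \<phi> z * log_pot \<mu> z\<bar>)" by (rule integral_abs_bound)
    also have "\<dots> \<le> (LINT z|lborel. B * (indicator K z * \<bar>log_pot (\<nu> n) z - log_pot \<mu> z\<bar>))"
    proof (rule integral_mono)
      show "integrable lborel (\<lambda>z. \<bar>\<phi> z * log_pot (\<nu> n) z - \<phi> z * log_pot \<mu> z\<bar>)"
        by (intro integrable_abs Bochner_Integration.integrable_diff \<phi>i p)
      show "integrable lborel (\<lambda>z. B * (indicator K z * \<bar>log_pot (\<nu> n) z - log_pot \<mu> z\<bar>))"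
        by (intro integrable_mult_right integrable_pot_diff[OF p Kb])
      fix z
      have "\<bar>\<phi> z * log_pot (\<nu> n) z - \<phi> z * log_pot \<mu> z\<bar> = \<bar>\<phi> z\<bar> * \<bar>log_pot (\<nu> n) z - log_pot \<mu> z\<bar>"
        by (simp flip: abs_mult right_diff_distrib)
      also have "\<dots> \<le> B * (indicator K z * \<bar>log_pot (\<nu> n) z - log_pot \<mu> z\<bar>)"
        using \<phi>(2)[of z] \<phi>(5)[of z] B by (cases "z \<in> K") (auto intro!: mult_right_mono)
      finally show "\<bar>\<phi> z * log_pot (\<nu> n) z - \<phi> z * log_pot \<mu> z\<bar> \<le> B * (indicator K z * \<bar>log_pot (\<nu> n) z - log_pot \<mu> z\<bar>)" .
    qed
    also have "\<dots> < e/4" using elim(1) by simp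
    finally have "\<bar>(LINT z|lborel. \<phi> z * log_pot (\<nu> n) z) - (LINT z|lborel. \<phi> z * log_pot \<mu> z)\<bar> < e/4" .
    then show ?case using \<phi>(6)[OF p(1)] \<phi>(6)[OF p(2)] e unfolding dist_real_def by linarith
  qed
qed

end

text \<open>
  On \<open>E\<close> both potentials are almost everywhere equal to \<open>ln D - a\<close>, and off \<open>E\<close> both are the \<open>L\<^sup>1\<close> limit
  of the potentials of the zero counting measures.
\<close>

lemma energy_minimizer_potentials_agree:
  assumes M: "energy_minimizer E D \<mu>" and M': "energy_minimizer E D \<mu>'" and conn: "connected (- E)"
  shows "AE z in lborel. log_pot \<mu> z = log_pot \<mu>' z"
proof -
  interpret M: energy_minimizer E D \<mu> by (rule M)
  interpret M': energy_minimizer E D \<mu>' by (rule M')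
  have "mutual_energy D \<mu> \<mu> = mutual_energy D \<mu>' \<mu>'"
    by (intro antisym M.minimal M'.minimal M.\<mu>_E M'.\<mu>_E)
  then have a: "M.a = M'.a" by (simp add: M.a_def M'.a_def)
  have onE: "AE z in lborel. z \<in> E \<longrightarrow> log_pot \<mu> z = log_pot \<mu>' z"
    using M.log_pot_eq_AE_E M'.log_pot_eq_AE_E by eventually_elim (use a in auto)
  have "open (- E)" using compact_imp_closed[OF M.compact_E] by (rule open_Compl)
  then obtain C :: "nat \<Rightarrow> complex set" where C: "\<And>n. compact (C n)" "\<And>n. C n \<subseteq> - E" "\<Union>(range C) = - E"
    using open_Union_compact_subsets by metis
  have onC: "AE z in lborel. z \<in> C k \<longrightarrow> log_pot \<mu> z - log_pot \<mu>' z = 0" for k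
  proof (rule AE_eq_0_if_abs_integral_0)
    have Cb: "C k \<in> sets borel" "bounded (C k)" using C by (auto simp: borel_compact compact_imp_bounded)
    show int: "integrable lborel (\<lambda>z. indicator (C k) z * \<bar>log_pot \<mu> z - log_pot \<mu>' z\<bar>)"
      by (rule integrable_pot_diff[OF M.\<mu>_ball M'.\<mu>_ball Cb])
    let ?I = "\<lambda>\<sigma> n. LINT z|lborel. indicator (C k) z * \<bar>log_pot (zero_counting_measure (chebyshev_poly E n)) z - log_pot \<sigma> z\<bar>"
    have lim: "(\<lambda>n. ?I \<mu> n + ?I \<mu>' n) \<longlonglongrightarrow> 0"
      using tendsto_add[OF M.potential_L1_off_E[OF conn C(1,2), of k] M'.potential_L1_off_E[OF conn C(1,2), of k]] by simp
    have "(LINT z|lborel. indicator (C k) z * \<bar>log_pot \<mu> z - log_pot \<mu>' z\<bar>) \<le> 0"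
    proof (rule tendsto_lowerbound[OF lim])
      show "\<forall>\<^sub>F n in sequentially. (LINT z|lborel. indicator (C k) z * \<bar>log_pot \<mu> z - log_pot \<mu>' z\<bar>) \<le> ?I \<mu> n + ?I \<mu>' n"
        using eventually_gt_at_top[of 0]
      proof eventually_elim
        case (elim n)
        let ?p = "log_pot (zero_counting_measure (chebyshev_poly E n))"
        have i: "integrable lborel (\<lambda>z. indicator (C k) z * \<bar>?p z - log_pot \<mu> z\<bar>)" "integrable lborel (\<lambda>z. indicator (C k) z * \<bar>?p z - log_pot \<mu>' z\<bar>)"
          by (rule integrable_pot_diff[OF M.\<nu>_ball[OF elim] M.\<mu>_ball Cb] integrable_pot_diff[OF M.\<nu>_ball[OF elim] M'.\<mu>_ball Cb])+
        have "(LINT z|lborel. indicator (C k) z * \<bar>log_pot \<mu> z - log_pot \<mu>' z\<bar>) \<le> (LINT z|lborel. indicator (C k) z * \<bar>?p z - log_pot \<mu> z\<bar> + indicator (C k) z * \<bar>?p z - log_pot \<mu>' z\<bar>)"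
          by (rule integral_mono[OF int Bochner_Integration.integrable_add[OF i]]) (auto simp: indicator_def)
        then show ?case using Bochner_Integration.integral_add[OF i] by simp
      qed
    qed simp
    moreover have "0 \<le> (LINT z|lborel. indicator (C k) z * \<bar>log_pot \<mu> z - log_pot \<mu>' z\<bar>)" by (rule integral_nonneg_AE) auto
    ultimately show "(LINT z|lborel. indicator (C k) z * \<bar>log_pot \<mu> z - log_pot \<mu>' z\<bar>) = 0" by linarith
  qed
  then have "AE z in lborel. \<forall>k. z \<in> C k \<longrightarrow> log_pot \<mu> z - log_pot \<mu>' z = 0" by (simp only: AE_all_countable) blast
  then show ?thesis using onE
  proof eventually_elim
    case (elim z)
    show ?case
    proof (cases "z \<in> E")
      case False
      then obtain k where "z \<in> C k" using C(3) by blast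
      then show ?thesis using elim(1) by auto
    qed (use elim in auto)
  qed
qed

text \<open>
  The functions \<open>max 0 (1 - k infdist z C)\<close> decrease to the indicator of a closed set \<open>C\<close>.
\<close>

lemma prob_on_eqI:
  assumes K: "compact K" and \<mu>: "prob_on K \<mu>" and \<nu>: "prob_on K \<nu>"
    and eq: "\<And>f :: complex \<Rightarrow> real. continuous_on UNIV f \<Longrightarrow> compact (closure {z. f z \<noteq> 0}) \<Longrightarrow> (LINT z|\<mu>. f z) = (LINT z|\<nu>. f z)"
  shows "\<mu> = \<nu>"
proof -
  have Kb: "K \<in> sets borel" by (rule borel_compact[OF K])
  have cl: "(\<lambda>k. LINT z|\<sigma>. max 0 (1 - real k * infdist z C)) \<longlonglongrightarrow> measure \<sigma> C"
    if \<sigma>: "prob_on K \<sigma>" and C: "closed C" "C \<noteq> {}" for C \<sigma>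
  proof -
    interpret prob_space \<sigma> using \<sigma> by (simp add: prob_on_def)
    have s: "sets \<sigma> = sets borel" using \<sigma> by (simp add: prob_on_def)
    note [measurable_cong] = s
    have "(\<lambda>k. LINT z|\<sigma>. max 0 (1 - real k * infdist z C)) \<longlonglongrightarrow> (LINT z|\<sigma>. indicator C z)"
    proof (rule integral_dominated_convergence[where w="\<lambda>_. 1"])
      show "(\<lambda>z. max 0 (1 - real k * infdist z C)) \<in> borel_measurable \<sigma>" for k
      proof -
        have "(\<lambda>z. max 0 (1 - real k * infdist z C)) \<in> borel_measurable borel"
          by (intro borel_measurable_continuous_onI continuous_intros)
        then show ?thesis by measurable
      qed
      show "(indicator C :: complex \<Rightarrow> real) \<in> borel_measurable \<sigma>" using C s by (intro borel_measurable_indicator) auto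
      show "AE z in \<sigma>. (\<lambda>k. max 0 (1 - real k * infdist z C)) \<longlonglongrightarrow> indicator C z"
      proof (intro AE_I2)
        fix z
        show "(\<lambda>k. max 0 (1 - real k * infdist z C)) \<longlonglongrightarrow> indicator C z"
        proof (cases "z \<in> C")
          case False
          then have d: "infdist z C > 0" using in_closed_iff_infdist_zero[OF C] infdist_nonneg[of z C] by (simp add: less_le)
          obtain k0 where k0: "1 / infdist z C < real k0" using reals_Archimedean2 by blast
          have "max 0 (1 - real k * infdist z C) = 0" if "k \<ge> k0" for k
          proof -
            have "1 < real k0 * infdist z C" using k0 d by (simp add: divide_less_eq)
            also have "\<dots> \<le> real k * infdist z C" using that d by (intro mult_right_mono) auto
            finally show ?thesis by simp
          qed
          then have "\<forall>\<^sub>F k in sequentially. max 0 (1 - real k * infdist z C) = 0"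
            unfolding eventually_sequentially by blast
          then show ?thesis using False by (simp add: tendsto_eventually)
        qed simp
      qed
      show "AE z in \<sigma>. norm (max 0 (1 - real k * infdist z C)) \<le> 1" for k
        by (intro AE_I2) (auto simp: infdist_nonneg)
    qed simp
    then show ?thesis using C s by simp
  qed
  have closed_eq: "emeasure \<mu> C = emeasure \<nu> C" if "closed C" for C
  proof -
    define C' where "C' = C \<inter> K"
    have C': "compact C'" using that K by (auto simp: C'_def intro: closed_Int_compact)
    have meq: "measure \<mu> C' = measure \<nu> C'"
    proof (cases "C' = {}")
      case False
      have "(\<lambda>k. LINT z|\<mu>. max 0 (1 - real k * infdist z C')) \<longlonglongrightarrow> measure \<mu> C'" "(\<lambda>k. LINT z|\<nu>. max 0 (1 - real k * infdist z C')) \<longlonglongrightarrow> measure \<nu> C'"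
        using cl[OF \<mu> compact_imp_closed[OF C'] False] cl[OF \<nu> compact_imp_closed[OF C'] False] by auto
      moreover have "\<forall>\<^sub>F k in sequentially. (LINT z|\<mu>. max 0 (1 - real k * infdist z C')) = (LINT z|\<nu>. max 0 (1 - real k * infdist z C'))"
        using eventually_gt_at_top[of 0]
      proof eventually_elim
        case (elim k)
        have sub: "{z. max 0 (1 - real k * infdist z C') \<noteq> 0} \<subseteq> {z. infdist z C' \<le> 1}"
        proof
          fix z assume "z \<in> {z. max 0 (1 - real k * infdist z C') \<noteq> 0}"
          then have "real k * infdist z C' < 1" by (auto simp: max_def split: if_splits)
          moreover have "infdist z C' \<le> real k * infdist z C'" using elim infdist_nonneg[of z C'] mult_right_mono[of 1 "real k" "infdist z C'"] by simp
          ultimately show "z \<in> {z. infdist z C' \<le> 1}" by simp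
        qed
        have "compact {z. infdist z C' \<le> 1}" by (rule compact_infdist_le[OF False C']) simp
        then have "compact (closure {z. max 0 (1 - real k * infdist z C') \<noteq> 0})"
          using sub by (meson bounded_subset compact_closure compact_imp_bounded)
        then show ?case by (intro eq) (intro continuous_intros)
      qed
      ultimately have "(\<lambda>k. LINT z|\<nu>. max 0 (1 - real k * infdist z C')) \<longlonglongrightarrow> measure \<mu> C'" by (simp add: tendsto_cong)
      then show ?thesis using \<open>(\<lambda>k. LINT z|\<nu>. max 0 (1 - real k * infdist z C')) \<longlonglongrightarrow> measure \<nu> C'\<close> by (rule LIMSEQ_unique)
    qed simp
    have "emeasure \<sigma> C = ennreal (measure \<sigma> C')" if \<sigma>: "prob_on K \<sigma>" for \<sigma>
    proof -
      interpret prob_space \<sigma> using \<sigma> by (simp add: prob_on_def)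
      have s: "sets \<sigma> = sets borel" using \<sigma> by (simp add: prob_on_def)
      have "emeasure \<sigma> C = emeasure \<sigma> C'"
      proof (rule emeasure_eq_AE)
        show "AE z in \<sigma>. (z \<in> C) = (z \<in> C')" using prob_on_AE[OF \<sigma> Kb] by eventually_elim (auto simp: C'_def)
      qed (use s \<open>closed C\<close> C' in \<open>auto simp: borel_compact\<close>)
      then show ?thesis by (simp add: emeasure_eq_measure)
    qed
    then show ?thesis using meq \<mu> \<nu> by simp
  qed
  show ?thesis
  proof (rule measure_eqI_generator_eq[where E="Collect closed" and \<Omega>=UNIV and A="\<lambda>_. UNIV"])
    show "Int_stable (Collect closed :: complex set set)" by (auto simp: Int_stable_def)
    show "sets \<mu> = sigma_sets UNIV (Collect closed)" "sets \<nu> = sigma_sets UNIV (Collect closed)"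
      using \<mu> \<nu> by (simp_all add: prob_on_def borel_eq_closed)
    show "emeasure \<mu> UNIV \<noteq> \<infinity>" for i :: nat
    proof -
      interpret prob_space \<mu> using \<mu> by (simp add: prob_on_def)
      show ?thesis by simp
    qed
  qed (use closed_eq in auto)
qed

lemma energy_minimizer_unique:
  assumes M: "energy_minimizer E D \<mu>" and M': "energy_minimizer E D \<mu>'" and conn: "connected (- E)"
  shows "\<mu> = \<mu>'"
proof -
  interpret M: energy_minimizer E D \<mu> by (rule M)
  interpret M': energy_minimizer E D \<mu>' by (rule M')
  show ?thesis
  proof (rule prob_on_eqI[OF M.compact_E M.\<mu>_E M'.\<mu>_E])
    fix f :: "complex \<Rightarrow> real" assume f: "continuous_on UNIV f" "compact (closure {z. f z \<noteq> 0})"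
    have "\<bar>(LINT z|\<mu>. f z) - (LINT z|\<mu>'. f z)\<bar> \<le> 0"
    proof (rule field_le_epsilon)
      fix e :: real assume "e > 0"
      then have e2: "e/2 > 0" by simp
      show "\<bar>(LINT z|\<mu>. f z) - (LINT z|\<mu>'. f z)\<bar> \<le> 0 + e"
      proof (rule test_function_by_log_potential[OF f subset_UNIV open_UNIV e2])
        fix \<phi> :: "complex \<Rightarrow> real" and B K
        assume \<phi>: "\<phi> \<in> borel_measurable borel"
          and app: "\<And>\<rho> \<nu>. prob_on (cball 0 \<rho>) \<nu> \<Longrightarrow> \<bar>(LINT z|\<nu>. f z) - (LINT z|lborel. \<phi> z * log_pot \<nu> z)\<bar> \<le> e/2"
        note [measurable] = \<phi> borel_measurable_log_pot[OF M.\<mu>_E] borel_measurable_log_pot[OF M'.\<mu>_E]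
        have "(LINT z|lborel. \<phi> z * log_pot \<mu> z) = (LINT z|lborel. \<phi> z * log_pot \<mu>' z)"
        proof (rule integral_cong_AE)
          show "AE z in lborel. \<phi> z * log_pot \<mu> z = \<phi> z * log_pot \<mu>' z"
            using energy_minimizer_potentials_agree[OF M M' conn] by eventually_elim simp
        qed measurable
        then show "\<bar>(LINT z|\<mu>. f z) - (LINT z|\<mu>'. f z)\<bar> \<le> 0 + e"
          using app[OF M.\<mu>_ball] app[OF M'.\<mu>_ball] by linarith
      qed
    qed
    then show "(LINT z|\<mu>. f z) = (LINT z|\<mu>'. f z)" by simp
  qed
qed

section \<open>Existence of the minimizer and the equilibrium measure\<close>

lemma compact_prob_measures_eq:
  assumes "compact E"
  shows "compact_prob_measures E = {\<mu>. prob_on E \<mu>}"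
proof (intro equalityI subsetI)
  fix \<mu> assume "\<mu> \<in> compact_prob_measures E"
  then obtain K where K: "compact K" "K \<subseteq> E" "prob_on K \<mu>" by (auto simp: compact_prob_measures_def prob_on_def)
  then show "\<mu> \<in> {\<mu>. prob_on E \<mu>}" using prob_on_subset[OF K(3,2)] assms by (auto simp: borel_compact)
next
  fix \<mu> assume "\<mu> \<in> {\<mu>. prob_on E \<mu>}"
  then show "\<mu> \<in> compact_prob_measures E" using assms by (auto simp: compact_prob_measures_def prob_on_def)
qed

text \<open>
  With \<open>P\<close> and \<open>Q\<close> the positive and negative parts of the logarithmic kernel, the shifted kernel is
  \<open>P - Q + ln D\<close>.  The integral of \<open>Q\<close> is finite, because \<open>Q \<le> ln D\<close> on \<open>E\<close>, so that it may be
  subtracted; this is where \<open>D \<ge> 1\<close> enters.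
\<close>

lemma log_energy_eq_mutual_energy:
  assumes E: "compact E" "E \<subseteq> cball 0 (D/4)" and D: "D \<ge> 1" and \<mu>: "prob_on E \<mu>"
  shows "log_energy \<mu> = enn2ereal (mutual_energy D \<mu> \<mu>) - ereal (ln D)"
proof -
  interpret M: prob_space \<mu> using \<mu> by (simp add: prob_on_def)
  have [measurable_cong]: "sets \<mu> = sets borel" using \<mu> by (simp add: prob_on_def)
  have Eb: "E \<in> sets borel" by (rule borel_compact[OF E(1)])
  let ?P = "\<lambda>z w. e2ennreal (log_kernel z w)" and ?Q = "\<lambda>z w. e2ennreal (- log_kernel z w)"
  have [measurable]: "(\<lambda>(z,w). log_kernel z w) \<in> borel_measurable (borel \<Otimes>\<^sub>M borel)"
    unfolding log_kernel_def by measurable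
  have lk[measurable]: "(\<lambda>x. log_kernel (f x) (g x)) \<in> borel_measurable N" if "f \<in> borel_measurable N" "g \<in> borel_measurable N" for f g and N :: "'x measure"
    using measurable_compose[OF measurable_Pair[OF that], of "\<lambda>(z,w). log_kernel z w" borel] by simp
  have pw: "shifted_kernel D z w + ?Q z w = ?P z w + ennreal (ln D)" and Qle: "?Q z w \<le> ennreal (ln D)" if "z \<in> E" "w \<in> E" for z w
  proof -
    have "cmod z \<le> D/4" "cmod w \<le> D/4" using that E(2) by auto
    then have c: "cmod (z - w) \<le> D" using norm_triangle_ineq4[of z w] D by linarith
    have "shifted_kernel D z w + ?Q z w = ?P z w + ennreal (ln D) \<and> ?Q z w \<le> ennreal (ln D)"
    proof (cases "z = w")
      case False
      define x where "x = ln (cmod (z - w))"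
      have x: "x \<le> ln D" unfolding x_def using False c D by (intro ln_mono) auto
      have K: "shifted_kernel D z w = ennreal (ln D - x)" using False D by (simp add: shifted_kernel_def x_def ln_div)
      have P: "?P z w = ennreal (- x)" using False by (simp add: log_kernel_def x_def ln_div e2ennreal_ereal)
      have Q: "?Q z w = ennreal x" using False by (simp add: log_kernel_def x_def ln_div e2ennreal_ereal)
      have lD: "ln D \<ge> 0" using D by simp
      have "ennreal (ln D - x) + ennreal x = ennreal (- x) + ennreal (ln D)"
      proof (cases "x \<ge> 0")
        case True
        then show ?thesis using x by (simp add: ennreal_neg flip: ennreal_plus)
      next
        case False
        then show ?thesis using lD by (simp add: ennreal_neg flip: ennreal_plus)
      qed
      then show ?thesis unfolding K P Q using x by (auto intro: ennreal_leI)
    qed (simp add: shifted_kernel_def log_kernel_def e2ennreal_neg)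
    then show "shifted_kernel D z w + ?Q z w = ?P z w + ennreal (ln D)" "?Q z w \<le> ennreal (ln D)" by auto
  qed
  let ?A = "mutual_energy D \<mu> \<mu>"
  let ?PP = "\<integral>\<^sup>+z. \<integral>\<^sup>+w. ?P z w \<partial>\<mu> \<partial>\<mu>" and ?QQ = "\<integral>\<^sup>+z. \<integral>\<^sup>+w. ?Q z w \<partial>\<mu> \<partial>\<mu>"
  have split: "(\<integral>\<^sup>+z. \<integral>\<^sup>+w. F z w + G z w \<partial>\<mu> \<partial>\<mu>) = (\<integral>\<^sup>+z. \<integral>\<^sup>+w. F z w \<partial>\<mu> \<partial>\<mu>) + (\<integral>\<^sup>+z. \<integral>\<^sup>+w. G z w \<partial>\<mu> \<partial>\<mu>)"
    if [measurable]: "(\<lambda>(z,w). F z w) \<in> borel_measurable (borel \<Otimes>\<^sub>M borel)" "(\<lambda>(z,w). G z w) \<in> borel_measurable (borel \<Otimes>\<^sub>M borel)" for F G :: "complex \<Rightarrow> complex \<Rightarrow> ennreal"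
  proof -
    have "(\<integral>\<^sup>+w. F z w + G z w \<partial>\<mu>) = (\<integral>\<^sup>+w. F z w \<partial>\<mu>) + (\<integral>\<^sup>+w. G z w \<partial>\<mu>)" for z
      by (rule nn_integral_add) measurable
    then show ?thesis by (simp only:) (rule nn_integral_add, measurable)
  qed
  have "?A + ?QQ = (\<integral>\<^sup>+z. \<integral>\<^sup>+w. shifted_kernel D z w + ?Q z w \<partial>\<mu> \<partial>\<mu>)"
    unfolding mutual_energy_def by (rule split[symmetric]) measurable
  also have "\<dots> = (\<integral>\<^sup>+z. \<integral>\<^sup>+w. ?P z w + ennreal (ln D) \<partial>\<mu> \<partial>\<mu>)"
  proof (rule nn_integral_cong_AE)
    show "AE z in \<mu>. (\<integral>\<^sup>+w. shifted_kernel D z w + ?Q z w \<partial>\<mu>) = (\<integral>\<^sup>+w. ?P z w + ennreal (ln D) \<partial>\<mu>)"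
      using prob_on_AE[OF \<mu> Eb]
    proof eventually_elim
      case (elim z)
      show ?case by (rule nn_integral_cong_AE) (use prob_on_AE[OF \<mu> Eb] in eventually_elim, use elim pw in auto)
    qed
  qed
  also have "\<dots> = ?PP + (\<integral>\<^sup>+z. \<integral>\<^sup>+w. ennreal (ln D) \<partial>\<mu> \<partial>\<mu>)" by (rule split) measurable
  also have "(\<integral>\<^sup>+z. \<integral>\<^sup>+w. ennreal (ln D) \<partial>\<mu> \<partial>\<mu>) = ennreal (ln D)" by (simp add: M.emeasure_space_1)
  finally have eq: "?A + ?QQ = ?PP + ennreal (ln D)" .
  have "?QQ \<le> (\<integral>\<^sup>+z. \<integral>\<^sup>+w. ennreal (ln D) \<partial>\<mu> \<partial>\<mu>)"
  proof (rule nn_integral_mono_AE)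
    show "AE z in \<mu>. (\<integral>\<^sup>+w. ?Q z w \<partial>\<mu>) \<le> (\<integral>\<^sup>+w. ennreal (ln D) \<partial>\<mu>)"
      using prob_on_AE[OF \<mu> Eb]
    proof eventually_elim
      case (elim z)
      show ?case by (rule nn_integral_mono_AE) (use prob_on_AE[OF \<mu> Eb] in eventually_elim, use elim Qle in auto)
    qed
  qed
  also have "\<dots> = ennreal (ln D)" by (simp add: M.emeasure_space_1)
  finally obtain q where q: "?QQ = ennreal q" "q \<ge> 0" by (cases ?QQ) (auto simp: top_unique)
  have lD: "ln D \<ge> 0" using D by simp
  have "enn2ereal ?A + ereal q = enn2ereal ?PP + ereal (ln D)"
    using arg_cong[OF eq, of enn2ereal] q lD by (simp add: plus_ennreal.rep_eq)
  then have "enn2ereal ?PP - ereal q = enn2ereal ?A - ereal (ln D)"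
    by (cases "enn2ereal ?PP"; cases "enn2ereal ?A") (auto simp: algebra_simps)
  then show ?thesis using q by (simp add: log_energy_def)
qed


lemma trunc_energy_le_mutual:
  assumes K: "compact K" and d: "\<delta> > 0" "\<delta> \<le> D" and KD: "\<And>z w. z \<in> K \<Longrightarrow> w \<in> K \<Longrightarrow> cmod (z - w) \<le> D" and \<nu>: "prob_on K \<nu>"
    and c: "mutual_energy D \<nu> \<nu> \<le> ennreal c" "c \<ge> 0"
  shows "(LINT z|\<nu>. LINT w|\<nu>. trunc_kernel D \<delta> z w) \<le> c"
proof -
  have "ennreal (LINT z|\<nu>. LINT w|\<nu>. trunc_kernel D \<delta> z w) = (\<integral>\<^sup>+z. \<integral>\<^sup>+w. ennreal (trunc_kernel D \<delta> z w) \<partial>\<nu> \<partial>\<nu>)"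
    by (rule nn_integral_trunc_energy[OF K d KD \<nu>, symmetric])
  also have "\<dots> \<le> mutual_energy D \<nu> \<nu>"
    unfolding mutual_energy_def by (intro nn_integral_mono trunc_kernel_le_shifted) (use d in auto)
  also have "\<dots> \<le> ennreal c" by (rule c(1))
  finally show ?thesis using c(2) by (simp add: ennreal_le_iff)
qed

text \<open>
  A minimizing sequence has a weak limit along a subsequence, and the energy is lower
  semicontinuous.
\<close>

lemma energy_minimizer_exists:
  assumes E: "compact E" "E \<subseteq> cball 0 (D/4)" and D: "D > 0" and \<sigma>: "prob_on E \<sigma>" "mutual_energy D \<sigma> \<sigma> < \<infinity>"
  obtains \<mu> where "energy_minimizer E D \<mu>"
proof -
  have ED: "cmod (z - w) \<le> D" if "z \<in> E" "w \<in> E" for z w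
  proof -
    have "cmod z \<le> D/4" "cmod w \<le> D/4" using that E(2) by auto
    then show ?thesis using norm_triangle_ineq4[of z w] D by linarith
  qed
  define m where "m = (INF \<mu>\<in>{\<mu>. prob_on E \<mu>}. mutual_energy D \<mu> \<mu>)"
  have "m \<le> mutual_energy D \<sigma> \<sigma>" unfolding m_def using \<sigma>(1) by (intro INF_lower) simp
  then have "m < \<infinity>" using \<sigma>(2) by (rule le_less_trans)
  then obtain r where r: "m = ennreal r" "r \<ge> 0" by (cases m) auto
  have "\<exists>\<nu>. prob_on E \<nu> \<and> mutual_energy D \<nu> \<nu> \<le> ennreal (r + 1 / (real n + 1))" for n
  proof -
    have "m < ennreal (r + 1 / (real n + 1))" unfolding r(1) using r(2) by (intro ennreal_lessI) (auto intro!: add_nonneg_pos)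
    then show ?thesis unfolding m_def INF_less_iff by (auto intro: less_imp_le)
  qed
  then obtain \<nu> where \<nu>: "\<And>n. prob_on E (\<nu> n)" "\<And>n. mutual_energy D (\<nu> n) (\<nu> n) \<le> ennreal (r + 1 / (real n + 1))"
    by metis
  obtain \<mu> where \<mu>: "prob_on E \<mu>" "mutual_energy D \<mu> \<mu> \<le> ennreal r"
  proof (rule energy_lower_semicontinuous[OF E(1) D ED \<nu>(1), where c=r])
    fix \<delta> e :: real assume \<delta>: "\<delta> > 0" "\<delta> \<le> D" and e: "e > 0"
    have "(\<lambda>k. 1 / (real k + 1)) \<longlonglongrightarrow> 0"
      using LIMSEQ_inverse_real_of_nat by (simp add: divide_inverse add.commute)
    then have "\<forall>\<^sub>F k in sequentially. 1 / (real k + 1) < e" using e by (intro order_tendstoD(2))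
    then show "\<forall>\<^sub>F k in sequentially. (LINT z|\<nu> k. LINT w|\<nu> k. trunc_kernel D \<delta> z w) \<le> r + e"
    proof eventually_elim
      case (elim k)
      have "(LINT z|\<nu> k. LINT w|\<nu> k. trunc_kernel D \<delta> z w) \<le> r + 1 / (real k + 1)"
        by (rule trunc_energy_le_mutual[OF E(1) \<delta> ED \<nu>(1) \<nu>(2)]) (use r in auto)
      then show ?case using elim by linarith
    qed
  qed
  show thesis
  proof (rule that, unfold_locales)
    show "mutual_energy D \<mu> \<mu> < \<infinity>" using \<mu>(2) by (simp add: le_less_trans)
    fix \<sigma>' assume "prob_on E \<sigma>'"
    then have "m \<le> mutual_energy D \<sigma>' \<sigma>'" unfolding m_def by (intro INF_lower) simp
    then show "mutual_energy D \<mu> \<mu> \<le> mutual_energy D \<sigma>' \<sigma>'" using \<mu>(2) r(1) by simp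
  qed (use E D \<mu> in auto)
qed

lemma finite_energy_if_capacity_pos:
  assumes "log_capacity A > 0" "A \<subseteq> E" "compact E" "E \<subseteq> cball 0 (D/4)" "D \<ge> 1"
  obtains \<sigma> where "prob_on E \<sigma>" "mutual_energy D \<sigma> \<sigma> < \<infinity>"
proof -
  obtain \<sigma> where \<sigma>: "\<sigma> \<in> compact_prob_measures A" "log_energy \<sigma> \<noteq> \<infinity>"
    using assms(1) unfolding log_capacity_def less_SUP_iff by (auto split: if_splits)
  have "\<sigma> \<in> compact_prob_measures E" using \<sigma>(1) assms(2) unfolding compact_prob_measures_def by blast
  then have p: "prob_on E \<sigma>" using compact_prob_measures_eq[OF assms(3)] by simp
  have "mutual_energy D \<sigma> \<sigma> \<noteq> \<infinity>"
  proof
    assume "mutual_energy D \<sigma> \<sigma> = \<infinity>"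
    then have "log_energy \<sigma> = \<infinity>" using log_energy_eq_mutual_energy[OF assms(3-5) p] by simp
    then show False using \<sigma>(2) by simp
  qed
  then have "mutual_energy D \<sigma> \<sigma> < \<infinity>" by (simp add: less_top)
  with p show ?thesis by (rule that)
qed

lemma equilibrium_measure_eq_minimizer:
  assumes M: "energy_minimizer E D \<mu>" and D: "D \<ge> 1" and conn: "connected (- E)"
  shows "equilibrium_measure E = \<mu>"
  unfolding equilibrium_measure_def
proof (rule the_equality)
  interpret M: energy_minimizer E D \<mu> by (rule M)
  note cpm = compact_prob_measures_eq[OF M.compact_E]
  note le = log_energy_eq_mutual_energy[OF M.compact_E M.E_ball D]
  have mono: "log_energy \<nu> \<le> log_energy \<nu>' \<longleftrightarrow> mutual_energy D \<nu> \<nu> \<le> mutual_energy D \<nu>' \<nu>'"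
    if "prob_on E \<nu>" "prob_on E \<nu>'" for \<nu> \<nu>'
    unfolding le[OF that(1)] le[OF that(2)] less_eq_ennreal.rep_eq
    by (cases "enn2ereal (mutual_energy D \<nu> \<nu>)"; cases "enn2ereal (mutual_energy D \<nu>' \<nu>')") auto
  show "\<mu> \<in> compact_prob_measures E \<and> (\<forall>\<nu>\<in>compact_prob_measures E. log_energy \<mu> \<le> log_energy \<nu>)"
    unfolding cpm using M.\<mu>_E M.minimal mono by auto
  fix \<mu>' assume m': "\<mu>' \<in> compact_prob_measures E \<and> (\<forall>\<nu>\<in>compact_prob_measures E. log_energy \<mu>' \<le> log_energy \<nu>)"
  have p': "prob_on E \<mu>'" using m' by (simp add: cpm)
  have min': "mutual_energy D \<mu>' \<mu>' \<le> mutual_energy D \<nu> \<nu>" if "prob_on E \<nu>" for \<nu>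
    using m' that mono[OF p' that] by (auto simp: cpm)
  have "energy_minimizer E D \<mu>'"
  proof unfold_locales
    show "mutual_energy D \<mu>' \<mu>' < \<infinity>" using min'[OF M.\<mu>_E] M.energy_finite by (rule le_less_trans)
  qed (use M.compact_E M.E_ball M.D_pos p' min' in auto)
  then show "\<mu>' = \<mu>" by (rule energy_minimizer_unique[OF _ M conn])
qed

lemma integral_restrict_space_supported:
  fixes f :: "complex \<Rightarrow> real"
  assumes "sets M = sets borel" "open N" "\<And>z. z \<notin> N \<Longrightarrow> f z = 0"
  shows "(LINT z|restrict_space M N. f z) = (LINT z|M. f z)"
proof -
  have "N \<inter> space M \<in> sets M" using assms(1,2) sets_eq_imp_space_eq[OF assms(1)] by simp
  then have "(LINT z|restrict_space M N. f z) = (LINT z|M. indicator N z *\<^sub>R f z)"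
    by (rule integral_restrict_space)
  also have "(\<lambda>z. indicator N z *\<^sub>R f z) = f" using assms(3) by (auto simp: fun_eq_iff indicator_def)
  finally show ?thesis .
qed

theorem theorem1p2:
  fixes E N :: "complex set"
  assumes "compact E" and "infinite E" and "connected (- E)"
    and "open N" and "connected N" and "simply_connected N"
    and "log_capacity (N \<inter> E) > 0"
    and "N \<inter> E \<in> null_sets lborel"
  shows "weakly_converges_on N
           (\<lambda>n. restrict_space (zero_counting_measure (chebyshev_poly E n)) N)
           (restrict_space (equilibrium_measure E) N)"
proof -
  obtain R where R: "\<forall>z\<in>E. cmod z \<le> R" using compact_imp_bounded[OF assms(1)] by (auto simp: bounded_iff)
  define D where "D = max 1 (4 * R)"
  have D: "D \<ge> 1" "E \<subseteq> cball 0 (D/4)" using R by (force simp: D_def)+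
  obtain \<sigma> where \<sigma>: "prob_on E \<sigma>" "mutual_energy D \<sigma> \<sigma> < \<infinity>"
    by (rule finite_energy_if_capacity_pos[OF assms(7) _ assms(1) D(2,1)]) auto
  obtain \<mu> where \<mu>: "energy_minimizer E D \<mu>"
    by (rule energy_minimizer_exists[OF assms(1) D(2) _ \<sigma>]) (use D in auto)
  interpret energy_minimizer E D \<mu> by (rule \<mu>)
  have eq: "equilibrium_measure E = \<mu>" by (rule equilibrium_measure_eq_minimizer[OF \<mu> D(1) assms(3)])
  show ?thesis
    unfolding weakly_converges_on_def eq
  proof (intro allI impI)
    fix f :: "complex \<Rightarrow> real"
    assume f: "continuous_on UNIV f" "compact (closure {z. f z \<noteq> 0})" "closure {z. f z \<noteq> 0} \<subseteq> N"
    have f0: "f z = 0" if "z \<notin> N" for z using that f(3) closure_subset[of "{z. f z \<noteq> 0}"] by blast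
    have "(LINT z|restrict_space (\<nu> n) N. f z) = (LINT z|\<nu> n. f z)" for n
      by (rule integral_restrict_space_supported) (use assms(4) f0 in \<open>auto simp: zero_counting_measure_def\<close>)
    moreover have "(LINT z|restrict_space \<mu> N. f z) = (LINT z|\<mu>. f z)"
      by (rule integral_restrict_space_supported) (use assms(4) f0 sets_\<mu> in auto)
    ultimately show "(\<lambda>n. LINT z|restrict_space (\<nu> n) N. f z) \<longlonglongrightarrow> (LINT z|restrict_space \<mu> N. f z)"
      using zeros_integral_tendsto[OF assms(3,4,8) f] by simp
  qed
qed

end
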